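(* Let $W_S=H_S\wr_X\mathrm{Sym}(X)$, where $H_S$ is a finite group, $M_S$ is the number of conjugacy classes of $H_S$, and $X$ is an infinite set. If $S^{(W_S)}$ is a sufficiently large (that is, PCwr) generating set of $W_S$ and $\gamma_{W_S}(n)=\gamma_{W_S,S^{(W_S)}}(n)$, then as $n\to\infty$ $$\gamma_{W_S}(n)\sim\left(\frac{M_S^{\frac{1+M_S}{4}}}{2^{\frac{5+3M_S}{4}}\,3^{\frac{1+M_S}{4}}\,n^{\frac{3+M_S}{4}}}\right)e^{\pi\sqrt{\frac{2nM_S}{3}}}.$$
   Context: $f(n)\sim g(n)$ means $f(n)/g(n)\to1$ as $n\to\infty$. $\mathrm{Sym}(X)$ is the group of permutations of the infinite set $X$ with finite support. For a group $H$, $H^{(X)}$ is the group of functions $X\to H$ with finite support (value $1$ outside a finite set), and $H\wr_X\mathrm{Sym}(X):=H^{(X)}\rtimes\mathrm{Sym}(X)$, where $f\in\mathrm{Sym}(X)$ acts by $\psi\mapsto f(\psi)=\psi\circ f^{-1}$ and $(\varphi,f)(\psi,g)=(\varphi f(\psi),fg)$. For a group $G$ generated by a set $S$, the word length $\ell_{G,S}(g)$ is the smallest $n\ge0$ such that $g=s_1\cdots s_n$ with $s_i\in S\cup S^{-1}$; the conjugacy length $\kappa_{G,S}(g)$ is the smallest word length of an element of the conjugacy class of $g$; $\gamma_{G,S}(n)$ is the number of conjugacy classes of $G$ whose conjugacy length is $n$. Sufficiently large (PCwr) generating sets of $W=H\wr_X\mathrm{Sym}(X)$: for $a\in H\setminus\{1\}$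 and $u\in X$ let $\varphi_u^a\in H^{(X)}\subset W$ be the function with value $a$ at $u$ and $1$ elsewhere. Let $T_H=\{\varphi_u^a: a\in H\setminus\{1\},u\in X\}$ and let $T_X\subset\mathrm{Sym}(X)\subset W$ be the set of all transpositions $(x\ y)$ of distinct elements of $X$. Let $S=S_H\sqcup S_X$ with $S_H\subset T_H$, $S_X\subset T_X$. The transposition graph $\Gamma(S_X)$ has vertex set $X$ and an edge $\{x,y\}$ for each $(x\ y)\in S_X$. The set $S$ is PCwr ("partition-complete for wreath products") if (i) $\Gamma(S_X)$ is connected, and (ii) for all $L\ge0$ and all partitions $\lambda=(\lambda_1,\dots,\lambda_k)$ of $L$, $\Gamma(S_X)$ contains a forest of $k$ trees $T_1,\dots,T_k$, where $T_i$ has $\lambda_i$ vertices, including one vertex $x^{(i)}$ such that $\varphi_{x^{(i)}}^a\in S_H$ for all $a\in H\setminus\{1\}$. *)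

theory Defs
  imports
    "HOL-Algebra.Product_Groups"
    "HOL-Algebra.Generated_Groups"
    "HOL-Combinatorics.Permutations"
    "HOL-Library.Landau_Symbols"
begin

section \<open>Conjugacy growth\<close>

definition conj_class :: "('a, 'b) monoid_scheme \<Rightarrow> 'a \<Rightarrow> 'a set" where
  "conj_class G g = {h \<otimes>\<^bsub>G\<^esub> g \<otimes>\<^bsub>G\<^esub> inv\<^bsub>G\<^esub> h | h. h \<in> carrier G}"

definition word_length :: "('a, 'b) monoid_scheme \<Rightarrow> 'a set \<Rightarrow> 'a \<Rightarrow> nat" where
  "word_length G S g =
     (LEAST n. \<exists>ss. length ss = n \<and> set ss \<subseteq> S \<union> m_inv G ` S \<and> g = foldr (\<otimes>\<^bsub>G\<^esub>) ss \<one>\<^bsub>G\<^esub>)"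

definition conj_length :: "('a, 'b) monoid_scheme \<Rightarrow> 'a set \<Rightarrow> 'a \<Rightarrow> nat" where
  "conj_length G S g = (LEAST n. \<exists>h \<in> conj_class G g. word_length G S h = n)"

text \<open>
  As \<open>card\<close> is 0 on infinite sets, a value \<open>conj_growth G S n = 0\<close> does not by itself say that
  no class has conjugacy length \<open>n\<close>; a positive value is always the true number of such classes.
\<close>

definition conj_growth :: "('a, 'b) monoid_scheme \<Rightarrow> 'a set \<Rightarrow> nat \<Rightarrow> nat" where
  "conj_growth G S n = card {conj_class G g | g. g \<in> carrier G \<and> conj_length G S g = n}"

definition num_conj_classes :: "('a, 'b) monoid_scheme \<Rightarrow> nat" where
  "num_conj_classes G = card {conj_class G g | g. g \<in> carrier G}"


section \<open>The wreath product with the finitary symmetric group\<close>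

definition fin_sym_group :: "'x set \<Rightarrow> ('x \<Rightarrow> 'x) monoid" where
  "fin_sym_group X =
     \<lparr> carrier = {f. f permutes X \<and> finite {x. f x \<noteq> x}}, monoid.mult = (\<circ>), one = id \<rparr>"

text \<open>
  The group of finitely supported functions from \<open>X\<close> to \<open>H\<close> is the restricted direct product
  \<open>sum_group X (\<lambda>_. H)\<close>, whose elements are \<open>undefined\<close> outside \<open>X\<close>. Permutations of \<open>X\<close> are the
  identity outside \<open>X\<close>, so precomposing with one stays within this group.
\<close>

definition wreath ::
  "('h, 'm) monoid_scheme \<Rightarrow> 'x set \<Rightarrow> (('x \<Rightarrow> 'h) \<times> ('x \<Rightarrow> 'x)) monoid" where
  "wreath H X =
     \<lparr> carrier = carrier (sum_group X (\<lambda>_. H)) \<times> carrier (fin_sym_group X),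
       monoid.mult = (\<lambda>(\<phi>, f) (\<psi>, g).
         (\<phi> \<otimes>\<^bsub>sum_group X (\<lambda>_. H)\<^esub> (\<psi> \<circ> inv_into UNIV f), f \<circ> g)),
       one = (\<one>\<^bsub>sum_group X (\<lambda>_. H)\<^esub>, id) \<rparr>"

definition wr_single ::
  "('h, 'm) monoid_scheme \<Rightarrow> 'x set \<Rightarrow> 'x \<Rightarrow> 'h \<Rightarrow> ('x \<Rightarrow> 'h) \<times> ('x \<Rightarrow> 'x)" where
  "wr_single H X u a = ((\<lambda>x\<in>X. if x = u then a else \<one>\<^bsub>H\<^esub>), id)"

definition wr_transp ::
  "('h, 'm) monoid_scheme \<Rightarrow> 'x set \<Rightarrow> 'x \<Rightarrow> 'x \<Rightarrow> ('x \<Rightarrow> 'h) \<times> ('x \<Rightarrow> 'x)" where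
  "wr_transp H X x y = (\<one>\<^bsub>sum_group X (\<lambda>_. H)\<^esub>, Transposition.transpose x y)"

definition wr_singles ::
  "('h, 'm) monoid_scheme \<Rightarrow> 'x set \<Rightarrow> (('x \<Rightarrow> 'h) \<times> ('x \<Rightarrow> 'x)) set" where
  "wr_singles H X = {wr_single H X u a | u a. u \<in> X \<and> a \<in> carrier H - {\<one>\<^bsub>H\<^esub>}}"

definition wr_transps ::
  "('h, 'm) monoid_scheme \<Rightarrow> 'x set \<Rightarrow> (('x \<Rightarrow> 'h) \<times> ('x \<Rightarrow> 'x)) set" where
  "wr_transps H X = {wr_transp H X x y | x y. x \<in> X \<and> y \<in> X \<and> x \<noteq> y}"


section \<open>Simple graphs and trees\<close>

text \<open>
  A simple graph is given by a vertex set \<open>V\<close> and a set \<open>E\<close> of two-element subsets of \<open>V\<close>.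
  A cycle is listed by its pairwise distinct vertices, of which there are at least three.
\<close>

definition simple_graph :: "'x set \<Rightarrow> 'x set set \<Rightarrow> bool" where
  "simple_graph V E \<longleftrightarrow> (\<forall>e\<in>E. e \<subseteq> V \<and> card e = 2)"

definition graph_connected :: "'x set \<Rightarrow> 'x set set \<Rightarrow> bool" where
  "graph_connected V E \<longleftrightarrow> V \<noteq> {} \<and> (\<forall>x\<in>V. \<forall>y\<in>V. (x, y) \<in> {(u, v). {u, v} \<in> E}\<^sup>*)"

definition graph_cycle :: "'x set set \<Rightarrow> 'x list \<Rightarrow> bool" where
  "graph_cycle E vs \<longleftrightarrow> length vs \<ge> 3 \<and> distinct vs \<and>
     (\<forall>i < length vs. {vs ! i, vs ! (Suc i mod length vs)} \<in> E)"

definition graph_tree :: "'x set \<Rightarrow> 'x set set \<Rightarrow> bool" where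
  "graph_tree V E \<longleftrightarrow> simple_graph V E \<and> graph_connected V E \<and> (\<nexists>vs. graph_cycle E vs)"


section \<open>PCwr sets\<close>

definition transp_graph_edges ::
  "('h, 'm) monoid_scheme \<Rightarrow> 'x set \<Rightarrow> (('x \<Rightarrow> 'h) \<times> ('x \<Rightarrow> 'x)) set \<Rightarrow> 'x set set" where
  "transp_graph_edges H X SX =
     {{x, y} | x y. x \<in> X \<and> y \<in> X \<and> x \<noteq> y \<and> wr_transp H X x y \<in> SX}"

definition is_partition :: "nat list \<Rightarrow> nat \<Rightarrow> bool" where
  "is_partition ps L \<longleftrightarrow> sorted_wrt (\<ge>) ps \<and> 0 \<notin> set ps \<and> sum_list ps = L"

text \<open>
  The trees \<open>(V i, E i)\<close> of the forest are subgraphs of the transposition graph, not necessarily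
  induced ones, with pairwise disjoint vertex sets.
\<close>

definition PCwr ::
  "('h, 'm) monoid_scheme \<Rightarrow> 'x set \<Rightarrow> (('x \<Rightarrow> 'h) \<times> ('x \<Rightarrow> 'x)) set \<Rightarrow> bool" where
  "PCwr H X S \<longleftrightarrow>
     (\<exists>SH SX. SH \<subseteq> wr_singles H X \<and> SX \<subseteq> wr_transps H X \<and> S = SH \<union> SX \<and> SH \<inter> SX = {} \<and>
        graph_connected X (transp_graph_edges H X SX) \<and>
        (\<forall>L ps. is_partition ps L \<longrightarrow>
           (\<exists>V E. (\<forall>i < length ps.
                      graph_tree (V i) (E i) \<and> V i \<subseteq> X \<and> E i \<subseteq> transp_graph_edges H X SX \<and>
                      finite (V i) \<and> card (V i) = ps ! i \<and>
                      (\<exists>x \<in> V i. \<forall>a \<in> carrier H - {\<one>\<^bsub>H\<^esub>}. wr_single H X x a \<in> SH)) \<and>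
                  disjoint_family_on V {..<length ps})))"

end

(*
  An element of the wreath product is determined up to conjugacy by the number of its cycles of
  each length k and each class C of the holonomy (the product of the labels along the cycle), the
  fixed points with trivial label being ignored. A cycle costs k - 1 generators if C is trivial and
  k otherwise. This many suffice because a PCwr set contains disjoint trees, and the product of the
  edges of a tree is a full cycle. Fewer do not: a word of length n with letters on a finite set A
  leaves at least card A - n disjoint nonempty invariant blocks with trivial labels, since each
  letter destroys one block or merges two, and each block contains a cycle of trivial holonomy.
  Hence the growth series is the product of (1 - q^m)^(-M) over m > 0.

  The coefficients are estimated by the circle method with q = exp (-t) and saddle point
  t = pi * sqrt (M / (6 * n)). With L(w) the Lambert series, the product is exp (M * L(w)). Around
  the saddle point a second order expansion of L along the circle only needs real asymptotics, and
  Re L(w) - L(|w|) is bounded by its first term, which gives an integrable majorant for dominated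
  convergence. The constant comes from L(exp (-t)) = pi^2 / (6 t) + ln (t / (2 pi)) / 2 + o(1),
  obtained with the trapezoid rule after subtracting a comparison function with the same
  logarithmic singularity.
*)

theory Submission
  imports
    Defs
    "HOL-Combinatorics.Orbits"
    "HOL-Probability.Sinc_Integral"
    "HOL-Real_Asymp.Real_Asymp"
begin

section \<open>Lambert series\<close>

text \<open>Two different accuracies are needed at the saddle point. At the positive axis the j-th
  derivative of L along the circle of radius exp (-t) has size t^(-j-1), so with theta = t^(3/2) * u
  the quadratic term is of order 1 and the cubic one of order t^(1/2). The linear term has to cancel
  n * theta only up to o(1), so an error o(t^(-3/2)) in the first derivative is harmless and its
  main term pi^2 / (6 t^2) is enough; this is why the saddle point has a closed form. The value
  L(exp (-t)) is exponentiated and therefore needed up to o(1), including its logarithm. The power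
  n^(-(3+M)/4) is t^((3+M)/2) up to a constant: t^(3/2) is the scale of the arc, and t^(M/2) comes
  from M * ln t / 2. On the group side, all but finitely many points are fixed with trivial label,
  so counting makes sense only for the other tags, and conjugating elements are built on a finite
  set that contains both supports.\<close>

definition psum1 :: "real \<Rightarrow> real" where
  "psum1 x = exp (-x) / (1 - exp (-x))\<^sup>2"

definition psum2 :: "real \<Rightarrow> real" where
  "psum2 x = exp (-x) * (1 + exp (-x)) / (1 - exp (-x)) ^ 3"

definition psum3 :: "real \<Rightarrow> real" where
  "psum3 x = exp (-x) * (1 + 4 * exp (-x) + (exp (-x))\<^sup>2) / (1 - exp (-x)) ^ 4"

lemma pow_times_exp_tendsto_0:
  fixes q :: real
  assumes "0 < q" "q < 1"
  shows "(\<lambda>m. real m ^ j * q ^ m) \<longlonglongrightarrow> 0"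
proof -
  define c where "c = - ln q"
  have "c > 0" "q = exp (-c)" using assms by (auto simp: c_def)
  hence *: "(\<lambda>m. real m ^ j * q ^ m) = (\<lambda>m. real m ^ j * exp (- c * real m))"
    by (simp add: exp_of_nat_mult[symmetric] mult.commute)
  show ?thesis unfolding * using \<open>c > 0\<close> by real_asymp
qed

text \<open>Telescoping: with \<open>p = 1 / (1 - q)\<close> the sequence p * q^m * g(m) has the
  differences m^j * q^m as soon as p * g(m) - (p - 1) * g(m + 1) = m^j. This is solved by the sum
  over i of (p - 1)^i times the i-th forward difference of m^j, which yields the coefficients of
  \<open>g\<close> here and in the next two lemmas.\<close>

lemma psum1_sums:
  assumes "x > 0"
  shows "(\<lambda>m. real m ^ 1 * exp (-x) ^ m) sums psum1 x"
proof -
  define q where "q = exp (-x)"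
  define p where "p = 1 / (1 - q)"
  have q: "0 < q" "q < 1" using assms by (auto simp: q_def)
  have pq: "p * q = p - 1" using q by (simp add: p_def field_simps)
  have p1: "p - 1 = p * q" using pq by simp
  have ps: "psum1 x = q * p ^ 2"
    unfolding psum1_def q_def[symmetric] p_def by (simp add: power_one_over)
  define h where "h = (\<lambda>m. p * 1 * (real m ^ 1 * q ^ m) + p * (p - 1) * (real m ^ 0 * q ^ m))"
  have "h \<longlonglongrightarrow> p * 1 * 0 + p * (p - 1) * 0"
    unfolding h_def by (intro tendsto_add tendsto_mult_left pow_times_exp_tendsto_0 q)
  hence "(\<lambda>m. h m - h (Suc m)) sums (h 0 - 0)" by (intro telescope_sums') simp
  moreover have "h m - h (Suc m) = real m ^ 1 * q ^ m" for m
  proof -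
    define g where "g = (\<lambda>x. 1 * x ^ 1 + (p - 1) * x ^ 0)"
    have "h k = p * q ^ k * g (real k)" for k by (simp add: h_def g_def algebra_simps)
    hence "h m - h (Suc m) = q ^ m * (p * g (real m) - (p * q) * g (real m + 1))"
      by (simp add: algebra_simps)
    also have "p * g (real m) - (p * q) * g (real m + 1) = real m ^ 1"
      unfolding pq g_def by (simp add: algebra_simps power2_eq_square power3_eq_cube)
    finally show ?thesis by simp
  qed
  moreover have "h 0 = psum1 x"
    by (simp add: h_def p1 ps algebra_simps power_eq_if)
  ultimately show ?thesis by (simp add: q_def)
qed

lemma psum2_sums:
  assumes "x > 0"
  shows "(\<lambda>m. real m ^ 2 * exp (-x) ^ m) sums psum2 x"
proof -
  define q where "q = exp (-x)"
  define p where "p = 1 / (1 - q)"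
  have q: "0 < q" "q < 1" using assms by (auto simp: q_def)
  have pq: "p * q = p - 1" using q by (simp add: p_def field_simps)
  have p1: "p - 1 = p * q" using pq by simp
  have ps: "psum2 x = q * (1 + q) * p ^ 3"
    unfolding psum2_def q_def[symmetric] p_def by (simp add: power_one_over)
  define h where "h = (\<lambda>m. p * 1 * (real m ^ 2 * q ^ m) + p * (2 * (p - 1)) * (real m ^ 1 * q ^ m) + p * ((p - 1) * (p + (p - 1))) * (real m ^ 0 * q ^ m))"
  have "h \<longlonglongrightarrow> p * 1 * 0 + p * (2 * (p - 1)) * 0 + p * ((p - 1) * (p + (p - 1))) * 0"
    unfolding h_def by (intro tendsto_add tendsto_mult_left pow_times_exp_tendsto_0 q)
  hence "(\<lambda>m. h m - h (Suc m)) sums (h 0 - 0)" by (intro telescope_sums') simp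
  moreover have "h m - h (Suc m) = real m ^ 2 * q ^ m" for m
  proof -
    define g where "g = (\<lambda>x. 1 * x ^ 2 + (2 * (p - 1)) * x ^ 1 + ((p - 1) * (p + (p - 1))) * x ^ 0)"
    have "h k = p * q ^ k * g (real k)" for k by (simp add: h_def g_def algebra_simps)
    hence "h m - h (Suc m) = q ^ m * (p * g (real m) - (p * q) * g (real m + 1))"
      by (simp add: algebra_simps)
    also have "p * g (real m) - (p * q) * g (real m + 1) = real m ^ 2"
      unfolding pq g_def by (simp add: algebra_simps power2_eq_square power3_eq_cube)
    finally show ?thesis by simp
  qed
  moreover have "h 0 = psum2 x"
    by (simp add: h_def p1 ps algebra_simps power_eq_if)
  ultimately show ?thesis by (simp add: q_def)
qed

lemma psum3_sums:
  assumes "x > 0"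
  shows "(\<lambda>m. real m ^ 3 * exp (-x) ^ m) sums psum3 x"
proof -
  define q where "q = exp (-x)"
  define p where "p = 1 / (1 - q)"
  have q: "0 < q" "q < 1" using assms by (auto simp: q_def)
  have pq: "p * q = p - 1" using q by (simp add: p_def field_simps)
  have p1: "p - 1 = p * q" using pq by simp
  have ps: "psum3 x = q * (1 + 4 * q + q ^ 2) * p ^ 4"
    unfolding psum3_def q_def[symmetric] p_def by (simp add: power_one_over)
  define h where "h = (\<lambda>m. p * 1 * (real m ^ 3 * q ^ m) + p * (3 * (p - 1)) * (real m ^ 2 * q ^ m) + p * (3 * (p - 1) * (p + (p - 1))) * (real m ^ 1 * q ^ m) + p * ((p - 1) * (p ^ 2 + 4 * p * (p - 1) + (p - 1) ^ 2)) * (real m ^ 0 * q ^ m))"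
  have "h \<longlonglongrightarrow> p * 1 * 0 + p * (3 * (p - 1)) * 0 + p * (3 * (p - 1) * (p + (p - 1))) * 0 + p * ((p - 1) * (p ^ 2 + 4 * p * (p - 1) + (p - 1) ^ 2)) * 0"
    unfolding h_def by (intro tendsto_add tendsto_mult_left pow_times_exp_tendsto_0 q)
  hence "(\<lambda>m. h m - h (Suc m)) sums (h 0 - 0)" by (intro telescope_sums') simp
  moreover have "h m - h (Suc m) = real m ^ 3 * q ^ m" for m
  proof -
    define g where "g = (\<lambda>x. 1 * x ^ 3 + (3 * (p - 1)) * x ^ 2 + (3 * (p - 1) * (p + (p - 1))) * x ^ 1 + ((p - 1) * (p ^ 2 + 4 * p * (p - 1) + (p - 1) ^ 2)) * x ^ 0)"
    have "h k = p * q ^ k * g (real k)" for k by (simp add: h_def g_def algebra_simps)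
    hence "h m - h (Suc m) = q ^ m * (p * g (real m) - (p * q) * g (real m + 1))"
      by (simp add: algebra_simps)
    also have "p * g (real m) - (p * q) * g (real m + 1) = real m ^ 3"
      unfolding pq g_def by (simp add: algebra_simps power2_eq_square power3_eq_cube)
    finally show ?thesis by simp
  qed
  moreover have "h 0 = psum3 x"
    by (simp add: h_def p1 ps algebra_simps power_eq_if)
  ultimately show ?thesis by (simp add: q_def)
qed

section \<open>Size of the power sums compared with powers of 1/x\<close>

lemma psum1_conv_sinh:
  assumes "x > 0"
  shows "psum1 x = 1 / (2 * sinh (x / 2))\<^sup>2"
proof -
  have "2 * sinh (x / 2) = exp (x / 2) * (1 - exp (-x))"
    by (simp add: sinh_def algebra_simps flip: exp_add)
  hence "(2 * sinh (x / 2))\<^sup>2 = exp (x / 2) ^ 2 * (1 - exp (-x))\<^sup>2"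
    by (simp add: power_mult_distrib)
  also have "exp (x / 2) ^ 2 = exp x" by (simp add: exp_double[symmetric])
  finally have "(2 * sinh (x / 2))\<^sup>2 = exp x * (1 - exp (-x))\<^sup>2" .
  moreover have "exp (-x) / E = 1 / (exp x * E)" for E :: real
    by (simp add: exp_minus divide_inverse)
  ultimately show ?thesis unfolding psum1_def by (simp only:)
qed

lemma real_le_sinh: "x \<ge> 0 \<Longrightarrow> x \<le> sinh (x :: real)"
proof -
  assume x: "x \<ge> 0"
  have "sinh 0 - 0 \<le> sinh x - x"
  proof (rule DERIV_nonneg_imp_nondecreasing[OF x])
    fix y :: real
    have "((\<lambda>x. sinh x - x) has_field_derivative (cosh y - 1)) (at y)"
      by (auto intro!: derivative_eq_intros)
    thus "\<exists>z. ((\<lambda>x. sinh x - x) has_real_derivative z) (at y) \<and> z \<ge> 0"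
      using cosh_real_ge_1[of y] by (intro exI[of _ "cosh y - 1"]) auto
  qed
  thus ?thesis by simp
qed

lemma sinh_le_mult_cosh: "x \<ge> 0 \<Longrightarrow> sinh x \<le> x * cosh (x :: real)"
proof -
  assume x: "x \<ge> 0"
  have "0 * cosh 0 - sinh 0 \<le> x * cosh x - sinh x"
  proof (rule DERIV_nonneg_imp_nondecreasing[OF x])
    fix y :: real assume "0 \<le> y"
    have "((\<lambda>x. x * cosh x - sinh x) has_field_derivative (y * sinh y)) (at y)"
      by (auto intro!: derivative_eq_intros)
    thus "\<exists>z. ((\<lambda>x. x * cosh x - sinh x) has_real_derivative z) (at y) \<and> z \<ge> 0"
      using \<open>0 \<le> y\<close> by (intro exI[of _ "y * sinh y"]) auto
  qed
  thus ?thesis by simp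
qed

lemma psum1_le:
  assumes "x > 0"
  shows "psum1 x \<le> 1 / x\<^sup>2"
proof -
  have "x \<le> 2 * sinh (x / 2)" using real_le_sinh[of "x/2"] assms by simp
  hence "x\<^sup>2 \<le> (2 * sinh (x / 2))\<^sup>2" using assms by (intro power_mono) auto
  thus ?thesis unfolding psum1_conv_sinh[OF assms] using assms by (intro divide_left_mono) auto
qed

lemma psum1_nonneg: "x > 0 \<Longrightarrow> psum1 x \<ge> 0"
  by (simp add: psum1_def)

text \<open>For s = (2 sinh (x/2))^2, the inequality sinh y \<le> y cosh y gives s \<le> x^2 * (1 +
  s/4); dividing by s * x^2 is the claim. Together with \<open>psum1_le\<close> it keeps the
  difference bounded near 0, where both terms blow up.\<close>

lemma psum1_ge:
  assumes "x > 0"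
  shows "1 / x\<^sup>2 - psum1 x \<le> 1 / 4"
proof -
  define s where "s = (2 * sinh (x / 2))\<^sup>2"
  have s: "s > 0" using assms by (auto simp: s_def)
  have "2 * sinh (x / 2) \<le> x * cosh (x / 2)" using sinh_le_mult_cosh[of "x/2"] assms by simp
  hence "s \<le> (x * cosh (x / 2))\<^sup>2" unfolding s_def using assms by (intro power_mono) auto
  also have "\<dots> = x\<^sup>2 * (1 + s / 4)" by (simp add: s_def power_mult_distrib cosh_square_eq)
  finally have "s - x\<^sup>2 \<le> s * x\<^sup>2 / 4" by (simp add: algebra_simps)
  hence "1 / x\<^sup>2 - 1 / s \<le> 1 / 4" using s assms by (simp add: field_simps)
  thus ?thesis by (simp add: psum1_conv_sinh assms s_def)
qed

lemma one_minus_exp_ge: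
  assumes "x > (0::real)"
  shows "1 - exp (-x) \<ge> x / (1 + x)"
proof -
  have "1 + x \<le> exp x" by simp
  hence "1 / exp x \<le> 1 / (1 + x)" using assms by (intro divide_left_mono) auto
  thus ?thesis using assms by (simp add: exp_minus field_simps)
qed

text \<open>The exponential is spread over j factors: 1 + x \<le> j * (1 + x/j) \<le> j * exp (x/j),
  raised to the power j.\<close>

lemma exp_mult_pow_le:
  assumes "x > (0::real)" "j > 0"
  shows "exp (-x) * (1 + x) ^ j \<le> real j ^ j"
proof -
  have "1 + x \<le> real j * (1 + x / real j)" using assms by (simp add: field_simps)
  also have "\<dots> \<le> real j * exp (x / real j)" using assms by (intro mult_left_mono) auto
  finally have "(1 + x) ^ j \<le> (real j * exp (x / real j)) ^ j" using assms by (intro power_mono) auto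
  also have "\<dots> = real j ^ j * exp x" using assms by (simp add: power_mult_distrib flip: exp_of_nat_mult)
  finally show ?thesis by (simp add: exp_minus field_simps)
qed

lemma exp_over_pow_le:
  assumes "x > (0::real)" "j > 0"
  shows "exp (-x) / (1 - exp (-x)) ^ j \<le> real j ^ j / x ^ j"
proof -
  have "exp (-x) / (1 - exp (-x)) ^ j \<le> exp (-x) / (x / (1 + x)) ^ j"
    using one_minus_exp_ge[of x] assms by (intro divide_left_mono power_mono mult_pos_pos zero_less_power) auto
  also have "\<dots> = exp (-x) * (1 + x) ^ j / x ^ j" using assms by (simp add: power_divide)
  also have "\<dots> \<le> real j ^ j / x ^ j" using exp_mult_pow_le[OF assms] assms by (intro divide_right_mono) auto
  finally show ?thesis .
qed

lemma psum2_le: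
  assumes "x > 0"
  shows "psum2 x \<le> 54 / x ^ 3"
proof -
  have "psum2 x = (1 + exp (-x)) * (exp (-x) / (1 - exp (-x)) ^ 3)" by (simp add: psum2_def)
  also have "\<dots> \<le> 2 * (real 3 ^ 3 / x ^ 3)"
    by (intro mult_mono exp_over_pow_le) (use assms in auto)
  finally show ?thesis by simp
qed

lemma psum2_nonneg: "x > 0 \<Longrightarrow> psum2 x \<ge> 0"
  by (auto simp: psum2_def intro!: divide_nonneg_pos mult_nonneg_nonneg add_nonneg_nonneg)

lemma psum3_le:
  assumes "x > 0"
  shows "psum3 x \<le> 1536 / x ^ 4"
proof -
  have "exp (-x) \<le> 1" using assms by simp
  have "psum3 x = (1 + 4 * exp (-x) + (exp (-x))\<^sup>2) * (exp (-x) / (1 - exp (-x)) ^ 4)" by (simp add: psum3_def)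
  also have "\<dots> \<le> (1 + 4 * 1 + 1\<^sup>2) * (real 4 ^ 4 / x ^ 4)"
    by (intro mult_mono exp_over_pow_le add_mono power_mono) (use assms in auto)
  finally show ?thesis by simp
qed

lemma psum3_nonneg: "x > 0 \<Longrightarrow> psum3 x \<ge> 0"
  by (auto simp: psum3_def intro!: divide_nonneg_pos mult_nonneg_nonneg add_nonneg_nonneg)

lemma psum2_tendsto: "((\<lambda>x. x ^ 3 * psum2 x) \<longlongrightarrow> 2) (at_right 0)"
  unfolding psum2_def by real_asymp

section \<open>Limits of series, and the Lambert series as a double sum\<close>

lemma tannery_uniform:
  fixes a :: "nat \<Rightarrow> _ \<Rightarrow> 'a :: {real_normed_algebra, banach}"
  assumes "\<And>k. ((\<lambda>n. a k n) \<longlongrightarrow> b k) F"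
    and "eventually (\<lambda>n. \<forall>k. norm (a k n) \<le> M k) F"
    and "summable M" and "F \<noteq> bot"
  shows "((\<lambda>n. \<Sum>k. a k n) \<longlongrightarrow> (\<Sum>k. b k)) F"
proof -
  have "eventually (\<lambda>(k, n). norm (a k n) \<le> M k) (at_top \<times>\<^sub>F F)"
    using assms(2) unfolding eventually_prod_filter
    by (intro exI[of _ "\<lambda>_. True"] exI[of _ "\<lambda>n. \<forall>k. norm (a k n) \<le> M k"]) auto
  from tannerys_theorem[OF assms(1) this assms(3,4)] show ?thesis by blast
qed

text \<open>The double series of w^(m k) / k, summed over m first; summed over k first it is minus
  the sum of Ln (1 - w^m). This form is the one whose terms are expanded around the positive axis.
  The type is generic because real and complex arguments both occur.\<close>

definition lambert :: "'a :: {real_normed_field, banach} \<Rightarrow> 'a" where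
  "lambert w = (\<Sum>k. w ^ Suc k / (of_nat (Suc k) * (1 - w ^ Suc k)))"

lemma norm_lambert_term_le:
  fixes w :: "'a :: real_normed_field"
  assumes "norm w \<le> r" "r < 1"
  shows "norm (w ^ Suc k / (of_nat (Suc k) * (1 - w ^ Suc k))) \<le> r ^ Suc k / (1 - r)"
proof -
  have r: "0 \<le> r" using assms(1) norm_ge_zero order_trans by blast
  have "norm (w ^ Suc k) \<le> r ^ Suc k" unfolding norm_power using assms(1) by (intro power_mono) auto
  moreover have "r ^ Suc k \<le> r" using power_Suc_le_self[of r k] r assms(2) by simp
  moreover have "1 - norm (w ^ Suc k) \<le> norm (1 - w ^ Suc k)"
    using norm_triangle_ineq2[of 1 "w ^ Suc k"] by simp
  ultimately have 1: "1 - r \<le> norm (1 - w ^ Suc k)" by linarith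
  have "1 * (1 - r) \<le> real (Suc k) * norm (1 - w ^ Suc k)"
    using 1 assms(2) by (intro mult_mono) auto
  hence "norm (w ^ Suc k) / (real (Suc k) * norm (1 - w ^ Suc k)) \<le> r ^ Suc k / (1 - r)"
    using \<open>norm (w ^ Suc k) \<le> r ^ Suc k\<close> assms(2) r by (intro frac_le) auto
  thus ?thesis by (simp only: norm_divide norm_mult norm_of_nat)
qed

lemma summable_pow_Suc_div: "0 \<le> r \<Longrightarrow> r < 1 \<Longrightarrow> summable (\<lambda>k. r ^ Suc k / (1 - r :: real))"
  by (intro summable_divide) (simp add: summable_geometric summable_mult)

lemma summable_lambert:
  fixes w :: "'a :: {real_normed_field, banach}"
  assumes "norm w < 1"
  shows "summable (\<lambda>k. w ^ Suc k / (of_nat (Suc k) * (1 - w ^ Suc k)))"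
  by (rule summable_comparison_test'[OF summable_pow_Suc_div[of "norm w"], of 0])
     (use assms norm_lambert_term_le[of w "norm w"] in auto)

lemma minus_Ln_one_minus_sums:
  fixes z :: complex
  assumes "norm z < 1"
  shows "(\<lambda>k. z ^ Suc k / of_nat (Suc k)) sums (- Ln (1 - z))"
proof -
  have "(\<lambda>n. - (z ^ n / of_nat n)) sums ln (1 - z)" using Ln_series'[of "-z"] assms by simp
  hence "(\<lambda>n. z ^ n / of_nat n) sums (- Ln (1 - z))" using sums_minus by fastforce
  thus ?thesis by (subst sums_Suc_iff) simp
qed

text \<open>The two orders of summation agree: the sum over m is truncated at N, so that it commutes
  with the series over k, and then N tends to infinity under the geometric majorant
  \<open>r ^ Suc k / (1 - r)\<close>.\<close>

lemma minus_Ln_sums_lambert: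
  fixes w :: complex
  assumes w: "norm w < 1"
  shows "(\<lambda>m. - Ln (1 - w ^ Suc m)) sums lambert w"
proof -
  define r where "r = norm w"
  have r: "0 \<le> r" "r < 1" using w by (auto simp: r_def)
  define a where "a = (\<lambda>k N. (\<Sum>m<N. (w ^ Suc m) ^ Suc k / of_nat (Suc k)))"
  have pow1: "norm (w ^ Suc m) < 1" for m
    using w power_Suc_less_one[of "norm w" m] by (cases "w = 0") (auto simp: norm_power norm_mult)
  have "(\<lambda>k. a k N) sums (\<Sum>m<N. - Ln (1 - w ^ Suc m))" for N
    unfolding a_def by (intro sums_sum minus_Ln_one_minus_sums pow1)
  hence eq: "(\<Sum>m<N. - Ln (1 - w ^ Suc m)) = (\<Sum>k. a k N)" for N
    by (simp add: sums_iff)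
  have swap: "(w ^ Suc m) ^ Suc k = w ^ Suc k * (w ^ Suc k) ^ m" for m k
    by (metis power_commutes power_mult power_Suc mult.commute)
  have lim: "(\<lambda>N. a k N) \<longlonglongrightarrow> w ^ Suc k / (of_nat (Suc k) * (1 - w ^ Suc k))" for k
  proof -
    have "(\<lambda>m. (w ^ Suc k) ^ m) sums (1 / (1 - w ^ Suc k))" using pow1 by (rule geometric_sums)
    hence "(\<lambda>m. w ^ Suc k / of_nat (Suc k) * (w ^ Suc k) ^ m) sums
             (w ^ Suc k / of_nat (Suc k) * (1 / (1 - w ^ Suc k)))" by (rule sums_mult)
    moreover have "w ^ Suc k / of_nat (Suc k) * (1 / (1 - w ^ Suc k)) = w ^ Suc k / (of_nat (Suc k) * (1 - w ^ Suc k))"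
      by (simp only: times_divide_times_eq mult_1_right)
    ultimately show ?thesis unfolding a_def sums_def swap by (simp only: times_divide_eq_left)
  qed
  have bound: "norm (a k N) \<le> r ^ Suc k / (1 - r)" for k N
  proof -
    have "norm (a k N) \<le> (\<Sum>m<N. norm ((w ^ Suc m) ^ Suc k / of_nat (Suc k)))"
      unfolding a_def by (rule norm_sum)
    also have "\<dots> \<le> (\<Sum>m<N. r ^ Suc k * r ^ m)"
    proof (rule sum_mono)
      fix m
      have "norm ((w ^ Suc m) ^ Suc k / of_nat (Suc k)) \<le> norm ((w ^ Suc m) ^ Suc k) / 1"
        unfolding norm_divide norm_of_nat by (intro divide_left_mono) auto
      also have "\<dots> = r ^ Suc k * (r ^ Suc k) ^ m"
        unfolding swap by (simp add: norm_mult norm_power r_def)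
      also have "(r ^ Suc k) ^ m \<le> r ^ m"
        using power_Suc_le_self[of r k] r by (intro power_mono) auto
      finally show "norm ((w ^ Suc m) ^ Suc k / of_nat (Suc k)) \<le> r ^ Suc k * r ^ m"
        using r by (simp add: mult_left_mono)
    qed
    also have "\<dots> = r ^ Suc k * (\<Sum>m<N. r ^ m)" by (rule sum_distrib_left[symmetric])
    also have "(\<Sum>m<N. r ^ m) \<le> (\<Sum>m. r ^ m)" using r by (intro sum_le_suminf summable_geometric) auto
    also have "(\<Sum>m. r ^ m) = 1 / (1 - r)" using r by (intro suminf_geometric) auto
    finally show ?thesis using r by (simp add: mult_left_mono)
  qed
  have "(\<lambda>N. \<Sum>k. a k N) \<longlonglongrightarrow> (\<Sum>k. w ^ Suc k / (of_nat (Suc k) * (1 - w ^ Suc k)))"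
    by (rule tannery_uniform[OF lim _ summable_pow_Suc_div[OF r]]) (use bound in auto)
  thus ?thesis unfolding sums_def lambert_def eq .
qed

lemma lambert_of_real:
  fixes r :: real
  assumes "\<bar>r\<bar> < 1"
  shows "lambert (complex_of_real r) = of_real (lambert r)"
proof -
  have "of_real (lambert r) = (\<Sum>k. complex_of_real (r ^ Suc k / (of_nat (Suc k) * (1 - r ^ Suc k))))"
    unfolding lambert_def by (intro suminf_of_real summable_lambert) (use assms in auto)
  thus ?thesis unfolding lambert_def by simp
qed

lemma minus_ln_sums_lambert:
  fixes r :: real
  assumes "0 \<le> r" "r < 1"
  shows "(\<lambda>m. - ln (1 - r ^ Suc m)) sums lambert r"
proof -
  have "(\<lambda>m. - Ln (1 - complex_of_real r ^ Suc m)) sums of_real (lambert r)"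
    using minus_Ln_sums_lambert[of "of_real r"] assms lambert_of_real[of r] by simp
  also have "(\<lambda>m. - Ln (1 - complex_of_real r ^ Suc m)) = (\<lambda>m. of_real (- ln (1 - r ^ Suc m)))"
  proof
    fix m
    have "r ^ Suc m < 1" using assms power_Suc_le_self[of r m] by simp
    hence "Ln (of_real (1 - r ^ Suc m)) = of_real (ln (1 - r ^ Suc m))" by (intro Ln_of_real) simp
    thus "- Ln (1 - complex_of_real r ^ Suc m) = of_real (- ln (1 - r ^ Suc m))" by simp
  qed
  finally show ?thesis by (simp only: sums_of_real_iff)
qed

section \<open>Sums of derivatives\<close>

text \<open>\<open>dsum1\<close>, \<open>dsum2\<close>, \<open>dsum3\<close> are the termwise
  t-derivatives of \<open>lambert (exp (-t))\<close> of order j = 1, 2, 3, up to the sign (-1)^j: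
  each derivative multiplies the term exp (-k m t) / k by k m, and the sum over m is a
  \<open>psum\<close>.\<close>

definition dsum1 :: "real \<Rightarrow> real" where
  "dsum1 t = (\<Sum>k. psum1 (real (Suc k) * t))"

definition dsum2 :: "real \<Rightarrow> real" where
  "dsum2 t = (\<Sum>k. real (Suc k) * psum2 (real (Suc k) * t))"

definition dsum3 :: "real \<Rightarrow> real" where
  "dsum3 t = (\<Sum>k. real (Suc k) ^ 2 * psum3 (real (Suc k) * t))"

lemma inverse_squares_sums': "(\<lambda>k. 1 / real (Suc k) ^ 2) sums (pi\<^sup>2 / 6)"
  using inverse_squares_sums by (simp add: add.commute)

lemma summable_inverse_squares: "summable (\<lambda>k. c / real (Suc k) ^ 2)"
  using summable_mult[OF sums_summable[OF inverse_squares_sums'], of c] by (simp del: of_nat_Suc)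

lemma dsum1_term_le:
  assumes "t > 0"
  shows "psum1 (real (Suc k) * t) \<le> (1 / t\<^sup>2) / real (Suc k) ^ 2"
  using psum1_le[of "real (Suc k) * t"] assms by (simp add: power_mult_distrib mult.commute del: of_nat_Suc)

lemma dsum2_term_le:
  assumes "t > 0"
  shows "real (Suc k) * psum2 (real (Suc k) * t) \<le> (54 / t ^ 3) / real (Suc k) ^ 2"
proof -
  have "real (Suc k) * psum2 (real (Suc k) * t) \<le> real (Suc k) * (54 / (real (Suc k) * t) ^ 3)"
    using assms by (intro mult_left_mono psum2_le) auto
  also have "\<dots> = (54 / t ^ 3) / real (Suc k) ^ 2"
    using assms by (simp add: power_mult_distrib power2_eq_square power3_eq_cube del: of_nat_Suc)
  finally show ?thesis .
qed

lemma dsum3_term_le: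
  assumes "t > 0"
  shows "real (Suc k) ^ 2 * psum3 (real (Suc k) * t) \<le> (1536 / t ^ 4) / real (Suc k) ^ 2"
proof -
  have "real (Suc k) ^ 2 * psum3 (real (Suc k) * t) \<le> real (Suc k) ^ 2 * (1536 / (real (Suc k) * t) ^ 4)"
    using assms by (intro mult_left_mono psum3_le) auto
  also have "\<dots> = (1536 / t ^ 4) / real (Suc k) ^ 2"
    using assms by (simp add: power_mult_distrib power2_eq_square power4_eq_xxxx del: of_nat_Suc)
  finally show ?thesis .
qed

lemma summable_dsum1: "t > 0 \<Longrightarrow> summable (\<lambda>k. psum1 (real (Suc k) * t))"
  by (rule summable_comparison_test'[OF summable_inverse_squares[of "1 / t\<^sup>2"], of 0])
     (use dsum1_term_le psum1_nonneg in \<open>auto simp del: of_nat_Suc\<close>)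

lemma summable_dsum2: "t > 0 \<Longrightarrow> summable (\<lambda>k. real (Suc k) * psum2 (real (Suc k) * t))"
  by (rule summable_comparison_test'[OF summable_inverse_squares[of "54 / t ^ 3"], of 0])
     (use dsum2_term_le psum2_nonneg in \<open>auto simp: abs_mult simp del: of_nat_Suc\<close>)

lemma summable_dsum3: "t > 0 \<Longrightarrow> summable (\<lambda>k. real (Suc k) ^ 2 * psum3 (real (Suc k) * t))"
  by (rule summable_comparison_test'[OF summable_inverse_squares[of "1536 / t ^ 4"], of 0])
     (use dsum3_term_le psum3_nonneg in \<open>auto simp: abs_mult simp del: of_nat_Suc\<close>)

lemma dsum3_le:
  assumes "t > 0"
  shows "dsum3 t \<le> 256 * pi\<^sup>2 / t ^ 4"
proof -
  have "dsum3 t \<le> (\<Sum>k. (1536 / t ^ 4) / real (Suc k) ^ 2)"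
    unfolding dsum3_def
    by (intro suminf_le dsum3_term_le summable_dsum3 summable_inverse_squares assms)
  also have "\<dots> = (\<Sum>k. (1536 / t ^ 4) * (1 / real (Suc k) ^ 2))" by (simp del: of_nat_Suc)
  also have "\<dots> = (1536 / t ^ 4) * (pi\<^sup>2 / 6)"
    by (rule sums_unique[symmetric], rule sums_mult, rule inverse_squares_sums')
  finally show ?thesis by simp
qed

text \<open>With x = k t, the k-th summand is x^3 * psum2 x / k^2, which tends to 2 / k^2;
  \<open>psum2_le\<close> supplies the majorant.\<close>

lemma dsum2_tendsto: "((\<lambda>t. t ^ 3 * dsum2 t) \<longlongrightarrow> pi\<^sup>2 / 3) (at_right 0)"
proof -
  define a where "a = (\<lambda>k t. t ^ 3 * (real (Suc k) * psum2 (real (Suc k) * t)))"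
  have "((\<lambda>t. \<Sum>k. a k t) \<longlongrightarrow> (\<Sum>k. 2 * (1 / real (Suc k) ^ 2))) (at_right 0)"
  proof (rule tannery_uniform)
    fix k
    have "((\<lambda>t. (real (Suc k) * t) ^ 3 * psum2 (real (Suc k) * t)) \<longlongrightarrow> 2) (at_right 0)"
      by (rule filterlim_compose[OF psum2_tendsto]) real_asymp
    hence "((\<lambda>t. (1 / real (Suc k) ^ 2) * ((real (Suc k) * t) ^ 3 * psum2 (real (Suc k) * t)))
        \<longlongrightarrow> (1 / real (Suc k) ^ 2) * 2) (at_right 0)" by (rule tendsto_mult_left)
    thus "((\<lambda>t. a k t) \<longlongrightarrow> 2 * (1 / real (Suc k) ^ 2)) (at_right 0)"
      by (simp add: a_def power_mult_distrib power2_eq_square power3_eq_cube mult_ac del: of_nat_Suc)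
  next
    show "eventually (\<lambda>t. \<forall>k. norm (a k t) \<le> 54 / real (Suc k) ^ 2) (at_right 0)"
      using eventually_at_right_less[of 0]
    proof eventually_elim
      case (elim t)
      show ?case
      proof
        fix k
        have "a k t \<le> t ^ 3 * ((54 / t ^ 3) / real (Suc k) ^ 2)"
          unfolding a_def using elim by (intro mult_left_mono dsum2_term_le) auto
        moreover have "a k t \<ge> 0" unfolding a_def using elim
          by (intro mult_nonneg_nonneg psum2_nonneg) auto
        ultimately show "norm (a k t) \<le> 54 / real (Suc k) ^ 2" using elim by (simp del: of_nat_Suc)
      qed
    qed
  qed (use summable_inverse_squares in auto)
  also have "(\<Sum>k. 2 * (1 / real (Suc k) ^ 2)) = 2 * (pi\<^sup>2 / 6)"
    by (rule sums_unique[symmetric], rule sums_mult, rule inverse_squares_sums')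
  finally have *: "((\<lambda>t. \<Sum>k. a k t) \<longlongrightarrow> pi\<^sup>2 / 3) (at_right 0)" by simp
  show ?thesis
  proof (rule Lim_transform_eventually[OF *])
    show "eventually (\<lambda>t. (\<Sum>k. a k t) = t ^ 3 * dsum2 t) (at_right 0)"
      using eventually_at_right_less[of 0]
      by eventually_elim (auto simp: a_def dsum2_def intro!: suminf_mult summable_dsum2 simp del: of_nat_Suc)
  qed
qed

lemma summable_Suc_powr: "s < -1 \<Longrightarrow> summable (\<lambda>k. real (Suc k) powr s)"
  by (subst summable_Suc_iff) (simp add: summable_real_powr_iff)

text \<open>The difference 1/x^2 - psum1 x is at most 1/4 and at most 1/x^2, hence below x^s for
  every s in [-2, 0]. The choice s = -5/4 lies below -1, so that the sum over k converges, and above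
  -3/2, so that the error is still o(1) after multiplication by the angle t^(3/2) * u.\<close>

lemma dsum1_bounds:
  assumes "t > 0"
  shows "0 \<le> pi\<^sup>2 / 6 / t\<^sup>2 - dsum1 t"
    and "pi\<^sup>2 / 6 / t\<^sup>2 - dsum1 t \<le> (\<Sum>k. real (Suc k) powr (-5/4)) * t powr (-5/4)"
proof -
  have "(\<lambda>k. 1 / t\<^sup>2 * (1 / real (Suc k) ^ 2) - psum1 (real (Suc k) * t)) sums
          (1 / t\<^sup>2 * (pi\<^sup>2 / 6) - dsum1 t)"
    unfolding dsum1_def
    by (intro sums_diff sums_mult inverse_squares_sums' summable_sums summable_dsum1 assms)
  hence sums: "(\<lambda>k. 1 / (real (Suc k) * t)\<^sup>2 - psum1 (real (Suc k) * t)) sums (pi\<^sup>2 / 6 / t\<^sup>2 - dsum1 t)"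
    by (simp add: power_mult_distrib mult.commute del: of_nat_Suc)
  have le: "1 / x\<^sup>2 - psum1 x \<le> x powr (-5/4)" if "x > 0" for x
  proof (cases "x \<le> 1")
    case True
    have "1 / x\<^sup>2 - psum1 x \<le> 1" using psum1_ge[OF that] by simp
    also have "1 \<le> x powr (-5/4)" using that True powr_mono2'[of "-5/4" x 1] by simp
    finally show ?thesis .
  next
    case False
    have "1 / x\<^sup>2 - psum1 x \<le> x powr (-2)"
      using psum1_nonneg[OF that] that by (simp add: powr_minus powr_numeral divide_inverse)
    also have "\<dots> \<le> x powr (-5/4)" using False by (intro powr_mono) auto
    finally show ?thesis .
  qed
  show "0 \<le> pi\<^sup>2 / 6 / t\<^sup>2 - dsum1 t"
    by (rule sums_le[OF _ sums_zero sums]) (use psum1_le assms in auto)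
  have "(\<lambda>k. real (Suc k) powr (-5/4) * t powr (-5/4)) sums ((\<Sum>k. real (Suc k) powr (-5/4)) * t powr (-5/4))"
    by (intro sums_mult2 summable_sums summable_Suc_powr) simp
  thus "pi\<^sup>2 / 6 / t\<^sup>2 - dsum1 t \<le> (\<Sum>k. real (Suc k) powr (-5/4)) * t powr (-5/4)"
    by (rule sums_le[OF _ sums, rotated])
       (metis assms le powr_mult mult_pos_pos of_nat_0_less_iff zero_less_Suc)
qed

section \<open>The Lambert series near the singularity\<close>

text \<open>\<open>sing_ref\<close> has the same logarithmic singularity at \<open>0\<close> as \<open>- ln (1 - exp (- x))\<close>, but its
  sum over \<open>m * t\<close> has a closed form by Euler's product for \<open>sinh\<close>.\<close>

definition sing_ref :: "real \<Rightarrow> real" where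
  "sing_ref x = ln (1 + x\<^sup>2) / 2 - ln x"

definition sing_diff :: "real \<Rightarrow> real" where
  "sing_diff x = - ln (1 - exp (-x)) - sing_ref x"

definition sing_diff' :: "real \<Rightarrow> real" where
  "sing_diff' x = - exp (-x) / (1 - exp (-x)) + 1 / x - x / (1 + x\<^sup>2)"

definition sing_diff'' :: "real \<Rightarrow> real" where
  "sing_diff'' x = psum1 x - 1 / x\<^sup>2 - (1 - x\<^sup>2) / (1 + x\<^sup>2)\<^sup>2"

text \<open>For x > 0, \<open>sing_ref x\<close> is ln (1 + 1/x^2) / 2, so the sum over x = m t is
  half the logarithm of the product of 1 + y^2 / m^2 with y = 1/t. The product formula for the sine
  at the imaginary point i y evaluates it.\<close>

lemma sing_ref_sums:
  assumes "t > 0"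
  shows "(\<lambda>m. sing_ref (real (Suc m) * t)) sums (ln (sinh (pi / t) / (pi / t)) / 2)"
proof -
  define y where "y = 1 / t"
  have y: "y > 0" using assms by (simp add: y_def)
  have "(\<lambda>n. of_real pi * (\<i> * of_real y) * (\<Prod>k=1..n. 1 - (\<i> * of_real y)\<^sup>2 / of_nat k ^ 2))
          \<longlonglongrightarrow> sin (of_real pi * (\<i> * complex_of_real y))"
    by (rule sin_product_formula_complex)
  hence "(\<lambda>n. - \<i> * (of_real pi * (\<i> * of_real y) * (\<Prod>k=1..n. 1 - (\<i> * of_real y)\<^sup>2 / of_nat k ^ 2)))
          \<longlonglongrightarrow> - \<i> * sin (of_real pi * (\<i> * complex_of_real y))" by (rule tendsto_mult_left)
  also have "- \<i> * sin (of_real pi * (\<i> * complex_of_real y)) = of_real (sinh (pi * y))"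
  proof -
    have "sin (\<i> * complex_of_real (pi * y)) = \<i> * sinh (complex_of_real (pi * y))"
      by (simp add: sinh_conv_sin algebra_simps)
    hence "- \<i> * sin (of_real pi * (\<i> * complex_of_real y)) = sinh (complex_of_real (pi * y))"
      by (simp add: mult_ac)
    moreover have "sinh (complex_of_real v) = of_real (sinh v)" for v
      by (simp add: sinh_def scaleR_conv_of_real exp_of_real flip: of_real_minus)
    ultimately show ?thesis by metis
  qed
  also have "(\<lambda>n. - \<i> * (of_real pi * (\<i> * of_real y) * (\<Prod>k=1..n. 1 - (\<i> * complex_of_real y)\<^sup>2 / of_nat k ^ 2)))
      = (\<lambda>n. of_real (pi * y * (\<Prod>k=1..n. 1 + y\<^sup>2 / real k ^ 2)))"
  proof
    fix n
    have "- \<i> * (of_real pi * (\<i> * of_real y) * P) = of_real (pi * y) * P" for P :: complex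
      by (simp add: algebra_simps)
    thus "- \<i> * (of_real pi * (\<i> * of_real y) * (\<Prod>k=1..n. 1 - (\<i> * complex_of_real y)\<^sup>2 / of_nat k ^ 2))
      = of_real (pi * y * (\<Prod>k=1..n. 1 + y\<^sup>2 / real k ^ 2))"
      by (simp only:) (simp add: power_mult_distrib)
  qed
  finally have "(\<lambda>n. pi * y * (\<Prod>k=1..n. 1 + y\<^sup>2 / real k ^ 2)) \<longlonglongrightarrow> sinh (pi * y)"
    by (simp only: tendsto_of_real_iff)
  hence "(\<lambda>n. pi * y * (\<Prod>k=1..n. 1 + y\<^sup>2 / real k ^ 2) / (pi * y)) \<longlonglongrightarrow> sinh (pi * y) / (pi * y)"
    using y by (intro tendsto_divide tendsto_const) auto
  hence "(\<lambda>n. \<Prod>k=1..n. 1 + y\<^sup>2 / real k ^ 2) \<longlonglongrightarrow> sinh (pi * y) / (pi * y)" using y by simp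
  hence "(\<lambda>n. ln (\<Prod>k=1..n. 1 + y\<^sup>2 / real k ^ 2) / 2) \<longlonglongrightarrow> ln (sinh (pi * y) / (pi * y)) / 2"
    using y by (intro tendsto_divide tendsto_ln tendsto_const) auto
  also have "(\<lambda>n. ln (\<Prod>k=1..n. 1 + y\<^sup>2 / real k ^ 2) / 2) = (\<lambda>n. \<Sum>m<n. sing_ref (real (Suc m) * t))"
  proof
    fix n
    have pos: "1 + y\<^sup>2 / real k ^ 2 > 0" for k
      by (simp add: add_pos_nonneg)
    have "ln (\<Prod>k=1..n. 1 + y\<^sup>2 / real k ^ 2) / 2 = (\<Sum>k=1..n. ln (1 + y\<^sup>2 / real k ^ 2) / 2)"
      using pos by (subst ln_prod) (auto simp: sum_divide_distrib order.strict_implies_not_eq[THEN not_sym])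
    also have "\<dots> = (\<Sum>k=1..n. sing_ref (real k * t))"
    proof (rule sum.cong)
      fix k assume "k \<in> {1..n}"
      hence k: "real k > 0" by simp
      have "1 + y\<^sup>2 / real k ^ 2 = (1 + (real k * t)\<^sup>2) / (real k * t)\<^sup>2"
        using k assms by (simp add: y_def field_simps)
      hence "ln (1 + y\<^sup>2 / real k ^ 2) = ln (1 + (real k * t)\<^sup>2) - ln ((real k * t)\<^sup>2)"
        using k assms add_pos_nonneg[OF zero_less_one zero_le_power2, of "real k * t"] by (simp add: ln_div)
      also have "ln ((real k * t)\<^sup>2) = 2 * ln (real k * t)" using k assms by (simp add: ln_realpow)
      finally show "ln (1 + y\<^sup>2 / real k ^ 2) / 2 = sing_ref (real k * t)" by (simp add: sing_ref_def)
    qed simp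
    also have "\<dots> = (\<Sum>m<n. sing_ref (real (Suc m) * t))"
      by (simp add: sum.atLeast1_atMost_eq)
    finally show "ln (\<Prod>k=1..n. 1 + y\<^sup>2 / real k ^ 2) / 2 = (\<Sum>m<n. sing_ref (real (Suc m) * t))" .
  qed
  finally show ?thesis unfolding sums_def by (simp add: y_def)
qed

lemma sing_diff_sums:
  assumes "t > 0"
  shows "(\<lambda>m. sing_diff (real (Suc m) * t)) sums
           (lambert (exp (-t)) - ln (sinh (pi / t) / (pi / t)) / 2)"
proof -
  have "(\<lambda>m. - ln (1 - exp (-t) ^ Suc m)) sums lambert (exp (-t))"
    using assms by (intro minus_ln_sums_lambert) auto
  from sums_diff[OF this sing_ref_sums[OF assms]] show ?thesis
    by (simp add: sing_diff_def exp_of_nat_mult[symmetric] mult.commute del: of_nat_Suc power_Suc)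
qed

lemma sing_ref_deriv:
  assumes "x > 0"
  shows "(sing_ref has_real_derivative (x / (1 + x\<^sup>2) - 1 / x)) (at x)"
proof -
  have pos: "1 + x\<^sup>2 > 0" by (simp add: add_pos_nonneg)
  have "((\<lambda>x. 1 + x\<^sup>2) has_real_derivative 2 * x) (at x)"
    by (auto intro!: derivative_eq_intros)
  from DERIV_diff[OF DERIV_cdivide[OF DERIV_chain2[OF DERIV_ln[OF pos] this], of 2] DERIV_ln[OF assms]]
  have "(sing_ref has_real_derivative (inverse (1 + x\<^sup>2) * (2 * x) / 2 - inverse x)) (at x)"
    unfolding sing_ref_def .
  moreover have "inverse c * (2 * x) / 2 - inverse x = x / c - 1 / x" for c
    by (simp add: inverse_eq_divide)
  ultimately show ?thesis by (simp only:)
qed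

lemma sing_diff_deriv:
  assumes "x > 0"
  shows "(sing_diff has_real_derivative sing_diff' x) (at x)"
proof -
  have "((\<lambda>x. - ln (1 - exp (-x))) has_real_derivative (- exp (-x) / (1 - exp (-x)))) (at x)"
    using assms by (auto intro!: derivative_eq_intros)
  from DERIV_diff[OF this sing_ref_deriv[OF assms]] show ?thesis
    unfolding sing_diff_def sing_diff'_def by (simp add: algebra_simps)
qed

lemma sing_diff'_deriv:
  assumes "x > 0"
  shows "(sing_diff' has_real_derivative sing_diff'' x) (at x)"
proof -
  have pos: "1 + x\<^sup>2 \<noteq> 0" by (metis add_pos_nonneg less_irrefl zero_le_power2 zero_less_one)
  have q: "1 - exp (-x) \<noteq> 0" using assms by simp
  have 1: "((\<lambda>x. - exp (-x) / (1 - exp (-x))) has_real_derivative psum1 x) (at x)"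
    using q by (auto intro!: derivative_eq_intros simp: psum1_def power2_eq_square algebra_simps)
  have 2: "((\<lambda>x. 1 / x) has_real_derivative (- (1 / x\<^sup>2))) (at x)"
    using assms by (auto intro!: derivative_eq_intros simp: power2_eq_square)
  have 3: "((\<lambda>x. x / (1 + x\<^sup>2)) has_real_derivative ((1 - x\<^sup>2) / (1 + x\<^sup>2)\<^sup>2)) (at x)"
    using pos by (auto intro!: derivative_eq_intros simp: power2_eq_square algebra_simps)
  show ?thesis
    using DERIV_diff[OF DERIV_add[OF 1 2] 3] unfolding sing_diff'_def sing_diff''_def by simp
qed

text \<open>This is what the subtraction of \<open>sing_ref\<close> achieves: the double poles at 0
  cancel and the second derivative is integrable. The cut at x = 2 is where the bounds 1/4 and 1/x^2
  on 1/x^2 - psum1 x meet, and (5/4) / (1 + x^2) equals 1/4 there.\<close>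

lemma sing_diff''_bound:
  assumes "x > 0"
  shows "\<bar>sing_diff'' x\<bar> \<le> 3 / (1 + x\<^sup>2)"
proof -
  have "1 / x\<^sup>2 - psum1 x \<le> (5 / 4) / (1 + x\<^sup>2)"
  proof (cases "x \<le> 2")
    case True
    hence "x\<^sup>2 \<le> 2\<^sup>2" using assms by (intro power_mono) auto
    hence "1 / 4 \<le> (5 / 4) / (1 + x\<^sup>2)" by (simp add: field_simps add_pos_nonneg)
    thus ?thesis using psum1_ge[OF assms] by linarith
  next
    case False
    hence "2\<^sup>2 \<le> x\<^sup>2" by (intro power_mono) auto
    hence "1 / x\<^sup>2 \<le> (5 / 4) / (1 + x\<^sup>2)" using assms by (simp add: field_simps add_pos_nonneg)
    thus ?thesis using psum1_nonneg[OF assms] by linarith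
  qed
  moreover have "1 / x\<^sup>2 - psum1 x \<ge> 0" using psum1_le[OF assms] by simp
  moreover have "\<bar>(1 - x\<^sup>2) / (1 + x\<^sup>2)\<^sup>2\<bar> \<le> 1 / (1 + x\<^sup>2)"
  proof -
    have pos: "1 + x\<^sup>2 > 0" by (simp add: add_pos_nonneg)
    have "\<bar>1 - x\<^sup>2\<bar> \<le> 1 + x\<^sup>2" using zero_le_power2[of x] by linarith
    hence "\<bar>1 - x\<^sup>2\<bar> / (1 + x\<^sup>2)\<^sup>2 \<le> (1 + x\<^sup>2) / (1 + x\<^sup>2)\<^sup>2" by (intro divide_right_mono) auto
    thus ?thesis using pos by (simp add: power2_eq_square)
  qed
  moreover have "(5 / 4) / (1 + x\<^sup>2) + 1 / (1 + x\<^sup>2) \<le> 3 / (1 + x\<^sup>2)"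
    unfolding add_divide_distrib[symmetric] by (intro divide_right_mono) auto
  ultimately show ?thesis unfolding sing_diff''_def by linarith
qed

section \<open>An explicit antiderivative of the regularised summand\<close>

definition dilog_exp :: "real \<Rightarrow> real" where
  "dilog_exp x = (\<Sum>k. exp (-x) ^ Suc k / real (Suc k) ^ 2)"

text \<open>\<open>dilog_exp\<close> is the dilogarithm of exp (-x), with derivative ln (1 - exp
  (-x)), and x * sing_ref x + arctan x is an antiderivative of \<open>sing_ref\<close>; so this is
  one of \<open>sing_diff\<close>. Its limits at 0 and at infinity give the integral of
  \<open>sing_diff\<close> as pi^2 / 6 - pi / 2.\<close>

definition sing_diff_int :: "real \<Rightarrow> real" where
  "sing_diff_int x = - dilog_exp x - x * sing_ref x - arctan x"

lemma dilog_exp_deriv: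
  assumes "x > 0"
  shows "(dilog_exp has_real_derivative ln (1 - exp (-x))) (at x)"
proof -
  define z where "z = exp (-x)"
  have z: "0 < z" "z < 1" using assms by (auto simp: z_def)
  have "((\<lambda>y. \<Sum>k. 1 / real (Suc k) ^ 2 * y ^ Suc k) has_real_derivative
          (\<Sum>k. 1 / real (Suc k) ^ 2 * real (Suc k) * z ^ k)) (at z)"
  proof (rule DERIV_power_series'[of 1])
    fix y :: real assume "y \<in> {-1<..<1}"
    hence y: "\<bar>y\<bar> < 1" by auto
    show "summable (\<lambda>k. 1 / real (Suc k) ^ 2 * real (Suc k) * y ^ k)"
    proof (rule summable_comparison_test'[OF summable_geometric[of "\<bar>y\<bar>"], of 0])
      fix k
      have "\<bar>1 / real (Suc k) ^ 2 * real (Suc k)\<bar> \<le> 1" by (simp add: power2_eq_square del: of_nat_Suc)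
      hence "\<bar>1 / real (Suc k) ^ 2 * real (Suc k)\<bar> * \<bar>y\<bar> ^ k \<le> 1 * \<bar>y\<bar> ^ k" by (intro mult_right_mono) auto
      thus "norm (1 / real (Suc k) ^ 2 * real (Suc k) * y ^ k) \<le> \<bar>y\<bar> ^ k"
        by (simp add: abs_mult power_abs del: of_nat_Suc)
    qed (use y in auto)
  qed (use z in auto)
  also have "(\<lambda>y. \<Sum>k. 1 / real (Suc k) ^ 2 * y ^ Suc k) = (\<lambda>y. \<Sum>k. y ^ Suc k / real (Suc k) ^ 2)" by simp
  also have "(\<Sum>k. 1 / real (Suc k) ^ 2 * real (Suc k) * z ^ k) = - ln (1 - z) / z"
  proof (rule sums_unique[symmetric])
    have "(\<lambda>n. - (z ^ n / real n)) sums ln (1 - z)" using ln_series'[of "-z"] z by simp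
    hence "(\<lambda>n. z ^ n / real n) sums (- ln (1 - z))" using sums_minus by fastforce
    hence "(\<lambda>n. z ^ Suc n / real (Suc n)) sums (- ln (1 - z))" by (subst sums_Suc_iff) simp
    hence "(\<lambda>n. z ^ Suc n / real (Suc n) / z) sums (- ln (1 - z) / z)" by (rule sums_divide)
    thus "(\<lambda>k. 1 / real (Suc k) ^ 2 * real (Suc k) * z ^ k) sums (- ln (1 - z) / z)"
      using z by (simp add: power2_eq_square del: of_nat_Suc)
  qed
  finally have D: "((\<lambda>y. \<Sum>k. y ^ Suc k / real (Suc k) ^ 2) has_real_derivative (- ln (1 - z) / z)) (at (exp (-x)))"
    unfolding z_def .
  have "((\<lambda>x. exp (-x)) has_real_derivative (- z)) (at x)"
    unfolding z_def by (auto intro!: derivative_eq_intros)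
  from DERIV_chain2[OF D this] show ?thesis using z unfolding dilog_exp_def z_def by simp
qed

lemma dilog_exp_at_0: "(dilog_exp \<longlongrightarrow> pi\<^sup>2 / 6) (at_right 0)"
proof -
  have "(dilog_exp \<longlongrightarrow> (\<Sum>k. 1 / real (Suc k) ^ 2)) (at_right 0)"
    unfolding dilog_exp_def
  proof (rule tannery_uniform)
    fix k show "((\<lambda>x::real. exp (-x) ^ Suc k / real (Suc k) ^ 2) \<longlongrightarrow> 1 / real (Suc k) ^ 2) (at_right 0)"
      by (auto intro!: tendsto_eq_intros simp del: power_Suc)
  next
    show "eventually (\<lambda>x. \<forall>k. norm (exp (-x) ^ Suc k / real (Suc k) ^ 2) \<le> 1 / real (Suc k) ^ 2) (at_right 0)"
      using eventually_at_right_less[of 0]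
      by eventually_elim
         (auto intro!: divide_right_mono power_le_one simp: norm_divide norm_power simp del: power_Suc of_nat_Suc)
  qed (use summable_inverse_squares[of 1] in auto)
  thus ?thesis using sums_unique[OF inverse_squares_sums'] by simp
qed

lemma dilog_exp_at_top: "(dilog_exp \<longlongrightarrow> 0) at_top"
proof -
  have "(dilog_exp \<longlongrightarrow> (\<Sum>k. 0)) at_top"
    unfolding dilog_exp_def
  proof (rule tannery_uniform)
    fix k :: nat
    have "((\<lambda>x. exp (-x)) \<longlongrightarrow> (0::real)) at_top" by real_asymp
    hence "((\<lambda>x::real. exp (-x) ^ Suc k / real (Suc k) ^ 2) \<longlongrightarrow> 0 ^ Suc k / real (Suc k) ^ 2) at_top"
      by (intro tendsto_intros) auto
    thus "((\<lambda>x::real. exp (-x) ^ Suc k / real (Suc k) ^ 2) \<longlongrightarrow> 0) at_top" by simp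
  next
    show "eventually (\<lambda>x. \<forall>k. norm (exp (-x) ^ Suc k / real (Suc k) ^ 2) \<le> 1 / real (Suc k) ^ 2) at_top"
      using eventually_gt_at_top[of 0]
      by eventually_elim
         (auto intro!: divide_right_mono power_le_one simp: norm_divide norm_power simp del: power_Suc of_nat_Suc)
  qed (use summable_inverse_squares[of 1] in auto)
  thus ?thesis by simp
qed

lemma sing_diff_int_deriv:
  assumes "x > 0"
  shows "(sing_diff_int has_real_derivative sing_diff x) (at x)"
proof -
  have pos: "1 + x\<^sup>2 > 0" by (simp add: add_pos_nonneg)
  have "((\<lambda>x. - dilog_exp x - x * sing_ref x - arctan x) has_real_derivative
      (- ln (1 - exp (-x)) - (x * (x / (1 + x\<^sup>2) - 1 / x) + sing_ref x) - 1 / (1 + x\<^sup>2))) (at x)"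
    by (rule derivative_eq_intros dilog_exp_deriv assms sing_ref_deriv refl)+ (simp add: divide_inverse)
  also have "x * (x / (1 + x\<^sup>2) - 1 / x) = x\<^sup>2 / (1 + x\<^sup>2) - 1"
    using assms by (simp add: right_diff_distrib power2_eq_square)
  also have "\<dots> = - (1 / (1 + x\<^sup>2))" using pos by (simp add: divide_simps)
  also have "- ln (1 - exp (-x)) - (- (1 / (1 + x\<^sup>2)) + sing_ref x) - 1 / (1 + x\<^sup>2) = sing_diff x"
    by (simp add: sing_diff_def)
  finally show ?thesis unfolding sing_diff_int_def .
qed

lemma sing_diff_int_at_0: "(sing_diff_int \<longlongrightarrow> - (pi\<^sup>2 / 6)) (at_right 0)"
proof -
  have "((\<lambda>x. x * sing_ref x + arctan x) \<longlongrightarrow> 0) (at_right 0)"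
    unfolding sing_ref_def by real_asymp
  from tendsto_diff[OF tendsto_minus[OF dilog_exp_at_0] this] show ?thesis
    unfolding sing_diff_int_def by (simp add: algebra_simps)
qed

lemma sing_diff_int_at_top: "(sing_diff_int \<longlongrightarrow> - (pi / 2)) at_top"
proof -
  have "((\<lambda>x. x * sing_ref x + arctan x) \<longlongrightarrow> pi / 2) at_top"
    unfolding sing_ref_def by real_asymp
  from tendsto_diff[OF tendsto_minus[OF dilog_exp_at_top] this] show ?thesis
    unfolding sing_diff_int_def by (simp add: algebra_simps)
qed

text \<open>Since the limit is 0, the trapezoid rule leaves no boundary constant at 0, and the
  constant in \<open>lambert_asymptotics\<close> comes from \<open>sing_ref\<close> alone.\<close>

lemma sing_diff_at_0: "(sing_diff \<longlongrightarrow> 0) (at_right 0)"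
proof -
  have "((\<lambda>x::real. (1 - exp (-x)) / x) \<longlongrightarrow> 1) (at_right 0)" by real_asymp
  moreover have "((\<lambda>x::real. 1 + x\<^sup>2) \<longlongrightarrow> 1 + 0\<^sup>2) (at_right 0)" by (intro tendsto_intros)
  ultimately have "((\<lambda>x::real. - ln ((1 - exp (-x)) / x) - ln (1 + x\<^sup>2) / 2) \<longlongrightarrow> - ln 1 - ln (1 + 0\<^sup>2) / 2) (at_right 0)"
    by (intro tendsto_intros) auto
  hence *: "((\<lambda>x::real. - ln ((1 - exp (-x)) / x) - ln (1 + x\<^sup>2) / 2) \<longlongrightarrow> 0) (at_right 0)" by simp
  show ?thesis
  proof (rule Lim_transform_eventually[OF *])
    show "eventually (\<lambda>x. - ln ((1 - exp (-x)) / x) - ln (1 + x\<^sup>2) / 2 = sing_diff x) (at_right 0)"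
      using eventually_at_right_less[of 0]
      by eventually_elim (simp add: sing_diff_def sing_ref_def ln_div)
  qed
qed

text \<open>The error is viewed as a function \<open>e\<close> of the panel width s. Its derivative
  is half of d (a+s) - d a - s * d' (a+s), which two applications of the mean value theorem bound by
  t^2 * B; a third one, to \<open>e\<close> itself, gives t^3 * B. Only the order in t matters
  later, not the constant.\<close>

lemma trapezoid_rule_error:
  fixes K d d' d'' :: "real \<Rightarrow> real"
  assumes "t > 0"
    and K: "\<And>x. a \<le> x \<Longrightarrow> x \<le> a + t \<Longrightarrow> (K has_real_derivative d x) (at x)"
    and d: "\<And>x. a \<le> x \<Longrightarrow> x \<le> a + t \<Longrightarrow> (d has_real_derivative d' x) (at x)"
    and d': "\<And>x. a \<le> x \<Longrightarrow> x \<le> a + t \<Longrightarrow> (d' has_real_derivative d'' x) (at x)"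
    and B: "\<And>x. a \<le> x \<Longrightarrow> x \<le> a + t \<Longrightarrow> \<bar>d'' x\<bar> \<le> B"
  shows "\<bar>K (a + t) - K a - t / 2 * (d a + d (a + t))\<bar> \<le> t ^ 3 * B"
proof -
  define e where "e = (\<lambda>s. K (a + s) - K a - s / 2 * (d a + d (a + s)))"
  define e' where "e' = (\<lambda>s. (d (a + s) - d a - s * d' (a + s)) / 2)"
  have e: "(e has_real_derivative e' s) (at s)" if "0 \<le> s" "s \<le> t" for s
  proof -
    have 1: "((\<lambda>s. K (a + s)) has_real_derivative d (a + s)) (at s)"
      using DERIV_chain2[where f = K and g = "\<lambda>s. a + s" and Da = "d (a + s)" and Db = 1 and x = s and s = UNIV]
        K[of "a + s"] that DERIV_add[OF DERIV_const[of a] DERIV_ident] by simp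
    have 2: "((\<lambda>s. d (a + s)) has_real_derivative d' (a + s)) (at s)"
      using DERIV_chain2[where f = d and g = "\<lambda>s. a + s" and Da = "d' (a + s)" and Db = 1 and x = s and s = UNIV]
        d[of "a + s"] that DERIV_add[OF DERIV_const[of a] DERIV_ident] by simp
    have 3: "((\<lambda>s::real. s / 2) has_real_derivative 1 / 2) (at s)"
      using DERIV_cdivide[OF DERIV_ident] .
    have "d (a + s) - 0 - (1 / 2 * (d a + d (a + s)) + (0 + d' (a + s)) * (s / 2)) = e' s"
      by (simp add: e'_def field_simps)
    with DERIV_diff[OF DERIV_diff[OF 1 DERIV_const[of "K a"]] DERIV_mult[OF 3 DERIV_add[OF DERIV_const[of "d a"] 2]]]
    show ?thesis unfolding e_def by simp
  qed
  have "B \<ge> 0" using B[of a] assms(1) by simp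
  have e'_bound: "\<bar>e' s\<bar> \<le> t\<^sup>2 * B" if s: "0 < s" "s < t" for s
  proof -
    obtain u where u: "a < u" "u < a + s" "d (a + s) - d a = s * d' u"
      using MVT2[of a "a + s" d d'] d s by (auto simp: algebra_simps)
    obtain v where v: "u < v" "v < a + s" "d' (a + s) - d' u = (a + s - u) * d'' v"
      using MVT2[of u "a + s" d' d''] d' s u by auto
    have "e' s = - s * (a + s - u) * d'' v / 2"
    proof -
      have "e' s = - s * (d' (a + s) - d' u) / 2" unfolding e'_def u(3) by (simp add: algebra_simps)
      thus ?thesis unfolding v(3) by (simp add: mult.assoc)
    qed
    hence "\<bar>e' s\<bar> = s * (a + s - u) * \<bar>d'' v\<bar> / 2" using s u by (simp add: abs_mult)
    also have "\<dots> \<le> t * t * B / 2"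
      using s u v B[of v] by (intro divide_right_mono mult_mono) auto
    also have "\<dots> \<le> t\<^sup>2 * B" using \<open>B \<ge> 0\<close> by (simp add: power2_eq_square)
    finally show ?thesis .
  qed
  obtain s where s: "0 < s" "s < t" "e t - e 0 = (t - 0) * e' s"
    using MVT2[of 0 t e e'] e assms(1) by auto
  have "\<bar>e t\<bar> = t * \<bar>e' s\<bar>" using s assms(1) by (simp add: e_def abs_mult)
  also have "\<dots> \<le> t * (t\<^sup>2 * B)" using e'_bound[OF s(1,2)] assms(1) by (intro mult_left_mono) auto
  finally show ?thesis by (simp add: e_def power2_eq_square power3_eq_cube mult_ac)
qed

text \<open>The panels [m t, (m+1) t] with m \<ge> 1 cover [t, infinity), and the last term on the
  left corrects the half weight of the first node. The interval [0, t] is left out because the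
  derivatives are available only for x > 0; its contribution is the value of
  \<open>sing_diff_int\<close> at t.\<close>

lemma sing_diff_trapezoid:
  assumes "t > 0"
  shows "\<bar>- (pi / 2) - sing_diff_int t - t * (\<Sum>m. sing_diff (real (Suc m) * t)) + t / 2 * sing_diff t\<bar>
    \<le> 3 * (\<Sum>k. real (Suc k) powr (-3/2)) * t powr (3/2)"
proof -
  define D where "D = (\<lambda>m. sing_diff (real (Suc m) * t))"
  define K where "K = (\<lambda>m. sing_diff_int (real (Suc m) * t))"
  define S where "S = (\<Sum>m. D m)"
  have D: "D sums S" unfolding D_def S_def using sing_diff_sums[OF assms] by (simp add: sums_iff)
  have "filterlim (\<lambda>m. real (Suc m) * t) at_top sequentially" using assms by real_asymp
  hence "K \<longlonglongrightarrow> - (pi / 2)" unfolding K_def by (rule filterlim_compose[OF sing_diff_int_at_top])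
  hence "(\<lambda>m. K (Suc m) - K m) sums (- (pi / 2) - K 0)" by (rule telescope_sums)
  moreover have "(\<lambda>m. t / 2 * (D m + D (Suc m))) sums (t / 2 * (S + (S - D 0)))"
    using D by (intro sums_mult sums_add) (simp_all add: sums_Suc_iff)
  ultimately have sums: "(\<lambda>m. K (Suc m) - K m - t / 2 * (D m + D (Suc m))) sums
      (- (pi / 2) - K 0 - t / 2 * (S + (S - D 0)))" by (rule sums_diff)
  have bound: "\<bar>K (Suc m) - K m - t / 2 * (D m + D (Suc m))\<bar> \<le> 3 * real (Suc m) powr (-3/2) * t powr (3/2)" for m
  proof -
    define a where "a = real (Suc m) * t"
    have a: "a > 0" using assms by (simp add: a_def)
    have a': "real (Suc (Suc m)) * t = a + t" by (simp add: a_def algebra_simps)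
    \<comment> \<open>The exponent 3/2 is larger than 1, so that the panel errors are summable over
      m, and smaller than 2, so that t^3 * a^(-3/2) still sums to o(t).\<close>
    have pow: "a powr (3/2) \<le> 1 + a\<^sup>2"
    proof (cases "a \<le> 1")
      case True
      hence "a powr (3/2) \<le> 1" using a by (simp add: powr_le1)
      thus ?thesis using zero_le_power2[of a] by linarith
    next
      case False
      hence "a powr (3/2) \<le> a powr 2" by (intro powr_mono) auto
      thus ?thesis using a by (simp add: powr_numeral)
    qed
    have "\<bar>sing_diff_int (a + t) - sing_diff_int a - t / 2 * (sing_diff a + sing_diff (a + t))\<bar>
            \<le> t ^ 3 * (3 / (1 + a\<^sup>2))"
    proof (rule trapezoid_rule_error[OF assms sing_diff_int_deriv sing_diff_deriv sing_diff'_deriv])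
      fix x assume x: "a \<le> x"
      have "a\<^sup>2 \<le> x\<^sup>2" using x a by (intro power_mono) auto
      hence "3 / (1 + x\<^sup>2) \<le> 3 / (1 + a\<^sup>2)"
        by (intro divide_left_mono mult_pos_pos) (auto simp: add_pos_nonneg)
      thus "\<bar>sing_diff'' x\<bar> \<le> 3 / (1 + a\<^sup>2)" using sing_diff''_bound[of x] x a by linarith
    qed (use a in auto)
    also have "\<dots> \<le> t ^ 3 * (3 / (a powr (3/2)))"
      using pow a assms by (intro mult_left_mono divide_left_mono) (auto simp: add_pos_nonneg)
    also have "3 / (a powr (3/2)) = 3 * real (Suc m) powr (-3/2) * t powr (-3/2)"
      using powr_mult[of "real (Suc m)" t "-3/2"] assms by (simp add: a_def powr_minus_divide del: of_nat_Suc)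
    also have "t ^ 3 * (3 * real (Suc m) powr (-3/2) * t powr (-3/2)) = 3 * real (Suc m) powr (-3/2) * (t ^ 3 * t powr (-3/2))"
      by (simp only: mult_ac)
    also have "t ^ 3 * t powr (-3/2) = t powr 3 * t powr (-3/2)" using assms by simp
    also have "\<dots> = t powr (3/2)" unfolding powr_add[symmetric] by simp
    finally show ?thesis unfolding D_def K_def a' a_def[symmetric] .
  qed
  have P: "(\<lambda>k. 3 * real (Suc k) powr (-3/2) * t powr (3/2)) sums
      (3 * (\<Sum>k. real (Suc k) powr (-3/2)) * t powr (3/2))"
    by (intro sums_mult sums_mult2 summable_sums summable_Suc_powr) simp
  have "\<bar>- (pi / 2) - K 0 - t / 2 * (S + (S - D 0))\<bar> \<le> 3 * (\<Sum>k. real (Suc k) powr (-3/2)) * t powr (3/2)"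
  proof (rule abs_leI)
    show "- (pi / 2) - K 0 - t / 2 * (S + (S - D 0)) \<le> 3 * (\<Sum>k. real (Suc k) powr (-3/2)) * t powr (3/2)"
      by (rule sums_le[OF _ sums P]) (use bound abs_le_D1 in blast)
    show "- (- (pi / 2) - K 0 - t / 2 * (S + (S - D 0))) \<le> 3 * (\<Sum>k. real (Suc k) powr (-3/2)) * t powr (3/2)"
      by (rule sums_le[OF _ sums_minus[OF sums] P]) (use bound abs_le_D2 in blast)
  qed
  also have "- (pi / 2) - K 0 - t / 2 * (S + (S - D 0)) =
      - (pi / 2) - sing_diff_int t - t * S + t / 2 * sing_diff t"
    by (simp add: K_def D_def field_simps)
  finally show ?thesis by (simp only: S_def D_def)
qed

text \<open>Divided by t, the trapezoid estimate says that the sum of \<open>sing_diff\<close> is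
  (pi^2 / 6 - pi / 2) / t + o(1). The term - pi / (2 t), which stems from the arctangent, is
  cancelled by the exponential growth of sinh (pi / t) in \<open>sing_ref_sums\<close>; the factor t
  / (2 pi) remaining there supplies the logarithm.\<close>

lemma lambert_asymptotics:
  "((\<lambda>t. lambert (exp (-t)) - pi\<^sup>2 / 6 / t - ln (t / (2 * pi)) / 2) \<longlongrightarrow> 0) (at_right (0::real))"
proof -
  define C where "C = 3 * (\<Sum>k. real (Suc k) powr (-3/2))"
  define S where "S = (\<lambda>t. \<Sum>m. sing_diff (real (Suc m) * t))"
  define R where "R = (\<lambda>t. (- (pi / 2) - sing_diff_int t) / t - S t + sing_diff t / 2)"
  have R: "(R \<longlongrightarrow> 0) (at_right 0)"
  proof (rule Lim_null_comparison)
    show "((\<lambda>t. C * t powr (1/2)) \<longlongrightarrow> 0) (at_right 0)" by real_asymp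
    show "eventually (\<lambda>t. norm (R t) \<le> C * t powr (1/2)) (at_right 0)"
      using eventually_at_right_less[of 0]
    proof eventually_elim
      case (elim t)
      have "R t = (- (pi / 2) - sing_diff_int t - t * S t + t / 2 * sing_diff t) / t"
        using elim by (simp add: R_def field_simps)
      also have "\<bar>\<dots>\<bar> \<le> C * t powr (3/2) / t"
        using sing_diff_trapezoid[OF elim] elim unfolding C_def S_def by (simp add: divide_right_mono)
      also have "\<dots> = C * t powr (1/2)" using elim powr_diff[of t "3/2" 1] by simp
      finally show ?case by simp
    qed
  qed
  \<comment> \<open>The contribution of [0, t], divided by t: by l'Hopital's rule it tends to the
    value 0 of \<open>sing_diff\<close> at 0.\<close>
  have "((\<lambda>t. (sing_diff_int t + pi\<^sup>2 / 6) / t) \<longlongrightarrow> 0) (at_right 0)"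
  proof (rule lhopital_right_0)
    show "((\<lambda>t. sing_diff_int t + pi\<^sup>2 / 6) \<longlongrightarrow> 0) (at_right 0)"
      using tendsto_add[OF sing_diff_int_at_0 tendsto_const[of "pi\<^sup>2 / 6"]] by simp
    show "eventually (\<lambda>x. ((\<lambda>t. sing_diff_int t + pi\<^sup>2 / 6) has_real_derivative sing_diff x) (at x)) (at_right 0)"
      using eventually_at_right_less[of 0]
      by eventually_elim (auto intro!: derivative_eq_intros sing_diff_int_deriv)
    show "eventually (\<lambda>x. ((\<lambda>t. t) has_real_derivative 1) (at x)) (at_right (0::real))" by simp
  qed (use sing_diff_at_0 eventually_at_right_less[of "0::real"] in \<open>auto elim: eventually_mono\<close>)
  moreover have "((\<lambda>t. ln (sinh (pi / t) / (pi / t)) / 2 - pi / (2 * t) - ln (t / (2 * pi)) / 2) \<longlongrightarrow> 0) (at_right 0)"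
  proof -
    have "((\<lambda>t. ln (1 - exp (- (2 * pi / t))) / 2) \<longlongrightarrow> 0) (at_right 0)" by real_asymp
    moreover have "eventually (\<lambda>t. ln (1 - exp (- (2 * pi / t))) / 2 =
        ln (sinh (pi / t) / (pi / t)) / 2 - pi / (2 * t) - ln (t / (2 * pi)) / 2) (at_right 0)"
      using eventually_at_right_less[of 0]
    proof eventually_elim
      case (elim t)
      have gen: "E / 2 / (pi / t) = E * (t / (2 * pi))" for E by simp
      have "sinh (pi / t) = exp (pi / t) * (1 - exp (- (2 * pi / t))) / 2"
        by (simp add: sinh_def algebra_simps flip: exp_add)
      hence "sinh (pi / t) / (pi / t) = exp (pi / t) * (1 - exp (- (2 * pi / t))) * (t / (2 * pi))"
        using gen by (simp only:)
      moreover have "ln (A * B * C) = ln A + ln B + ln C" if "A > 0" "B > 0" "C > 0" for A B C :: real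
        using that by (simp add: ln_mult_pos)
      from this[of "exp (pi / t)" "1 - exp (- (2 * pi / t))" "t / (2 * pi)"]
      have "ln (exp (pi / t) * (1 - exp (- (2 * pi / t))) * (t / (2 * pi))) =
          pi / t + ln (1 - exp (- (2 * pi / t))) + ln (t / (2 * pi))" using elim by simp
      ultimately have "ln (sinh (pi / t) / (pi / t)) = pi / t + ln (1 - exp (- (2 * pi / t))) + ln (t / (2 * pi))"
        by (simp only:)
      moreover have "pi / (2 * t) = pi / t / 2" by simp
      ultimately show ?case by linarith
    qed
    ultimately show ?thesis by (rule Lim_transform_eventually)
  qed
  ultimately have "((\<lambda>t. - R t - (sing_diff_int t + pi\<^sup>2 / 6) / t + sing_diff t / 2 +
     (ln (sinh (pi / t) / (pi / t)) / 2 - pi / (2 * t) - ln (t / (2 * pi)) / 2)) \<longlongrightarrow> - 0 - 0 + 0 / 2 + 0) (at_right 0)"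
    by (intro tendsto_intros R sing_diff_at_0) auto
  hence lim: "((\<lambda>t. - R t - (sing_diff_int t + pi\<^sup>2 / 6) / t + sing_diff t / 2 +
     (ln (sinh (pi / t) / (pi / t)) / 2 - pi / (2 * t) - ln (t / (2 * pi)) / 2)) \<longlongrightarrow> 0) (at_right 0)" by simp
  show ?thesis
  proof (rule Lim_transform_eventually[OF lim])
    show "eventually (\<lambda>t. - R t - (sing_diff_int t + pi\<^sup>2 / 6) / t + sing_diff t / 2 +
     (ln (sinh (pi / t) / (pi / t)) / 2 - pi / (2 * t) - ln (t / (2 * pi)) / 2) =
       lambert (exp (-t)) - pi\<^sup>2 / 6 / t - ln (t / (2 * pi)) / 2) (at_right 0)"
      using eventually_at_right_less[of 0]
    proof eventually_elim
      case (elim t)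
      have "S t = lambert (exp (-t)) - ln (sinh (pi / t) / (pi / t)) / 2"
        unfolding S_def using sing_diff_sums[OF elim] by (simp add: sums_iff)
      thus ?case using elim by (simp add: R_def add_divide_distrib diff_divide_distrib)
    qed
  qed
qed

section \<open>The generating function near and away from the positive axis\<close>

lemma exp_imag_Taylor:
  fixes x :: real
  shows "norm (exp (\<i> * x) - 1 - \<i> * x + x\<^sup>2 / 2) \<le> \<bar>x\<bar> ^ 3 / 2"
proof -
  have "norm (exp (\<i> * x) - (\<Sum>k\<le>2. (\<i> * complex_of_real x) ^ k / fact k)) \<le>
      exp \<bar>Re (\<i> * x)\<bar> * norm (\<i> * complex_of_real x) ^ Suc 2 / fact 2"
    by (rule Taylor_exp)
  also have "(\<Sum>k\<le>2. (\<i> * complex_of_real x) ^ k / fact k) = 1 + \<i> * x - x\<^sup>2 / 2"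
    by (simp add: numeral_2_eq_2 power2_eq_square algebra_simps)
  finally show ?thesis by (simp add: norm_mult numeral_3_eq_3 algebra_simps)
qed

text \<open>The left quotient is the sum of exp (-m x) * exp (i m \<alpha>), and each factor exp (i
  m \<alpha>) is expanded to second order. Only the angle is expanded, so the coefficients and the
  error are the real power sums at x.\<close>

lemma lambert_term_Taylor:
  fixes x \<alpha> :: real
  assumes "x > 0"
  defines "a \<equiv> exp (of_real (-x) + \<i> * of_real \<alpha>)"
  shows "norm (a / (1 - a) - of_real (exp (-x) / (1 - exp (-x))) - \<i> * of_real (\<alpha> * psum1 x) + of_real (\<alpha>\<^sup>2 / 2 * psum2 x))
    \<le> \<bar>\<alpha>\<bar> ^ 3 / 2 * psum3 x"
proof -
  define q where "q = exp (-x)"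
  have q: "0 < q" "q < 1" using assms by (auto simp: q_def)
  have a: "a = of_real q * exp (\<i> * of_real \<alpha>)" by (simp only: a_def q_def exp_add exp_of_real)
  have na: "norm a = q" using q by (simp add: a norm_mult)
  have am: "a ^ m = of_real (q ^ m) * exp (\<i> * of_real (real m * \<alpha>))" for m
    by (simp add: a power_mult_distrib exp_of_nat_mult[symmetric] mult_ac)
  have ne: "1 - a \<noteq> 0" using na q by auto
  have 1: "(\<lambda>m. a ^ m) sums (1 / (1 - a))" using geometric_sums[of a] na q by simp
  have 2: "(\<lambda>m. complex_of_real (q ^ m)) sums of_real (1 / (1 - q))"
    using geometric_sums[of q] q by (intro sums_of_real) simp
  have 3: "(\<lambda>m. \<i> * of_real \<alpha> * of_real (real m ^ 1 * q ^ m)) sums (\<i> * of_real \<alpha> * of_real (psum1 x))"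
    unfolding q_def by (intro sums_mult sums_of_real psum1_sums assms)
  have 4: "(\<lambda>m. of_real (\<alpha>\<^sup>2 / 2) * complex_of_real (real m ^ 2 * q ^ m)) sums (of_real (\<alpha>\<^sup>2 / 2) * of_real (psum2 x))"
    unfolding q_def by (intro sums_mult sums_of_real psum2_sums assms)
  define T where "T = (\<lambda>m. a ^ m - of_real (q ^ m) - \<i> * of_real \<alpha> * of_real (real m ^ 1 * q ^ m)
       + of_real (\<alpha>\<^sup>2 / 2) * complex_of_real (real m ^ 2 * q ^ m))"
  define L where "L = 1 / (1 - a) - of_real (1 / (1 - q)) - \<i> * of_real \<alpha> * of_real (psum1 x) + of_real (\<alpha>\<^sup>2 / 2) * of_real (psum2 x)"
  have T: "T sums L" unfolding T_def L_def by (intro sums_add sums_diff 1 2 3 4)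
  have B: "(\<lambda>m. \<bar>\<alpha>\<bar> ^ 3 / 2 * (real m ^ 3 * q ^ m)) sums (\<bar>\<alpha>\<bar> ^ 3 / 2 * psum3 x)"
    unfolding q_def by (intro sums_mult psum3_sums assms)
  have "norm (T m) \<le> \<bar>\<alpha>\<bar> ^ 3 / 2 * (real m ^ 3 * q ^ m)" for m
  proof -
    have "T m = of_real (q ^ m) * (exp (\<i> * of_real (real m * \<alpha>)) - 1 - \<i> * of_real (real m * \<alpha>) + of_real ((real m * \<alpha>)\<^sup>2 / 2))"
      unfolding T_def am by (simp add: algebra_simps power_mult_distrib)
    hence "norm (T m) = q ^ m * norm (exp (\<i> * of_real (real m * \<alpha>)) - 1 - \<i> * of_real (real m * \<alpha>) + of_real ((real m * \<alpha>)\<^sup>2 / 2))"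
      using q by (simp only: norm_mult norm_of_real) simp
    also have "\<dots> \<le> q ^ m * (\<bar>real m * \<alpha>\<bar> ^ 3 / 2)"
      using exp_imag_Taylor[of "real m * \<alpha>"] q by (intro mult_left_mono) auto
    finally show ?thesis by (simp add: abs_mult power_mult_distrib mult_ac)
  qed
  hence "norm (\<Sum>m. T m) \<le> (\<Sum>m. \<bar>\<alpha>\<bar> ^ 3 / 2 * (real m ^ 3 * q ^ m))"
    by (intro norm_suminf_le sums_summable[OF B]) auto
  hence "norm L \<le> \<bar>\<alpha>\<bar> ^ 3 / 2 * psum3 x" using T B by (simp add: sums_iff)
  \<comment> \<open>The geometric series above start at m = 0; the two extra terms 1 cancel in the
    difference.\<close>
  moreover have "a / (1 - a) = 1 / (1 - a) - 1" using ne by (simp add: field_simps)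
  moreover have "q / (1 - q) = 1 / (1 - q) - 1" using q by (simp add: field_simps)
  ultimately have "L = a / (1 - a) - of_real (q / (1 - q)) - \<i> * of_real (\<alpha> * psum1 x) + of_real (\<alpha>\<^sup>2 / 2 * psum2 x)"
    unfolding L_def by (simp only: of_real_diff of_real_mult) simp
  with \<open>norm L \<le> _\<close> show ?thesis unfolding q_def by simp
qed

text \<open>The k-th term of the Lambert series is the previous expansion at x = k t and \<alpha> =
  k \<theta>, divided by k; this leaves the weights 1, k, k^2 of the three \<open>dsum\<close>
  functions.\<close>

lemma lambert_Taylor:
  fixes t \<theta> :: real
  assumes "t > 0"
  shows "norm (lambert (exp (of_real (-t) + \<i> * of_real \<theta>)) - of_real (lambert (exp (-t)))
      - \<i> * of_real (\<theta> * dsum1 t) + of_real (\<theta>\<^sup>2 / 2 * dsum2 t)) \<le> \<bar>\<theta>\<bar> ^ 3 / 2 * dsum3 t"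
proof -
  define w where "w = exp (of_real (-t) + \<i> * complex_of_real \<theta>)"
  define r where "r = exp (-t)"
  have nw: "norm w = r" by (simp add: w_def r_def)
  have r: "0 < r" "r < 1" using assms by (auto simp: r_def)
  have 1: "(\<lambda>k. w ^ Suc k / (of_nat (Suc k) * (1 - w ^ Suc k))) sums lambert w"
    unfolding lambert_def using nw r by (intro summable_sums summable_lambert) auto
  have 2: "(\<lambda>k. complex_of_real (r ^ Suc k / (of_nat (Suc k) * (1 - r ^ Suc k)))) sums of_real (lambert r)"
    unfolding lambert_def using r by (intro sums_of_real summable_sums summable_lambert) auto
  have 3: "(\<lambda>k. \<i> * of_real (\<theta> * psum1 (real (Suc k) * t))) sums (\<i> * of_real (\<theta> * dsum1 t))"
    unfolding dsum1_def by (intro sums_mult sums_of_real summable_sums summable_dsum1 assms)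
  have 4: "(\<lambda>k. complex_of_real (\<theta>\<^sup>2 / 2 * (real (Suc k) * psum2 (real (Suc k) * t)))) sums of_real (\<theta>\<^sup>2 / 2 * dsum2 t)"
    unfolding dsum2_def by (intro sums_mult sums_of_real summable_sums summable_dsum2 assms)
  define T where "T = (\<lambda>k. w ^ Suc k / (of_nat (Suc k) * (1 - w ^ Suc k)) - complex_of_real (r ^ Suc k / (of_nat (Suc k) * (1 - r ^ Suc k)))
     - \<i> * of_real (\<theta> * psum1 (real (Suc k) * t)) + complex_of_real (\<theta>\<^sup>2 / 2 * (real (Suc k) * psum2 (real (Suc k) * t))))"
  define L where "L = lambert w - of_real (lambert r) - \<i> * of_real (\<theta> * dsum1 t) + of_real (\<theta>\<^sup>2 / 2 * dsum2 t)"
  have T: "T sums L" unfolding T_def L_def by (intro sums_add sums_diff 1 2 3 4)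
  have B: "(\<lambda>k. \<bar>\<theta>\<bar> ^ 3 / 2 * (real (Suc k) ^ 2 * psum3 (real (Suc k) * t))) sums (\<bar>\<theta>\<bar> ^ 3 / 2 * dsum3 t)"
    unfolding dsum3_def by (intro sums_mult summable_sums summable_dsum3 assms)
  have "norm (T k) \<le> \<bar>\<theta>\<bar> ^ 3 / 2 * (real (Suc k) ^ 2 * psum3 (real (Suc k) * t))" for k
  proof -
    define K where "K = real (Suc k)"
    have K: "K > 0" by (simp add: K_def)
    define a where "a = exp (of_real (-(K * t)) + \<i> * complex_of_real (K * \<theta>))"
    have wa: "w ^ Suc k = a"
      unfolding w_def a_def K_def exp_of_nat_mult[symmetric] by (simp add: algebra_simps)
    have rq: "r ^ Suc k = exp (- (K * t))"
      unfolding r_def K_def exp_of_nat_mult[symmetric] by (simp add: algebra_simps)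
    define Z where "Z = a / (1 - a) - of_real (exp (-(K * t)) / (1 - exp (-(K * t)))) - \<i> * of_real (K * \<theta> * psum1 (K * t))
      + of_real ((K * \<theta>)\<^sup>2 / 2 * psum2 (K * t))"
    have Kc: "complex_of_nat (Suc k) = of_real K" by (simp add: K_def)
    have "T k = Z / of_real K"
    proof -
      have "a / (of_real K * (1 - a)) = a / (1 - a) / of_real K" by simp
      moreover have "exp (-(K * t)) / (K * (1 - exp (-(K * t)))) = exp (-(K * t)) / (1 - exp (-(K * t))) / K" by simp
      moreover have "\<i> * complex_of_real (\<theta> * psum1 (K * t)) = \<i> * of_real (K * \<theta> * psum1 (K * t)) / of_real K"
        using K by simp
      moreover have "complex_of_real (\<theta>\<^sup>2 / 2 * (K * psum2 (K * t))) = of_real ((K * \<theta>)\<^sup>2 / 2 * psum2 (K * t)) / of_real K"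
        using K by (simp add: power_mult_distrib power2_eq_square)
      ultimately show ?thesis unfolding T_def Z_def wa rq Kc K_def[symmetric]
        by (simp only: add_divide_distrib diff_divide_distrib of_real_divide)
    qed
    hence "norm (T k) = norm Z / K" using K by (simp add: norm_divide)
    also have "\<dots> \<le> (\<bar>K * \<theta>\<bar> ^ 3 / 2 * psum3 (K * t)) / K"
      using lambert_term_Taylor[of "K * t" "K * \<theta>"] K assms unfolding Z_def a_def
      by (intro divide_right_mono) auto
    also have "\<dots> = \<bar>\<theta>\<bar> ^ 3 / 2 * (K ^ 2 * psum3 (K * t))"
      using K by (simp add: abs_mult power_mult_distrib power2_eq_square power3_eq_cube)
    finally show ?thesis by (simp only: K_def)
  qed
  hence "norm (\<Sum>k. T k) \<le> (\<Sum>k. \<bar>\<theta>\<bar> ^ 3 / 2 * (real (Suc k) ^ 2 * psum3 (real (Suc k) * t)))"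
    by (intro norm_suminf_le sums_summable[OF B]) auto
  thus ?thesis using T B by (simp add: sums_iff L_def w_def r_def)
qed

text \<open>By 1 - cos \<theta> = 2 sin^2 (\<theta>/2) it suffices that sin x \<ge> x/3 on [0, 2],
  which follows from sin x \<ge> x - x^3 / 6. The interval reaches up to 2 because pi < 4.\<close>

lemma one_minus_cos_ge:
  assumes "\<bar>\<theta>\<bar> \<le> pi"
  shows "1 - cos \<theta> \<ge> \<theta>\<^sup>2 / 18"
proof -
  have cos_ge: "cos x \<ge> 1 - x\<^sup>2 / 2" for x :: real
  proof -
    have "\<bar>sin (x / 2)\<bar> \<le> \<bar>x / 2\<bar>" by (rule abs_sin_x_le_abs_x)
    hence "(sin (x / 2))\<^sup>2 \<le> (x / 2)\<^sup>2" by (simp only: abs_le_square_iff)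
    moreover have "cos x = 1 - 2 * (sin (x / 2))\<^sup>2" using cos_double_sin[of "x / 2"] by simp
    ultimately show ?thesis by (simp add: power2_eq_square)
  qed
  have sin_ge: "sin x \<ge> x - x ^ 3 / 6" if "x \<ge> 0" for x :: real
  proof -
    have "sin 0 - 0 + 0 ^ 3 / 6 \<le> sin x - x + x ^ 3 / 6"
    proof (rule DERIV_nonneg_imp_nondecreasing[OF that])
      fix y :: real
      have "((\<lambda>x. sin x - x + x ^ 3 / 6) has_real_derivative (cos y - 1 + y\<^sup>2 / 2)) (at y)"
        by (auto intro!: derivative_eq_intros simp: power2_eq_square)
      thus "\<exists>z. ((\<lambda>x. sin x - x + x ^ 3 / 6) has_real_derivative z) (at y) \<and> z \<ge> 0"
        using cos_ge[of y] by (intro exI[of _ "cos y - 1 + y\<^sup>2 / 2"]) auto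
    qed
    thus ?thesis by simp
  qed
  define x where "x = \<bar>\<theta>\<bar> / 2"
  have x: "0 \<le> x" "x \<le> 2" using assms pi_less_4 by (auto simp: x_def)
  have "x\<^sup>2 \<le> 2\<^sup>2" using x by (intro power_mono) auto
  hence "x * x\<^sup>2 \<le> x * 4" using x by (intro mult_left_mono) auto
  hence "x / 3 \<le> sin x" using sin_ge[OF x(1)] by (simp add: power2_eq_square power3_eq_cube)
  hence "(x / 3)\<^sup>2 \<le> (sin x)\<^sup>2" using x by (intro power_mono) auto
  moreover have "cos \<theta> = 1 - 2 * (sin x)\<^sup>2"
    using cos_double_sin[of x] by (simp add: x_def)
  ultimately show ?thesis by (simp add: x_def power2_eq_square)
qed

text \<open>Turning w away from the positive axis does not increase the real part of any term, so
  the loss in the first term can stand for the whole. That loss is r (1 + r) (1 - c) / ((1 - r) D)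
  with c = cos \<theta> and D = |1 - w|^2.\<close>

lemma lambert_decay:
  fixes t \<theta> :: real
  assumes t: "0 < t" "t \<le> 1" and \<theta>: "\<bar>\<theta>\<bar> \<le> pi"
  shows "Re (lambert (exp (of_real (-t) + \<i> * of_real \<theta>))) - lambert (exp (-t)) \<le> - (\<theta>\<^sup>2 / (2 * t * (27 * t\<^sup>2 + \<theta>\<^sup>2)))"
proof -
  define w where "w = exp (of_real (-t) + \<i> * complex_of_real \<theta>)"
  define r where "r = exp (-t)"
  have nw: "norm w = r" by (simp add: w_def r_def)
  have r: "0 < r" "r < 1" using assms by (auto simp: r_def)
  define a where "a = (\<lambda>k. w ^ Suc k / (of_nat (Suc k) * (1 - w ^ Suc k)))"
  define b where "b = (\<lambda>k. r ^ Suc k / (of_nat (Suc k) * (1 - r ^ Suc k)))"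
  have 1: "a sums lambert w"
    unfolding lambert_def a_def using nw r by (intro summable_sums summable_lambert) auto
  have 2: "b sums lambert r"
    unfolding lambert_def b_def using r by (intro summable_sums summable_lambert) auto
  have rk: "r ^ Suc k < 1" for k using r power_Suc_less_one by blast
  have le: "Re (a k) \<le> b k" for k
  proof -
    have "norm (1 - w ^ Suc k) \<ge> 1 - r ^ Suc k"
      using norm_triangle_ineq2[of 1 "w ^ Suc k"] nw by (simp add: norm_power norm_mult)
    moreover have "1 - r ^ Suc k > 0" using rk[of k] by simp
    ultimately have A: "real (Suc k) * (1 - r ^ Suc k) \<le> real (Suc k) * norm (1 - w ^ Suc k)"
      "0 < real (Suc k) * (1 - r ^ Suc k)" by (auto intro!: mult_left_mono mult_pos_pos simp del: power_Suc of_nat_Suc)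
    hence "norm (a k) \<le> b k"
      unfolding a_def b_def norm_divide norm_mult norm_of_nat norm_power nw using A r
      by (intro frac_le) auto
    thus ?thesis using complex_Re_le_cmod order_trans by blast
  qed
  have "(\<lambda>k. Re (a k) - b k) sums (Re (lambert w) - lambert r)"
    by (intro sums_diff sums_Re 1 2)
  from sums_minus[OF this] have "(\<lambda>k. b k - Re (a k)) sums (lambert r - Re (lambert w))" by simp
  hence "(\<Sum>k\<in>{0}. b k - Re (a k)) \<le> lambert r - Re (lambert w)"
    using le sum_le_suminf[of "\<lambda>k. b k - Re (a k)" "{0}"] by (simp add: sums_iff)
  hence main: "Re (lambert w) - lambert r \<le> Re (w / (1 - w)) - r / (1 - r)"
    by (simp add: a_def b_def)
  define c where "c = cos \<theta>"
  have c: "c \<le> 1" by (simp add: c_def)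
  define D where "D = (1 - r)\<^sup>2 + 2 * r * (1 - c)"
  have D: "D > 0" unfolding D_def using r c by (intro add_pos_nonneg) auto
  have w_eq: "w = of_real r * cis \<theta>" by (simp only: w_def r_def exp_add exp_of_real cis_conv_exp)
  have Re_w: "Re w = r * c" and Im_w: "Im w = r * sin \<theta>" by (simp_all add: w_eq c_def)
  have sc: "(sin \<theta>)\<^sup>2 = 1 - c\<^sup>2" by (simp add: c_def sin_squared_eq)
  have nD: "(Re (1 - w))\<^sup>2 + (Im (1 - w))\<^sup>2 = D"
    by (simp add: Re_w Im_w D_def power_mult_distrib sc) (simp add: algebra_simps power2_eq_square)
  have "Re (w / (1 - w)) = (r * c * (1 - r * c) - r\<^sup>2 * (sin \<theta>)\<^sup>2) / D"
    unfolding Re_divide nD by (simp add: Re_w Im_w power2_eq_square)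
  also have "r * c * (1 - r * c) - r\<^sup>2 * (sin \<theta>)\<^sup>2 = r * c - r\<^sup>2"
    unfolding sc by (simp add: algebra_simps power2_eq_square)
  finally have Re_eq: "Re (w / (1 - w)) - r / (1 - r) = - (r * (1 + r) * (1 - c) / ((1 - r) * D))"
  proof -
    assume *: "Re (w / (1 - w)) = (r * c - r\<^sup>2) / D"
    have "(r * c - r\<^sup>2) * (1 - r) - r * D = - (r * (1 + r) * (1 - c))"
      by (simp add: D_def algebra_simps power2_eq_square)
    hence "((r * c - r\<^sup>2) * (1 - r) - r * D) / (D * (1 - r)) = - (r * (1 + r) * (1 - c)) / (D * (1 - r))" by simp
    moreover have "(r * c - r\<^sup>2) / D - r / (1 - r) = ((r * c - r\<^sup>2) * (1 - r) - r * D) / (D * (1 - r))"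
      using D r by (intro diff_frac_eq) auto
    ultimately show ?thesis unfolding * by (simp add: mult.commute)
  qed
  \<comment> \<open>The part of D that depends on the angle. As y / D increases with y, a lower
    bound on y is enough. The constant 27 is 18 * 3 / 2, from \<open>one_minus_cos_ge\<close> and r
    \<ge> 1/3.\<close>
  define y where "y = 2 * r * (1 - c)"
  have y: "y \<ge> \<theta>\<^sup>2 / 27"
  proof -
    have "exp (1::real) \<le> 3" by (rule exp_le)
    hence "1 / 3 \<le> exp (-1 :: real)" by (simp add: exp_minus field_simps)
    also have "\<dots> \<le> r" using t by (simp add: r_def)
    finally have "2 * (1/3) * (\<theta>\<^sup>2 / 18) \<le> 2 * r * (1 - c)"
      using one_minus_cos_ge[OF \<theta>] r by (intro mult_mono) (auto simp: c_def)
    thus ?thesis by (simp add: y_def)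
  qed
  have y0: "y \<ge> 0" using r c by (simp add: y_def)
  have rt: "1 - r \<le> t" using exp_ge_add_one_self[of "-t"] by (simp add: r_def)
  have mono: "x / (p + x) \<le> y / (p' + y)" if "0 \<le> x" "x \<le> y" "0 < p'" "p' \<le> p" for x p p' :: real
  proof -
    have "x * (p' + y) \<le> y * (p + x)" using that mult_mono[of x y p' p] by (simp add: algebra_simps)
    thus ?thesis using that by (simp add: frac_le_eq divide_simps)
  qed
  have "(\<theta>\<^sup>2 / 27) / (t\<^sup>2 + \<theta>\<^sup>2 / 27) \<le> y / ((1 - r)\<^sup>2 + y)"
    using y rt r by (intro mono) (auto intro: power_mono)
  moreover have "(\<theta>\<^sup>2 / 27) / (t\<^sup>2 + \<theta>\<^sup>2 / 27) = \<theta>\<^sup>2 / (27 * t\<^sup>2 + \<theta>\<^sup>2)" 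
  proof -
    have "t\<^sup>2 + \<theta>\<^sup>2 / 27 = (27 * t\<^sup>2 + \<theta>\<^sup>2) / 27" by simp
    thus ?thesis by simp
  qed
  ultimately have "\<theta>\<^sup>2 / (27 * t\<^sup>2 + \<theta>\<^sup>2) \<le> y / D" by (simp add: D_def y_def)
  hence "(1/2) * (1 / t) * (\<theta>\<^sup>2 / (27 * t\<^sup>2 + \<theta>\<^sup>2)) \<le> ((1 + r) / 2) * (1 / (1 - r)) * (y / D)"
    using rt r t D y0 by (intro mult_mono) (auto intro!: divide_left_mono)
  also have "\<dots> = r * (1 + r) * (1 - c) / ((1 - r) * D)"
  proof -
    have "((1 + r) / 2) * (1 / e) * (2 * r * d / D) = r * (1 + r) * d / (e * D)" for e d
      by (simp add: mult.commute)
    thus ?thesis by (simp only: y_def)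
  qed
  finally have "\<theta>\<^sup>2 / (2 * t * (27 * t\<^sup>2 + \<theta>\<^sup>2)) \<le> r * (1 + r) * (1 - c) / ((1 - r) * D)" by simp
  thus ?thesis using main Re_eq unfolding w_def r_def by linarith
qed

text \<open>For t * u^2 \<le> 27 the exponent is at least u^2 / 108. Beyond that it is only known to
  be at least 1 / (4 t), but the second hypothesis, which says \<theta>^2 \<le> 16 for \<theta> =
  t^(3/2) * u, limits |u| to the order of t^(-3/2), and exp z \<ge> z^3 / 6 turns 1 / (4 t) into
  decay of order 1 / u^2.\<close>

lemma exp_decay_dominated:
  fixes t u :: real
  assumes t: "0 < t" and u: "t ^ 3 * u\<^sup>2 \<le> 16"
  shows "exp (- (u\<^sup>2 / (2 * (27 + t * u\<^sup>2)))) \<le> 12288 * inverse (1 + u\<^sup>2)"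
proof (cases "u\<^sup>2 \<le> 1")
  case True
  have "exp (- (u\<^sup>2 / (2 * (27 + t * u\<^sup>2)))) \<le> 1" using t by simp
  also have "1 \<le> 12288 * inverse (1 + u\<^sup>2)"
    using True add_pos_nonneg[OF zero_less_one zero_le_power2[of u]] by (simp add: field_simps)
  finally show ?thesis .
next
  case False
  hence U: "u\<^sup>2 > 1" by simp
  define z where "z = u\<^sup>2 / (2 * (27 + t * u\<^sup>2))"
  have den: "27 + t * u\<^sup>2 > 0" using t by (intro add_pos_nonneg) auto
  have z: "z > 0" unfolding z_def using U den by (intro divide_pos_pos) auto
  have exp_z: "exp (-z) \<le> 6144 / u\<^sup>2"
  proof (cases "t * u\<^sup>2 \<le> 27")
    case True
    have "u\<^sup>2 / (2 * 54) \<le> z" unfolding z_def using True t den by (intro divide_left_mono) auto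
    moreover have "exp (-z) \<le> 1 / z"
    proof -
      have "z \<le> exp z" using exp_ge_add_one_self[of z] by linarith
      thus ?thesis using z by (simp add: exp_minus field_simps)
    qed
    moreover have "1 / z \<le> 1 / (u\<^sup>2 / 108)" using \<open>u\<^sup>2 / (2 * 54) \<le> z\<close> U z
      by (intro divide_left_mono mult_pos_pos) auto
    moreover have "1 / (u\<^sup>2 / 108) \<le> 6144 / u\<^sup>2" using U by (simp add: divide_right_mono)
    ultimately show ?thesis by linarith
  next
    case False
    have "1 / (4 * t) = u\<^sup>2 / (4 * (t * u\<^sup>2))" using U t by (cases "u = 0") auto
    also have "\<dots> \<le> z" unfolding z_def using False t U den by (intro divide_left_mono mult_pos_pos) auto
    finally have "(1 / (4 * t)) ^ 3 \<le> z ^ 3" using t by (intro power_mono) auto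
    \<comment> \<open>1024 is 4^3 * 16. The factor 6 from exp z \<ge> z^3 / 6 makes it 6144, and
      passing from 1 / u^2 to 1 / (1 + u^2) for u^2 > 1 doubles that to 12288.\<close>
    moreover have "u\<^sup>2 / 1024 \<le> (1 / (4 * t)) ^ 3"
      using u t by (simp add: power_divide power_mult_distrib field_simps)
    ultimately have z3: "u\<^sup>2 / 1024 \<le> z ^ 3" by linarith
    have "z ^ 3 / 6 \<le> exp z"
    proof -
      have "z ^ 3 / fact 3 \<le> (\<Sum>n. z ^ n / fact n)"
        using sum_le_suminf[OF summable_exp[of z], of "{3}"] z by (simp add: divide_inverse mult.commute)
      also have "\<dots> = exp z" by (simp add: exp_def scaleR_conv_of_real divide_inverse mult.commute)
      finally show ?thesis by (simp add: fact_numeral)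
    qed
    hence "u\<^sup>2 / 6144 \<le> exp z" using z3 by linarith
    hence "1 / exp z \<le> 1 / (u\<^sup>2 / 6144)" using U by (intro frac_le) auto
    thus ?thesis by (simp add: exp_minus inverse_eq_divide)
  qed
  have "6144 / v \<le> 12288 * inverse (1 + v)" if "v > 1" for v :: real
    using that by (simp add: field_simps)
  from this[OF U] have "6144 / u\<^sup>2 \<le> 12288 * inverse (1 + u\<^sup>2)" .
  with exp_z show ?thesis unfolding z_def by linarith
qed

section \<open>The circle method\<close>

lemma integral_exp_imag_period:
  fixes d :: int
  shows "(\<integral>\<theta>. indicator {-pi..pi} \<theta> *\<^sub>R exp (\<i> * of_real (of_int d * \<theta>)) \<partial>lborel) =
    (if d = 0 then of_real (2 * pi) else 0)"
proof (cases "d = 0")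
  case True
  thus ?thesis by (simp add: scaleR_conv_of_real)
next
  case False
  define k where "k = \<i> * complex_of_int d"
  have k: "k \<noteq> 0" using False by (simp add: k_def)
  have k_eq: "exp (\<i> * of_real (of_int d * \<theta>)) = exp (k * of_real \<theta>)" for \<theta> by (simp add: k_def mult.assoc)
  define G where "G = (\<lambda>\<theta>::real. exp (k * of_real \<theta>) / k)"
  have "(\<integral>\<theta>. indicator {-pi..pi} \<theta> *\<^sub>R exp (k * of_real \<theta>) \<partial>lborel) = G pi - G (-pi)"
  proof (rule integral_FTC_Icc)
    fix x :: real
    have "((\<lambda>z. exp (k * z) / k) has_field_derivative exp (k * of_real x)) (at (of_real x))"
      using k by (auto intro!: derivative_eq_intros)
    hence "(G has_vector_derivative exp (k * of_real x)) (at x)"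
      unfolding G_def by (rule has_vector_derivative_real_field)
    thus "(G has_vector_derivative exp (k * of_real x)) (at x within {-pi..pi})"
      by (rule has_vector_derivative_at_within)
  qed (auto intro!: continuous_intros)
  also have "G pi = G (-pi)"
  proof -
    have "exp (k * of_real x) = cis (of_int d * x)" for x
      by (simp add: k_def cis_conv_exp mult.assoc)
    moreover have "cis (of_int d * pi) = cis (of_int d * (-pi))"
      using sin_npi_int[of d] by (simp add: complex_eq_iff mult.commute)
    ultimately show ?thesis by (simp only: G_def)
  qed
  finally show ?thesis unfolding k_eq using False by simp
qed

text \<open>Cauchy's coefficient formula on the circle of radius exp (-t), as an integral over the
  angle: the series is integrated term by term and the exponentials are orthogonal.\<close>

lemma fourier_coefficient:
  fixes p :: "nat \<Rightarrow> real" and F :: "complex \<Rightarrow> complex"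
  assumes F: "\<And>w. norm w < 1 \<Longrightarrow> (\<lambda>n. of_real (p n) * w ^ n) sums F w" and t: "t > 0"
  shows "(\<integral>\<theta>. indicator {-pi..pi} \<theta> *\<^sub>R (F (exp (of_real (-t) + \<i> * of_real \<theta>)) * exp (- (\<i> * of_real (real n * \<theta>)))) \<partial>lborel)
    = of_real (2 * pi * p n * exp (-t) ^ n)"
proof -
  define r where "r = exp (-t)"
  have r: "0 < r" "r < 1" using t by (auto simp: r_def)
  define f where "f = (\<lambda>m \<theta>. indicator {-pi..pi} \<theta> *\<^sub>R (of_real (p m * r ^ m) * exp (\<i> * of_real (of_int (int m - int n) * \<theta>))))"
  have term_eq: "of_real (p m) * exp (of_real (-t) + \<i> * of_real \<theta>) ^ m * exp (- (\<i> * of_real (real n * \<theta>)))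
      = of_real (p m * r ^ m) * exp (\<i> * of_real (of_int (int m - int n) * \<theta>))" for m \<theta>
    unfolding r_def exp_add exp_of_real
    by (simp add: power_mult_distrib exp_of_nat_mult[symmetric] algebra_simps exp_diff exp_minus divide_inverse)
  have sums: "(\<lambda>m. f m \<theta>) sums (indicator {-pi..pi} \<theta> *\<^sub>R (F (exp (of_real (-t) + \<i> * of_real \<theta>)) * exp (- (\<i> * of_real (real n * \<theta>)))))" for \<theta>
    unfolding f_def term_eq[symmetric] using t by (intro sums_scaleR_right sums_mult2 F) simp
  have abs_summable: "summable (\<lambda>m. \<bar>p m\<bar> * r ^ m)"
  proof -
    \<comment> \<open>Convergence at the larger radius \<open>R\<close>, still below 1, gives
      absolute convergence on the circle.\<close>
    define R where "R = (1 + r) / 2"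
    have R: "r < R" "R < 1" using r by (auto simp: R_def)
    have "summable (\<lambda>m. complex_of_real (p m) * of_real R ^ m)"
      using F[of "of_real R"] R r by (auto simp: sums_iff)
    hence "summable (\<lambda>m. norm (complex_of_real (p m) * of_real r ^ m))"
      by (rule powser_insidea) (use R r in auto)
    thus ?thesis using r by (simp add: norm_mult norm_power)
  qed
  have norm_f: "norm (f m \<theta>) = indicator {-pi..pi} \<theta> *\<^sub>R (\<bar>p m\<bar> * r ^ m)" for m \<theta>
    using r by (simp add: f_def norm_mult norm_power abs_mult power_abs)
  have int_f: "(\<integral>\<theta>. f m \<theta> \<partial>lborel) = (if m = n then of_real (2 * pi * p n * r ^ n) else 0)" for m
  proof -
    have "(\<integral>\<theta>. f m \<theta> \<partial>lborel) = (\<integral>\<theta>. of_real (p m * r ^ m) *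
        (indicator {-pi..pi} \<theta> *\<^sub>R exp (\<i> * of_real (of_int (int m - int n) * \<theta>))) \<partial>lborel)"
      unfolding f_def by (intro Bochner_Integration.integral_cong) (auto simp: indicator_def)
    also have "\<dots> = of_real (p m * r ^ m) * (if int m - int n = 0 then of_real (2 * pi) else 0)"
      unfolding integral_exp_imag_period[symmetric] by (rule integral_mult_right_zero)
    finally show ?thesis by auto
  qed
  have "(\<lambda>m. \<integral>\<theta>. f m \<theta> \<partial>lborel) sums (\<integral>\<theta>. (\<Sum>m. f m \<theta>) \<partial>lborel)"
  proof (rule sums_integral)
    fix m
    show "integrable lborel (f m)"
      unfolding f_def by (intro borel_integrable_compact continuous_intros) auto
  next
    show "AE \<theta> in lborel. summable (\<lambda>m. norm (f m \<theta>))"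
      unfolding norm_f using abs_summable by (intro AE_I2 summable_scaleR_right)
    have "(\<integral>\<theta>. norm (f m \<theta>) \<partial>lborel) = 2 * pi * (\<bar>p m\<bar> * r ^ m)" for m
      unfolding norm_f by simp
    thus "summable (\<lambda>m. \<integral>\<theta>. norm (f m \<theta>) \<partial>lborel)"
      using abs_summable by (simp add: summable_mult)
  qed
  moreover have "(\<lambda>m. \<integral>\<theta>. f m \<theta> \<partial>lborel) sums of_real (2 * pi * p n * r ^ n)"
    unfolding int_f using sums_single[of n "\<lambda>m. of_real (2 * pi * p n * r ^ n)"] by simp
  ultimately have "(\<integral>\<theta>. (\<Sum>m. f m \<theta>) \<partial>lborel) = of_real (2 * pi * p n * r ^ n)"
    by (rule sums_unique2)
  moreover have "(\<Sum>m. f m \<theta>) = indicator {-pi..pi} \<theta> *\<^sub>R (F (exp (of_real (-t) + \<i> * of_real \<theta>)) * exp (- (\<i> * of_real (real n * \<theta>))))" for \<theta>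
    using sums[of \<theta>] by (simp add: sums_iff)
  ultimately show ?thesis by (simp only: r_def)
qed

text \<open>Read off from the total mass of the normal density with variance 1 / (2 c).\<close>

lemma integral_exp_minus_square:
  assumes "c > 0"
  shows "(\<integral>u. exp (- (c * u\<^sup>2)) \<partial>lborel) = sqrt (pi / c)"
proof -
  define \<sigma> where "\<sigma> = sqrt (1 / (2 * c))"
  have \<sigma>: "\<sigma> > 0" "\<sigma>\<^sup>2 = 1 / (2 * c)" using assms by (auto simp: \<sigma>_def)
  have "normal_density 0 \<sigma> u = 1 / sqrt (pi / c) * exp (- (c * u\<^sup>2))" for u
    using assms by (simp add: normal_density_def \<sigma>(2) mult.commute)
  hence "(\<integral>u. 1 / sqrt (pi / c) * exp (- (c * u\<^sup>2)) \<partial>lborel) = 1"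
    using integral_normal_density[OF \<sigma>(1), of 0] by (simp only:)
  hence "1 / sqrt (pi / c) * (\<integral>u. exp (- (c * u\<^sup>2)) \<partial>lborel) = 1"
    by (simp only: integral_mult_right_zero)
  moreover have "1 / s * I = 1 \<Longrightarrow> I = s" for s I :: real by (cases "s = 0") (auto simp: field_simps)
  ultimately show ?thesis by blast
qed

text \<open>Replacing \<open>dsum1 t\<close> by pi^2 / (6 t^2) costs \<theta> * t^(-5/4), of order
  t^(1/4); the cubic remainder \<theta>^3 / t^4 has order t^(1/2). In the quadratic term \<theta>^2
  = t^3 * u^2, which is exactly the normalisation of \<open>dsum2_tendsto\<close>.\<close>

lemma saddle_exponent_tendsto:
  fixes u :: real and M :: nat
  defines "\<theta> \<equiv> \<lambda>t. t powr (3/2) * u"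
  shows "((\<lambda>t. of_nat M * (lambert (exp (of_real (-t) + \<i> * of_real (\<theta> t))) - of_real (lambert (exp (-t))))
      - \<i> * of_real (real M * (pi\<^sup>2 / 6) / t\<^sup>2 * \<theta> t)) \<longlongrightarrow> of_real (- (real M * (pi\<^sup>2 / 6) * u\<^sup>2))) (at_right 0)"
proof -
  define C where "C = (\<Sum>k. real (Suc k) powr (-5/4))"
  define E where "E = (\<lambda>t. of_nat M * (lambert (exp (of_real (-t) + \<i> * of_real (\<theta> t))) - of_real (lambert (exp (-t))))
      - \<i> * of_real (real M * (pi\<^sup>2 / 6) / t\<^sup>2 * \<theta> t))"
  have "((\<lambda>t. E t + of_real (real M * ((\<theta> t)\<^sup>2 / 2 * dsum2 t))) \<longlongrightarrow> 0) (at_right 0)"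
  proof (rule Lim_null_comparison)
    show "((\<lambda>t. real M * (\<bar>u\<bar> ^ 3 / 2 * 256 * pi\<^sup>2 * t powr (1/2) + \<bar>u\<bar> * C * t powr (1/4))) \<longlongrightarrow> 0) (at_right 0)"
      by real_asymp
    show "eventually (\<lambda>t. norm (E t + of_real (real M * ((\<theta> t)\<^sup>2 / 2 * dsum2 t))) \<le>
       real M * (\<bar>u\<bar> ^ 3 / 2 * 256 * pi\<^sup>2 * t powr (1/2) + \<bar>u\<bar> * C * t powr (1/4))) (at_right 0)"
      using eventually_at_right_less[of 0]
    proof eventually_elim
      case (elim t)
      define Z where "Z = lambert (exp (of_real (-t) + \<i> * of_real (\<theta> t))) - of_real (lambert (exp (-t)))
        - \<i> * of_real (\<theta> t * dsum1 t) + of_real ((\<theta> t)\<^sup>2 / 2 * dsum2 t)"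
      define D where "D = pi\<^sup>2 / 6 / t\<^sup>2 - dsum1 t"
      have "E t + of_real (real M * ((\<theta> t)\<^sup>2 / 2 * dsum2 t)) = of_nat M * (Z - \<i> * of_real (\<theta> t * D))"
        by (simp add: E_def Z_def D_def algebra_simps)
      also have "norm \<dots> = real M * norm (Z - \<i> * of_real (\<theta> t * D))"
        by (simp only: norm_mult norm_of_nat)
      also have "\<dots> \<le> real M * (norm Z + norm (\<i> * of_real (\<theta> t * D)))"
        by (intro mult_left_mono norm_triangle_ineq4) auto
      also have "norm (\<i> * of_real (\<theta> t * D)) = \<bar>\<theta> t\<bar> * \<bar>D\<bar>"
        by (simp only: norm_mult norm_ii norm_of_real abs_mult mult_1)
      also have "\<bar>D\<bar> \<le> C * t powr (-5/4)"
        using dsum1_bounds[OF elim] unfolding D_def C_def by (simp only: abs_of_nonneg)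
      also have "norm Z \<le> \<bar>\<theta> t\<bar> ^ 3 / 2 * dsum3 t"
        unfolding Z_def by (rule lambert_Taylor[OF elim])
      also have "dsum3 t \<le> 256 * pi\<^sup>2 / t ^ 4" by (rule dsum3_le[OF elim])
      finally have "norm (E t + of_real (real M * ((\<theta> t)\<^sup>2 / 2 * dsum2 t))) \<le>
        real M * (\<bar>\<theta> t\<bar> ^ 3 / 2 * (256 * pi\<^sup>2 / t ^ 4) + \<bar>\<theta> t\<bar> * (C * t powr (-5/4)))"
        by (simp add: mult_left_mono)
      also have "\<bar>\<theta> t\<bar> ^ 3 / 2 * (256 * pi\<^sup>2 / t ^ 4) = \<bar>u\<bar> ^ 3 / 2 * 256 * pi\<^sup>2 * ((t powr (3/2)) ^ 3 / t ^ 4)"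
        by (simp add: \<theta>_def abs_mult power_mult_distrib)
      also have "(t powr (3/2)) ^ 3 / t ^ 4 = t powr (1/2)"
      proof -
        have "(t powr (3/2)) ^ 3 = t powr (9/2)" by (simp add: power3_eq_cube powr_add[symmetric])
        moreover have "t ^ 4 = t powr 4" using elim by simp
        ultimately show ?thesis by (simp only: powr_diff[symmetric]) simp
      qed
      also have "\<bar>\<theta> t\<bar> * (C * t powr (-5/4)) = \<bar>u\<bar> * C * (t powr (3/2) * t powr (-5/4))"
        by (simp add: \<theta>_def abs_mult)
      also have "t powr (3/2) * t powr (-5/4) = t powr (1/4)" unfolding powr_add[symmetric] by simp
      finally show ?case .
    qed
  qed
  moreover have "((\<lambda>t. complex_of_real (real M * ((\<theta> t)\<^sup>2 / 2 * dsum2 t))) \<longlongrightarrow> of_real (real M * (u\<^sup>2 / 2 * (pi\<^sup>2 / 3)))) (at_right 0)"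
  proof (rule tendsto_of_real)
    have *: "((\<lambda>t. real M * (u\<^sup>2 / 2 * (t ^ 3 * dsum2 t))) \<longlongrightarrow> real M * (u\<^sup>2 / 2 * (pi\<^sup>2 / 3))) (at_right 0)"
      by (intro tendsto_intros dsum2_tendsto)
    show "((\<lambda>t. real M * ((\<theta> t)\<^sup>2 / 2 * dsum2 t)) \<longlongrightarrow> real M * (u\<^sup>2 / 2 * (pi\<^sup>2 / 3))) (at_right 0)"
    proof (rule Lim_transform_eventually[OF *])
      show "eventually (\<lambda>t. real M * (u\<^sup>2 / 2 * (t ^ 3 * dsum2 t)) = real M * ((\<theta> t)\<^sup>2 / 2 * dsum2 t)) (at_right 0)"
        using eventually_at_right_less[of 0]
      proof eventually_elim
        case (elim t)
        have "(t powr (3/2))\<^sup>2 = t ^ 3"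
          using elim powr_add[of t "3/2" "3/2"] by (simp add: power2_eq_square)
        thus ?case by (simp add: \<theta>_def power_mult_distrib)
      qed
    qed
  qed
  ultimately have "((\<lambda>t. E t + of_real (real M * ((\<theta> t)\<^sup>2 / 2 * dsum2 t)) - of_real (real M * ((\<theta> t)\<^sup>2 / 2 * dsum2 t)))
     \<longlongrightarrow> 0 - of_real (real M * (u\<^sup>2 / 2 * (pi\<^sup>2 / 3)))) (at_right 0)"
    by (rule tendsto_diff)
  moreover have "0 - complex_of_real (real M * (u\<^sup>2 / 2 * (pi\<^sup>2 / 3))) = of_real (- (real M * (pi\<^sup>2 / 6) * u\<^sup>2))" by simp
  ultimately show ?thesis by (simp only: E_def add_diff_cancel_right')
qed

section \<open>The rescaled integrand at the saddle point\<close>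

definition saddle :: "nat \<Rightarrow> nat \<Rightarrow> real" where
  "saddle M n = pi * sqrt (real M / (6 * real n))"

text \<open>The integrand of the coefficient formula divided by its value at angle 0, in the
  variable u. The indicator extends the moving range of u to the whole line, so that dominated
  convergence applies on a fixed space.\<close>

definition saddle_integrand :: "nat \<Rightarrow> nat \<Rightarrow> real \<Rightarrow> complex" where
  "saddle_integrand M n u = (let t = saddle M n; \<theta> = t powr (3/2) * u in
     indicator {-pi..pi} \<theta> *\<^sub>R (exp (of_nat M * (lambert (exp (of_real (-t) + \<i> * of_real \<theta>)) - of_real (lambert (exp (-t)))))
        * exp (- (\<i> * of_real (real n * \<theta>)))))"

lemma saddle_pos: "M > 0 \<Longrightarrow> n > 0 \<Longrightarrow> saddle M n > 0"
  by (simp add: saddle_def)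

text \<open>The saddle point equation M * dsum1 t = n with \<open>dsum1\<close> replaced by its main
  term. Because it is exact, the linear term subtracted in \<open>saddle_exponent_tendsto\<close> is
  precisely the factor exp (- i n \<theta>) of the integrand.\<close>

lemma saddle_square:
  assumes "M > 0" "n > 0"
  shows "real M * (pi\<^sup>2 / 6) / (saddle M n)\<^sup>2 = real n"
  using assms by (simp add: saddle_def power_mult_distrib)

lemma saddle_at_right_0:
  assumes "M > 0"
  shows "filterlim (saddle M) (at_right 0) sequentially"
proof -
  have "(\<lambda>n. real M / (6 * real n)) \<longlonglongrightarrow> 0" by real_asymp
  hence "(\<lambda>n. pi * sqrt (real M / (6 * real n))) \<longlonglongrightarrow> pi * sqrt 0" by (intro tendsto_intros)
  hence "saddle M \<longlonglongrightarrow> 0" by (simp add: saddle_def[abs_def])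
  moreover have "eventually (\<lambda>n. saddle M n > 0) sequentially"
    using eventually_gt_at_top[of 0] by eventually_elim (rule saddle_pos[OF assms])
  ultimately show ?thesis by (rule tendsto_imp_filterlim_at_right)
qed

lemma saddle_integrand_tendsto:
  assumes "M > 0"
  shows "(\<lambda>n. saddle_integrand M n u) \<longlonglongrightarrow> of_real (exp (- (real M * (pi\<^sup>2 / 6) * u\<^sup>2)))"
proof -
  define E where "E = (\<lambda>t. of_nat M * (lambert (exp (of_real (-t) + \<i> * of_real (t powr (3/2) * u))) - of_real (lambert (exp (-t))))
      - \<i> * of_real (real M * (pi\<^sup>2 / 6) / t\<^sup>2 * (t powr (3/2) * u)))"
  have "(\<lambda>n. exp (E (saddle M n))) \<longlonglongrightarrow> exp (of_real (- (real M * (pi\<^sup>2 / 6) * u\<^sup>2)))"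
    using filterlim_compose[OF saddle_exponent_tendsto[of M u] saddle_at_right_0[OF assms]]
    unfolding E_def by (rule tendsto_exp)
  hence lim: "(\<lambda>n. exp (E (saddle M n))) \<longlonglongrightarrow> of_real (exp (- (real M * (pi\<^sup>2 / 6) * u\<^sup>2)))"
    by (simp only: exp_of_real)
  have "((\<lambda>t. t powr (3/2) * u) \<longlongrightarrow> 0) (at_right 0)" by real_asymp
  hence "(\<lambda>n. (saddle M n) powr (3/2) * u) \<longlonglongrightarrow> 0"
    by (rule filterlim_compose[OF _ saddle_at_right_0[OF assms]])
  hence "eventually (\<lambda>n. (saddle M n) powr (3/2) * u \<in> {-pi<..<pi}) sequentially"
    by (rule topological_tendstoD) auto
  hence "eventually (\<lambda>n. exp (E (saddle M n)) = saddle_integrand M n u) sequentially"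
    using eventually_gt_at_top[of 0]
  proof eventually_elim
    case (elim n)
    have "of_nat M * (lambert (exp (of_real (- saddle M n) + \<i> * of_real (saddle M n powr (3/2) * u))) - of_real (lambert (exp (- saddle M n))))
      + - (\<i> * of_real (real n * (saddle M n powr (3/2) * u))) = E (saddle M n)"
      unfolding E_def saddle_square[OF assms elim(2)] by simp
    moreover have "indicator {-pi..pi} (saddle M n powr (3/2) * u) = (1::real)"
      using elim(1) by (simp add: indicator_def)
    ultimately show ?case unfolding saddle_integrand_def Let_def exp_add[symmetric] by (simp only: scaleR_one)
  qed
  from Lim_transform_eventually[OF lim this] show ?thesis .
qed

text \<open>The majorant does not depend on M: the real part of the exponent is at most 0, so a
  factor M \<ge> 1 only lowers it. Angles beyond pi are cut off by the indicator.\<close>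

lemma norm_saddle_integrand_le:
  assumes "M > 0" "n > 0" "saddle M n \<le> 1"
  shows "norm (saddle_integrand M n u) \<le> 12288 * inverse (1 + u\<^sup>2)"
proof (cases "\<bar>saddle M n powr (3/2) * u\<bar> \<le> pi")
  case True
  define t where "t = saddle M n"
  define \<theta> where "\<theta> = t powr (3/2) * u"
  have t: "0 < t" "t \<le> 1" using assms saddle_pos by (auto simp: t_def)
  have \<theta>: "\<bar>\<theta>\<bar> \<le> pi" using True by (simp add: \<theta>_def t_def)
  have \<theta>2: "\<theta>\<^sup>2 = t ^ 3 * u\<^sup>2"
    using t powr_add[of t "3/2" "3/2"] by (simp add: \<theta>_def power_mult_distrib power2_eq_square)
  have "\<theta>\<^sup>2 \<le> 4\<^sup>2" using \<theta> pi_less_4 by (intro abs_le_square_iff[THEN iffD1]) auto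
  hence u: "t ^ 3 * u\<^sup>2 \<le> 16" by (simp add: \<theta>2)
  define d where "d = Re (lambert (exp (of_real (-t) + \<i> * of_real \<theta>))) - lambert (exp (-t))"
  have "norm (saddle_integrand M n u) \<le> exp (real M * d)"
    unfolding saddle_integrand_def Let_def t_def[symmetric] \<theta>_def[symmetric]
    by (simp add: norm_mult d_def indicator_def)
  also have d: "d \<le> - (u\<^sup>2 / (2 * (27 + t * u\<^sup>2)))"
  proof -
    have "\<theta>\<^sup>2 / (2 * t * (27 * t\<^sup>2 + \<theta>\<^sup>2)) = t ^ 3 * u\<^sup>2 / (t ^ 3 * (2 * (27 + t * u\<^sup>2)))"
      unfolding \<theta>2 by (simp add: algebra_simps power2_eq_square power3_eq_cube)
    also have "\<dots> = u\<^sup>2 / (2 * (27 + t * u\<^sup>2))" using t by simp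
    finally show ?thesis using lambert_decay[OF t \<theta>] by (simp add: d_def)
  qed
  have "d \<le> 0" using d t by (smt (verit) divide_nonneg_nonneg mult_nonneg_nonneg zero_le_power2)
  hence "real M * d \<le> 1 * d" using assms(1) by (intro mult_right_mono_neg) auto
  hence "exp (real M * d) \<le> exp (- (u\<^sup>2 / (2 * (27 + t * u\<^sup>2))))" using d by simp
  also have "\<dots> \<le> 12288 * inverse (1 + u\<^sup>2)" by (rule exp_decay_dominated[OF t(1) u])
  finally show ?thesis .
next
  case False
  hence "saddle_integrand M n u = 0"
    unfolding saddle_integrand_def Let_def by (auto simp: indicator_def abs_le_iff)
  thus ?thesis by simp
qed

lemma borel_measurable_lambert [measurable]: "(lambert :: complex \<Rightarrow> complex) \<in> borel_measurable borel"
  unfolding lambert_def by measurable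

lemma borel_measurable_saddle_integrand [measurable]: "saddle_integrand M n \<in> borel_measurable borel"
  unfolding saddle_integrand_def Let_def by measurable

lemma integral_saddle_integrand_tendsto:
  assumes M: "M > 0"
  shows "(\<lambda>n. \<integral>u. saddle_integrand M n u \<partial>lborel) \<longlonglongrightarrow> of_real (sqrt (6 / (pi * real M)))"
proof -
  have "eventually (\<lambda>n. saddle M n < 1) sequentially"
    using saddle_at_right_0[OF M] by (intro order_tendstoD(2)[of _ 0]) (auto simp: filterlim_at)
  then obtain N where N: "\<And>n. n \<ge> N \<Longrightarrow> saddle M n < 1" by (auto simp: eventually_sequentially)
  have "(\<lambda>n. \<integral>u. saddle_integrand M (n + Suc N) u \<partial>lborel) \<longlonglongrightarrow>
      (\<integral>u. complex_of_real (exp (- (real M * (pi\<^sup>2 / 6) * u\<^sup>2))) \<partial>lborel)"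
  proof (rule integral_dominated_convergence)
    have "integrable lborel (\<lambda>u::real. inverse (1 + u\<^sup>2))"
      using integrable_inverse_1_plus_square by (simp add: set_integrable_def)
    thus "integrable lborel (\<lambda>u::real. 12288 * inverse (1 + u\<^sup>2))" by simp
    show "AE u in lborel. (\<lambda>n. saddle_integrand M (n + Suc N) u) \<longlonglongrightarrow> complex_of_real (exp (- (real M * (pi\<^sup>2 / 6) * u\<^sup>2)))"
      by (intro AE_I2 LIMSEQ_ignore_initial_segment saddle_integrand_tendsto M)
    show "AE u in lborel. norm (saddle_integrand M (n + Suc N) u) \<le> 12288 * inverse (1 + u\<^sup>2)" for n
      using N[of "n + Suc N"] by (intro AE_I2 norm_saddle_integrand_le M) auto
  qed measurable
  also have "(\<integral>u. complex_of_real (exp (- (real M * (pi\<^sup>2 / 6) * u\<^sup>2))) \<partial>lborel) =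
      of_real (sqrt (pi / (real M * (pi\<^sup>2 / 6))))"
    using integral_exp_minus_square[of "real M * (pi\<^sup>2 / 6)"] M by (simp only: integral_complex_of_real) simp
  also have "pi / (real M * (pi\<^sup>2 / 6)) = 6 / (pi * real M)" by (simp add: power2_eq_square)
  finally show ?thesis by (rule LIMSEQ_offset)
qed

text \<open>The substitution \<theta> = t^(3/2) * u in the coefficient formula. This is exact for
  every n > 0, so all asymptotics is confined to the integral and to the value of
  \<open>lambert\<close> in the divisor.\<close>

lemma power_series_exp_lambert_coeff_saddle:
  fixes p :: "nat \<Rightarrow> real"
  assumes M: "M > 0"
    and F: "\<And>w :: complex. norm w < 1 \<Longrightarrow> (\<lambda>n. of_real (p n) * w ^ n) sums exp (of_nat M * lambert w)"
    and n: "n > 0"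
  defines "t \<equiv> saddle M n"
  shows "of_real (p n / (t powr (3/2) * exp (real n * t + real M * lambert (exp (-t))) / (2 * pi)))
    = (\<integral>u. saddle_integrand M n u \<partial>lborel)"
proof -
  have t: "t > 0" using saddle_pos[OF M n] by (simp add: t_def)
  define s where "s = t powr (3/2)"
  have s: "s > 0" using t by (simp add: s_def)
  define Lr where "Lr = lambert (exp (-t))"
  define f where "f = (\<lambda>\<theta>. indicator {-pi..pi} \<theta> *\<^sub>R
     (exp (of_nat M * lambert (exp (of_real (-t) + \<i> * complex_of_real \<theta>))) * exp (- (\<i> * of_real (real n * \<theta>)))))"
  have "of_real (2 * pi * p n * exp (-t) ^ n) = (\<integral>\<theta>. f \<theta> \<partial>lborel)"
    unfolding f_def by (rule fourier_coefficient[OF F t, symmetric])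
  also have "\<dots> = \<bar>s\<bar> *\<^sub>R (\<integral>u. f (0 + s * u) \<partial>lborel)"
    using s by (intro lborel_integral_real_affine) auto
  also have "(\<lambda>u. f (0 + s * u)) = (\<lambda>u. of_real (exp (real M * Lr)) * saddle_integrand M n u)"
  proof
    fix u
    have "exp (of_nat M * lambert w) = of_real (exp (real M * Lr)) * exp (of_nat M * (lambert w - of_real Lr))" for w :: complex
      unfolding exp_of_real[symmetric] exp_add[symmetric] by (simp add: algebra_simps)
    thus "f (0 + s * u) = of_real (exp (real M * Lr)) * saddle_integrand M n u"
      unfolding f_def saddle_integrand_def Let_def t_def[symmetric] s_def[symmetric] Lr_def[symmetric]
      by (simp add: mult.assoc)
  qed
  finally have eq: "of_real (2 * pi * p n * exp (-t) ^ n) =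
      of_real (s * exp (real M * Lr)) * (\<integral>u. saddle_integrand M n u \<partial>lborel)"
    using s by (simp add: scaleR_conv_of_real)
  have "p n / (s * exp (real n * t + real M * Lr) / (2 * pi)) = (2 * pi * p n * exp (-t) ^ n) / (s * exp (real M * Lr))"
  proof -
    have "exp (-t) ^ n = exp (- (real n * t))" by (simp flip: exp_of_nat_mult)
    thus ?thesis using s by (simp add: exp_add exp_minus field_simps)
  qed
  thus ?thesis unfolding s_def[symmetric] Lr_def[symmetric]
    using eq s by (simp only: of_real_divide) (simp add: field_simps)
qed

text \<open>At the saddle point n t and M pi^2 / (6 t) are equal and add up to pi * sqrt (2 n M /
  3). The identity between the remaining powers is checked on logarithms, as linear forms in ln M,
  ln 2, ln 3, ln n and ln pi, where ln pi cancels.\<close>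

lemma saddle_main_term:
  assumes M: "M > 0" and n: "n > 0"
  defines "t \<equiv> saddle M n"
  shows "t powr (3/2) * exp (real n * t + real M * (pi\<^sup>2 / 6 / t + ln (t / (2 * pi)) / 2)) / (2 * pi) * sqrt (6 / (pi * real M)) =
     (real M powr ((1 + real M) / 4) /
            (2 powr ((5 + 3 * real M) / 4) * 3 powr ((1 + real M) / 4)
              * real n powr ((3 + real M) / 4)))
         * exp (pi * sqrt (2 * real n * real M / 3))" (is "?L = ?R")
proof -
  have t: "t > 0" using saddle_pos[OF M n] by (simp add: t_def)
  have L: "?L > 0" "?R > 0" using t M n by auto
  define a b c d l where "a = ln (real M)" and "b = ln (2::real)" and "c = ln (3::real)" and "d = ln (real n)" and "l = ln pi"
  have ln6: "ln (6::real) = b + c" using ln_mult_pos[of 2 "3::real"] by (simp add: b_def c_def)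
  have lt: "ln t = l + (a - (b + c) - d) / 2"
    using M n by (simp add: t_def saddle_def ln_mult_pos ln_sqrt ln_div ln6 a_def d_def l_def)
  have lt2: "ln (t / (2 * pi)) = ln t - b - l" using t by (simp add: ln_div ln_mult_pos b_def l_def)
  have "real n * t = real M * (pi\<^sup>2 / 6) / t"
    using t unfolding saddle_square[OF M n, symmetric] t_def[symmetric] by (simp add: power2_eq_square)
  moreover have "pi * sqrt (2 * real n * real M / 3) = 2 * (real n * t)"
  proof -
    have "2 * real n * real M / 3 = (2 * real n)\<^sup>2 * (real M / (6 * real n))"
      using n by (simp add: power2_eq_square)
    hence "sqrt (2 * real n * real M / 3) = 2 * real n * sqrt (real M / (6 * real n))"
      by (simp only: real_sqrt_mult real_sqrt_abs)
    thus ?thesis by (simp add: t_def saddle_def)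
  qed
  ultimately have E: "real n * t + real M * (pi\<^sup>2 / 6 / t) = pi * sqrt (2 * real n * real M / 3)" by simp
  have "ln ?L = 3/2 * ln t + (real n * t + real M * (pi\<^sup>2 / 6 / t)) + real M * (ln t - b - l) / 2 - (b + l) + (b + c - (l + a)) / 2"
    using t M by (simp add: ln_mult_pos ln_div ln_sqrt ln_powr ln6 lt2 a_def[symmetric] b_def[symmetric] c_def[symmetric] l_def[symmetric] algebra_simps)
  also have "\<dots> = (1 + real M) / 4 * a - ((5 + 3 * real M) / 4 * b + (1 + real M) / 4 * c + (3 + real M) / 4 * d) + pi * sqrt (2 * real n * real M / 3)"
    unfolding E lt by (simp add: field_simps)
  also have "\<dots> = ln ?R"
    using M n by (simp add: ln_mult_pos ln_div ln_powr a_def b_def c_def d_def)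
  finally show ?thesis using L by (simp only: ln_inj_iff)
qed

theorem power_series_exp_lambert_coeff_asymp:
  fixes p :: "nat \<Rightarrow> real"
  assumes M: "M > 0"
    and F: "\<And>w :: complex. norm w < 1 \<Longrightarrow> (\<lambda>n. of_real (p n) * w ^ n) sums exp (of_nat M * lambert w)"
  shows "p \<sim>[at_top]
    (\<lambda>n. (real M powr ((1 + real M) / 4) /
            (2 powr ((5 + 3 * real M) / 4) * 3 powr ((1 + real M) / 4)
              * real n powr ((3 + real M) / 4)))
         * exp (pi * sqrt (2 * real n * real M / 3)))" (is "_ \<sim>[at_top] ?g")
proof (rule asymp_equivI')
  define K where "K = (\<lambda>n. let t = saddle M n in t powr (3/2) * exp (real n * t + real M * lambert (exp (-t))) / (2 * pi))"
  define \<epsilon> where "\<epsilon> = (\<lambda>t. lambert (exp (-t)) - pi\<^sup>2 / 6 / t - ln (t / (2 * pi)) / 2 :: real)"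
  define c where "c = sqrt (6 / (pi * real M))"
  have c: "c > 0" using M by (simp add: c_def)
  have "(\<lambda>n. complex_of_real (p n / K n)) \<longlonglongrightarrow> of_real c"
  proof (rule Lim_transform_eventually[OF integral_saddle_integrand_tendsto[OF M, folded c_def]])
    show "eventually (\<lambda>n. (\<integral>u. saddle_integrand M n u \<partial>lborel) = of_real (p n / K n)) sequentially"
      using eventually_gt_at_top[of 0]
      by eventually_elim (use power_series_exp_lambert_coeff_saddle[OF M F] in \<open>simp add: K_def Let_def\<close>)
  qed
  hence 1: "(\<lambda>n. p n / K n) \<longlonglongrightarrow> c" by (simp only: tendsto_of_real_iff)
  have "(\<lambda>n. \<epsilon> (saddle M n)) \<longlonglongrightarrow> 0"
    unfolding \<epsilon>_def by (rule filterlim_compose[OF lambert_asymptotics saddle_at_right_0[OF M]])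
  hence 2: "(\<lambda>n. exp (real M * \<epsilon> (saddle M n))) \<longlonglongrightarrow> exp (real M * 0)" by (intro tendsto_intros)
  have "(\<lambda>n. p n / K n * exp (real M * \<epsilon> (saddle M n)) / c) \<longlonglongrightarrow> c * exp (real M * 0) / c"
    using c by (intro tendsto_divide tendsto_mult 1 2 tendsto_const) auto
  hence lim: "(\<lambda>n. p n / K n * exp (real M * \<epsilon> (saddle M n)) / c) \<longlonglongrightarrow> 1" using c by simp
  show "(\<lambda>n. p n / ?g n) \<longlonglongrightarrow> 1"
  proof (rule Lim_transform_eventually[OF lim])
    show "eventually (\<lambda>n. p n / K n * exp (real M * \<epsilon> (saddle M n)) / c = p n / ?g n) sequentially"
      using eventually_gt_at_top[of 0]
    proof eventually_elim
      case (elim n)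
      define t where "t = saddle M n"
      define Q where "Q = pi\<^sup>2 / 6 / t + ln (t / (2 * pi)) / 2"
      have "lambert (exp (-t)) = Q + \<epsilon> t" by (simp add: Q_def \<epsilon>_def)
      hence K: "K n = t powr (3/2) * exp (real n * t + real M * Q) / (2 * pi) * exp (real M * \<epsilon> t)"
        by (simp add: K_def Let_def t_def[symmetric] distrib_left exp_add)
      have "?g n = t powr (3/2) * exp (real n * t + real M * Q) / (2 * pi) * c"
        using saddle_main_term[OF M elim] unfolding Q_def t_def c_def by simp
      hence "?g n = K n / exp (real M * \<epsilon> t) * c" unfolding K by simp
      thus ?case unfolding t_def[symmetric] by (simp only: divide_divide_eq_right divide_divide_eq_left times_divide_eq_left times_divide_eq_right mult_ac)
    qed
  qed
qed

section \<open>Weighted configurations\<close>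

text \<open>Multisets over \<open>J\<close>, given by their multiplicities. The sum runs over the
  support because \<open>J\<close> may be infinite.\<close>

definition configs :: "'j set \<Rightarrow> ('j \<Rightarrow> nat) \<Rightarrow> nat \<Rightarrow> ('j \<Rightarrow> nat) set" where
  "configs J wt n = {c. {j. c j \<noteq> 0} \<subseteq> J \<and> finite {j. c j \<noteq> 0} \<and> (\<Sum>j | c j \<noteq> 0. wt j * c j) = n}"

lemma configs_finite_eq:
  assumes "finite J"
  shows "configs J wt n = {c. {j. c j \<noteq> 0} \<subseteq> J \<and> (\<Sum>j\<in>J. wt j * c j) = n}"
proof -
  have "(\<Sum>j | c j \<noteq> 0. wt j * c j) = (\<Sum>j\<in>J. wt j * c j)" if "{j. c j \<noteq> 0} \<subseteq> J" for c
    using that assms by (intro sum.mono_neutral_left) auto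
  moreover have "finite {j. c j \<noteq> 0}" if "{j. c j \<noteq> 0} \<subseteq> J" for c :: "'a \<Rightarrow> nat"
    using that assms finite_subset by blast
  ultimately show ?thesis unfolding configs_def by auto
qed

text \<open>An index that occurs has weight at most n. Each single coefficient is thereby reduced to
  a set of indices of bounded weight.\<close>

lemma configs_restrict:
  assumes "\<And>j. j \<in> J \<Longrightarrow> wt j > 0" "n \<le> N"
  shows "configs J wt n = configs {j \<in> J. wt j \<le> N} wt n"
proof -
  have "wt j \<le> N" if c: "c \<in> configs J wt n" and j: "c j \<noteq> 0" for c j
  proof -
    have "wt j * c j \<le> (\<Sum>j | c j \<noteq> 0. wt j * c j)"
      using c j by (intro member_le_sum) (auto simp: configs_def)
    also have "\<dots> = n" using c by (simp add: configs_def)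
    finally have "wt j * c j \<le> N" using assms(2) by simp
    moreover have "wt j * 1 \<le> wt j * c j" using j by (intro mult_left_mono) auto
    ultimately show ?thesis by linarith
  qed
  thus ?thesis unfolding configs_def by auto
qed

lemma configs_mono: "J \<subseteq> J' \<Longrightarrow> configs J wt n \<subseteq> configs J' wt n"
  by (auto simp: configs_def)

text \<open>Configurations are sorted by the multiplicity of \<open>j\<close>, which is then set to
  0. The sum has the shape of a Cauchy product with the series of 1 / (1 - w^(wt j)).\<close>

lemma configs_insert_card:
  assumes "finite J" "j \<notin> J" "\<And>n. finite (configs J wt n)" and wt: "wt j > 0"
  shows "finite (configs (insert j J) wt n)"
    and "card (configs (insert j J) wt n) = (\<Sum>i\<le>n. (if wt j dvd i then 1 else 0) * card (configs J wt (n - i)))"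
proof -
  define A where "A = (\<lambda>i. {c \<in> configs (insert j J) wt n. wt j * c j = i})"
  have sum_eq: "(\<Sum>k\<in>insert j J. wt k * c k) = wt j * c j + (\<Sum>k\<in>J. wt k * c k)" for c
    using assms by simp
  have union: "configs (insert j J) wt n = (\<Union>i\<le>n. A i)"
    unfolding A_def configs_finite_eq[OF finite.insertI[OF assms(1)]] sum_eq by auto
  have bij: "bij_betw (\<lambda>c. c(j := 0)) (A (wt j * i)) (configs J wt (n - wt j * i))" if "wt j * i \<le> n" for i
  proof (rule bij_betw_byWitness[where f' = "\<lambda>c. c(j := i)"])
    have other: "(\<Sum>k\<in>J. wt k * (c(j := x)) k) = (\<Sum>k\<in>J. wt k * c k)" for c x
      using assms(2) by (intro sum.cong) auto
    show "\<forall>c\<in>A (wt j * i). (c(j := 0))(j := i) = c" using wt by (auto simp: A_def)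
    show "\<forall>c\<in>configs J wt (n - wt j * i). (c(j := i))(j := 0) = c"
      using assms(2) by (auto simp: configs_def fun_eq_iff)
    show "(\<lambda>c. c(j := 0)) ` A (wt j * i) \<subseteq> configs J wt (n - wt j * i)"
      unfolding A_def configs_finite_eq[OF finite.insertI[OF assms(1)]] configs_finite_eq[OF assms(1)] sum_eq
      using other by (auto split: if_splits)
    show "(\<lambda>c. c(j := i)) ` configs J wt (n - wt j * i) \<subseteq> A (wt j * i)"
      unfolding A_def configs_finite_eq[OF finite.insertI[OF assms(1)]] configs_finite_eq[OF assms(1)] sum_eq
      using other that by (auto split: if_splits)
  qed
  have A_empty: "A i = {}" if "\<not> wt j dvd i" for i using that by (auto simp: A_def)
  have finA: "finite (A i)" if "i \<le> n" for i
    using A_empty[of i] bij bij_betw_finite assms(3) that by (cases "wt j dvd i") (fastforce elim: dvdE)+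
  show "finite (configs (insert j J) wt n)" unfolding union using finA by auto
  have "card (configs (insert j J) wt n) = (\<Sum>i\<le>n. card (A i))"
    unfolding union using finA by (intro card_UN_disjoint) (auto simp: A_def)
  also have "\<dots> = (\<Sum>i\<le>n. (if wt j dvd i then 1 else 0) * card (configs J wt (n - i)))"
    using A_empty bij_betw_same_card[OF bij] by (intro sum.cong) (auto elim!: dvdE)
  finally show "card (configs (insert j J) wt n) = (\<Sum>i\<le>n. (if wt j dvd i then 1 else 0) * card (configs J wt (n - i)))" .
qed

lemma sums_multiples:
  fixes w :: complex
  assumes "norm w < 1" "k > 0"
  shows "(\<lambda>i. of_nat (if k dvd i then 1 else 0) * w ^ i) sums (1 / (1 - w ^ k))"
proof -
  have "norm (w ^ k) < 1" unfolding norm_power using assms by (simp add: power_less_one_iff)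
  hence "(\<lambda>n. (w ^ k) ^ n) sums (1 / (1 - w ^ k))" by (rule geometric_sums)
  hence "(\<lambda>n. of_nat (if k dvd k * n then 1 else 0) * w ^ (k * n)) sums (1 / (1 - w ^ k))"
    by (simp add: power_mult)
  thus ?thesis
    by (subst (asm) sums_mono_reindex[of "\<lambda>n. k * n" "\<lambda>i. of_nat (if k dvd i then 1 else 0) * w ^ i"])
       (use assms in \<open>auto simp: strict_mono_def elim!: dvdE\<close>)
qed

lemma configs_finite_gf:
  assumes "finite J" "\<And>j. j \<in> J \<Longrightarrow> wt j > 0"
  shows "finite (configs J wt n)"
    and "norm w < 1 \<Longrightarrow> (\<lambda>n. of_nat (card (configs J wt n)) * w ^ n) sums (\<Prod>j\<in>J. 1 / (1 - w ^ wt j :: complex))"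
proof -
  have "(\<forall>n. finite (configs J wt n)) \<and>
    (\<forall>w::complex. norm w < 1 \<longrightarrow> (\<lambda>n. of_nat (card (configs J wt n)) * w ^ n) sums (\<Prod>j\<in>J. 1 / (1 - w ^ wt j)))"
    using assms
  proof (induction J)
    case empty
    have eq: "configs {} wt n = (if n = 0 then {\<lambda>_. 0} else {})" for n
      by (auto simp: configs_finite_eq)
    have "(\<lambda>n. of_nat (card (configs {} wt n)) * w ^ n) sums 1" for w :: complex
      using sums_single[of 0 "\<lambda>n. 1 :: complex"] unfolding eq by (rule sums_cong[THEN iffD1, rotated]) auto
    thus ?case by (simp add: eq)
  next
    case (insert j J)
    hence IH: "\<And>n. finite (configs J wt n)"
      "\<And>w::complex. norm w < 1 \<Longrightarrow> (\<lambda>n. of_nat (card (configs J wt n)) * w ^ n) sums (\<Prod>j\<in>J. 1 / (1 - w ^ wt j))"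
      by auto
    have wt: "wt j > 0" using insert by auto
    note step = configs_insert_card[OF insert.hyps(1,2) IH(1) wt]
    have "(\<lambda>n. of_nat (card (configs (insert j J) wt n)) * w ^ n) sums (\<Prod>j\<in>insert j J. 1 / (1 - w ^ wt j))"
      if w: "norm w < 1" for w :: complex
    proof -
      define a where "a = (\<lambda>w::complex. \<lambda>i. of_nat (if wt j dvd i then 1 else 0) * w ^ i)"
      define b where "b = (\<lambda>w::complex. \<lambda>n. of_nat (card (configs J wt n)) * w ^ n)"
      define r where "r = complex_of_real (norm w)"
      have r: "norm r < 1" using w by (simp add: r_def)
      \<comment> \<open>The coefficients are nonnegative, so the norms are the terms of the same
        series at the point |w|, and absolute convergence follows from convergence there.\<close>
      have normab: "norm (a w i) = Re (a r i)" "norm (b w i) = Re (b r i)" for i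
        by (simp_all add: a_def b_def r_def norm_mult norm_power flip: of_real_power)
      have sa: "summable (\<lambda>i. norm (a w i))"
        unfolding normab unfolding a_def using sums_multiples[OF r wt] by (intro summable_Re) (simp add: sums_iff)
      have sb: "summable (\<lambda>i. norm (b w i))"
        unfolding normab unfolding b_def using IH(2)[OF r] by (intro summable_Re) (simp add: sums_iff)
      have "(\<lambda>n. \<Sum>i\<le>n. a w i * b w (n - i)) sums ((\<Sum>i. a w i) * (\<Sum>i. b w i))"
        by (rule Cauchy_product_sums[OF sa sb])
      also have "(\<Sum>i. a w i) = 1 / (1 - w ^ wt j)"
        unfolding a_def using sums_multiples[OF w wt] by (simp add: sums_iff)
      also have "(\<Sum>i. b w i) = (\<Prod>j\<in>J. 1 / (1 - w ^ wt j))"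
        unfolding b_def using IH(2)[OF w] by (simp add: sums_iff)
      also have "(\<lambda>n. \<Sum>i\<le>n. a w i * b w (n - i)) = (\<lambda>n. of_nat (card (configs (insert j J) wt n)) * w ^ n)"
      proof
        fix n
        have "(\<Sum>i\<le>n. a w i * b w (n - i)) = (\<Sum>i\<le>n. of_nat ((if wt j dvd i then 1 else 0) * card (configs J wt (n - i))) * w ^ n)"
          unfolding a_def b_def by (intro sum.cong) (auto simp flip: power_add)
        thus "(\<Sum>i\<le>n. a w i * b w (n - i)) = of_nat (card (configs (insert j J) wt n)) * w ^ n"
          unfolding step(2) by (simp add: sum_distrib_right)
      qed
      finally show ?thesis using insert.hyps by simp
    qed
    with step(1) show ?case by blast
  qed
  thus "finite (configs J wt n)"
    and "norm w < 1 \<Longrightarrow> (\<lambda>n. of_nat (card (configs J wt n)) * w ^ n) sums (\<Prod>j\<in>J. 1 / (1 - w ^ wt j :: complex))"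
    by auto
qed

text \<open>The index set is cut off at weight N, and each coefficient is constant from N = n on. At
  the point r = |w| the finite products converge, hence are bounded, and they bound the partial sums
  of the full series; the terms of that series are then the majorant for the limit in N at
  w.\<close>

theorem configs_gf:
  fixes M :: nat and w :: complex
  assumes wt: "\<And>j. j \<in> J \<Longrightarrow> wt j > 0"
    and fin: "\<And>m. m > 0 \<Longrightarrow> finite {j \<in> J. wt j = m}"
    and M: "\<And>m. m > 0 \<Longrightarrow> card {j \<in> J. wt j = m} = M"
    and w: "norm w < 1"
  shows "(\<lambda>n. of_nat (card (configs J wt n)) * w ^ n) sums exp (of_nat M * lambert w)"
proof -
  define JN where "JN = (\<lambda>N. {j \<in> J. wt j \<le> N})"
  have JN_eq: "JN N = (\<Union>m<N. {j \<in> J. wt j = Suc m})" for N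
  proof -
    have "wt j \<le> N \<longleftrightarrow> (\<exists>m<N. wt j = Suc m)" if "j \<in> J" for j
      using wt[OF that] by (cases "wt j") auto
    thus ?thesis unfolding JN_def by blast
  qed
  have finJN: "finite (JN N)" for N unfolding JN_eq by (intro finite_UN_I finite_lessThan fin) simp
  have wtJN: "\<And>j. j \<in> JN N \<Longrightarrow> wt j > 0" for N using wt by (auto simp: JN_def)
  have restrict: "configs J wt n = configs (JN N) wt n" if "n \<le> N" for n N
    unfolding JN_def by (rule configs_restrict[OF wt that])
  have fin_configs: "finite (configs J wt n)" for n
    unfolding restrict[OF order.refl] by (rule configs_finite_gf(1)[OF finJN wtJN])
  have prod_JN: "(\<Prod>j\<in>JN N. 1 / (1 - v ^ wt j)) = exp (of_nat M * (\<Sum>m<N. - Ln (1 - v ^ Suc m)))"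
    if v: "norm v < 1" for v :: complex and N
  proof -
    have "(\<Prod>j\<in>JN N. 1 / (1 - v ^ wt j)) = (\<Prod>m<N. \<Prod>j\<in>{j \<in> J. wt j = Suc m}. 1 / (1 - v ^ wt j))"
      unfolding JN_eq using fin by (intro prod.UNION_disjoint) auto
    also have "\<dots> = (\<Prod>m<N. (1 / (1 - v ^ Suc m)) ^ M)"
    proof (intro prod.cong refl)
      fix m
      have "(\<Prod>j\<in>{j \<in> J. wt j = Suc m}. 1 / (1 - v ^ wt j)) = (\<Prod>j\<in>{j \<in> J. wt j = Suc m}. 1 / (1 - v ^ Suc m))"
        by (intro prod.cong) auto
      also have "\<dots> = (1 / (1 - v ^ Suc m)) ^ M" using M[of "Suc m"] by (simp only: prod_constant)
      finally show "(\<Prod>j\<in>{j \<in> J. wt j = Suc m}. 1 / (1 - v ^ wt j)) = (1 / (1 - v ^ Suc m)) ^ M" .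
    qed
    also have "\<dots> = (\<Prod>m<N. exp (of_nat M * (- Ln (1 - v ^ Suc m))))"
    proof (intro prod.cong refl)
      fix m
      have "norm (v ^ Suc m) < 1" unfolding norm_power using v by (simp add: power_less_one_iff del: power_Suc)
      hence "1 - v ^ Suc m \<noteq> 0" by auto
      hence "exp (- Ln (1 - v ^ Suc m)) = 1 / (1 - v ^ Suc m)" by (simp add: exp_minus divide_inverse)
      thus "(1 / (1 - v ^ Suc m)) ^ M = exp (of_nat M * (- Ln (1 - v ^ Suc m)))"
        by (simp only: exp_of_nat_mult)
    qed
    also have "\<dots> = exp (of_nat M * (\<Sum>m<N. - Ln (1 - v ^ Suc m)))"
      by (simp only: exp_sum[OF finite_lessThan, symmetric] sum_distrib_left)
    finally show ?thesis .
  qed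
  have lim: "(\<lambda>N. \<Prod>j\<in>JN N. 1 / (1 - v ^ wt j)) \<longlonglongrightarrow> exp (of_nat M * lambert v)" if "norm v < 1" for v :: complex
    unfolding prod_JN[OF that] using minus_Ln_sums_lambert[OF that] unfolding sums_def
    by (intro tendsto_intros)
  define p where "p = (\<lambda>n. real (card (configs J wt n)))"
  define r where "r = norm w"
  have r: "0 \<le> r" "r < 1" using w by (auto simp: r_def)
  have summable: "summable (\<lambda>n. p n * r ^ n)"
  proof -
    define P where "P = (\<lambda>N. Re (\<Prod>j\<in>JN N. 1 / (1 - of_real r ^ wt j)))"
    have "P \<longlonglongrightarrow> Re (exp (of_nat M * lambert (of_real r)))"
      unfolding P_def using r by (intro tendsto_Re lim) simp
    hence "Bseq P" using convergentI Bseq_eq_bounded convergent_imp_Bseq by blast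
    then obtain B where B: "\<And>N. norm (P N) \<le> B" unfolding Bseq_def by blast
    have "(\<Sum>n<N. p n * r ^ n) \<le> B" for N
    proof -
      have "(\<lambda>n. of_nat (card (configs (JN N) wt n)) * of_real r ^ n) sums (\<Prod>j\<in>JN N. 1 / (1 - complex_of_real r ^ wt j))"
        using r by (intro configs_finite_gf(2)[OF finJN wtJN]) auto
      from sums_Re[OF this] have s: "(\<lambda>n. real (card (configs (JN N) wt n)) * r ^ n) sums P N"
        by (simp add: P_def flip: of_real_power)
      have "(\<Sum>n<N. p n * r ^ n) = (\<Sum>n<N. real (card (configs (JN N) wt n)) * r ^ n)"
        unfolding p_def using restrict[of _ N] by (intro sum.cong) auto
      also have "\<dots> \<le> P N"
        using s r sum_le_suminf[of "\<lambda>n. real (card (configs (JN N) wt n)) * r ^ n" "{..<N}"] by (simp add: sums_iff)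
      also have "\<dots> \<le> B" using B[of N] by simp
      finally show ?thesis .
    qed
    thus ?thesis using r by (intro bounded_imp_summable[of _ B]) (auto simp: p_def lessThan_Suc_atMost[symmetric] simp del: sum.lessThan_Suc)
  qed
  define a where "a = (\<lambda>n N. of_nat (card (configs (JN N) wt n)) * w ^ n)"
  have sum_a: "(\<Sum>n. a n N) = (\<Prod>j\<in>JN N. 1 / (1 - w ^ wt j))" for N
    unfolding a_def using configs_finite_gf(2)[OF finJN wtJN w, of N] by (simp add: sums_iff)
  have "(\<lambda>N. \<Sum>n. a n N) \<longlonglongrightarrow> (\<Sum>n. of_nat (card (configs J wt n)) * w ^ n)"
  proof (rule tannery_uniform[OF _ _ summable])
    fix n
    have "eventually (\<lambda>N. of_nat (card (configs J wt n)) * w ^ n = a n N) sequentially"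
      using eventually_ge_at_top[of n] by eventually_elim (simp add: a_def restrict)
    thus "(\<lambda>N. a n N) \<longlonglongrightarrow> of_nat (card (configs J wt n)) * w ^ n"
      by (rule Lim_transform_eventually[OF tendsto_const])
  next
    have "norm (a n N) \<le> p n * r ^ n" for n N
      unfolding a_def p_def r_def norm_mult norm_power norm_of_nat
      using card_mono[OF fin_configs configs_mono[of "JN N" J wt n]]
      by (intro mult_right_mono) (auto simp: JN_def)
    thus "eventually (\<lambda>N. \<forall>n. norm (a n N) \<le> p n * r ^ n) sequentially" by simp
  qed simp
  hence "(\<Sum>n. of_nat (card (configs J wt n)) * w ^ n) = exp (of_nat M * lambert w)"
    unfolding sum_a using lim[OF w] LIMSEQ_unique by blast
  moreover have "summable (\<lambda>n. of_nat (card (configs J wt n)) * w ^ n)"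
    by (rule summable_norm_cancel) (use summable in \<open>simp add: p_def r_def norm_mult norm_power\<close>)
  ultimately show ?thesis by (simp add: sums_iff)
qed

section \<open>Orbits and holonomy\<close>

text \<open>\<open>orbit f x\<close> is generated from f x, so x belongs to it only because a
  permutation of finite support returns to x. It is then the list of iterates up to the first
  return.\<close>

lemma permutation_orbit_card:
  assumes "permutation f"
  shows "card (orbit f x) > 0" "(f ^^ card (orbit f x)) x = x"
    "inj_on (\<lambda>i. (f ^^ i) x) {..<card (orbit f x)}"
    "orbit f x = (\<lambda>i. (f ^^ i) x) ` {..<card (orbit f x)}"
proof -
  have self: "x \<in> orbit f x" by (rule permutation_self_in_orbit[OF assms])
  define n where "n = funpow_dist1 f x x"
  have eq: "orbit f x = (\<lambda>i. (f ^^ i) x) ` {0..<n}"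
    unfolding n_def by (rule orbit_conv_funpow_dist1[OF self])
  have inj: "inj_on (\<lambda>i. (f ^^ i) x) {0..<n}"
    unfolding n_def by (rule inj_on_funpow_dist1[OF self])
  have card: "card (orbit f x) = n"
    unfolding eq using inj by (simp add: card_image)
  show "card (orbit f x) > 0" unfolding card n_def by simp
  show "(f ^^ card (orbit f x)) x = x"
    unfolding card n_def using funpow_dist1_prop[OF self] .
  show "inj_on (\<lambda>i. (f ^^ i) x) {..<card (orbit f x)}"
    using inj unfolding card by (simp add: atLeast0LessThan)
  show "orbit f x = (\<lambda>i. (f ^^ i) x) ` {..<card (orbit f x)}"
    using eq unfolding card by (simp add: atLeast0LessThan)
qed

lemma permutes_finite_support_permutation:
  assumes "f permutes X" "finite {x. f x \<noteq> x}"
  shows "permutation f"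
  using assms by (simp add: permutation permutes_bij)

lemma orbit_conjugate:
  assumes "bij p" "\<And>x. f' (p x) = p (f x)"
  shows "orbit f' (p x) = p ` orbit f x"
proof -
  have pow: "(f' ^^ n) (p x) = p ((f ^^ n) x)" for n
    by (induction n) (auto simp: assms(2))
  show ?thesis unfolding orbit_altdef pow by blast
qed

section \<open>Conjugacy classes in a group\<close>

context group
begin

lemma conj_class_closed: "a \<in> carrier G \<Longrightarrow> conj_class G a \<subseteq> carrier G"
  by (auto simp: conj_class_def)

lemma conj_class_conj:
  assumes "a \<in> carrier G" "s \<in> carrier G"
  shows "conj_class G (s \<otimes> a \<otimes> inv s) = conj_class G a"
proof -
  have sub: "conj_class G (s \<otimes> a \<otimes> inv s) \<subseteq> conj_class G a" if "a \<in> carrier G" "s \<in> carrier G" for a s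
  proof
    fix y assume "y \<in> conj_class G (s \<otimes> a \<otimes> inv s)"
    then obtain h where h: "h \<in> carrier G" "y = h \<otimes> (s \<otimes> a \<otimes> inv s) \<otimes> inv h" by (auto simp: conj_class_def)
    hence "y = (h \<otimes> s) \<otimes> a \<otimes> inv (h \<otimes> s)" using that by (simp add: m_assoc inv_mult_group)
    thus "y \<in> conj_class G a" using h that unfolding conj_class_def by blast
  qed
  have "conj_class G a = conj_class G (inv s \<otimes> (s \<otimes> a \<otimes> inv s) \<otimes> inv (inv s))"
    using assms by (simp add: m_assoc) (simp add: m_assoc[symmetric])
  with sub[of a s] sub[of "s \<otimes> a \<otimes> inv s" "inv s"] show ?thesis using assms by blast
qed

lemma in_own_conj_class: "a \<in> carrier G \<Longrightarrow> a \<in> conj_class G a"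
  unfolding conj_class_def by (auto intro!: exI[of _ \<one>])

lemma conj_class_eq_one_iff: "a \<in> carrier G \<Longrightarrow> conj_class G a = {\<one>} \<longleftrightarrow> a = \<one>"
  using in_own_conj_class[of a] by (auto simp: conj_class_def)

lemma conj_class_eqD:
  assumes "a \<in> carrier G" "b \<in> carrier G" "conj_class G a = conj_class G b"
  obtains s where "s \<in> carrier G" "b = s \<otimes> a \<otimes> inv s"
  using in_own_conj_class[OF assms(2)] unfolding assms(3)[symmetric] by (auto simp: conj_class_def)

lemma conj_class_eq_iff:
  assumes "a \<in> carrier G" "b \<in> carrier G"
  shows "conj_class G a = conj_class G b \<longleftrightarrow> b \<in> conj_class G a"
proof
  assume "b \<in> conj_class G a"
  then obtain h where "h \<in> carrier G" "b = h \<otimes> a \<otimes> inv h" by (auto simp: conj_class_def)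
  thus "conj_class G a = conj_class G b" using conj_class_conj[OF assms(1)] by simp
qed (use in_own_conj_class[OF assms(2)] in simp)

end

section \<open>The wreath product as a group\<close>

locale fin_wreath = group H for H :: "('h, 'm) monoid_scheme" (structure) +
  fixes X :: "'x set"
begin

abbreviation W where "W \<equiv> wreath H X"

abbreviation wprod where "wprod ss \<equiv> foldr (\<otimes>\<^bsub>W\<^esub>) ss \<one>\<^bsub>W\<^esub>"

lemma carrier_wreath_iff:
  "g \<in> carrier W \<longleftrightarrow> fst g \<in> X \<rightarrow>\<^sub>E carrier H \<and> finite {x \<in> X. fst g x \<noteq> \<one>} \<and>
     snd g permutes X \<and> finite {x. snd g x \<noteq> x}"
  by (cases g) (simp add: wreath_def fin_sym_group_def carrier_sum_group conj_ac)

lemma mult_wreath: "g \<otimes>\<^bsub>W\<^esub> h = (\<lambda>x\<in>X. fst g x \<otimes> fst h (inv_into UNIV (snd g) x), snd g \<circ> snd h)"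
  by (cases g; cases h) (simp add: wreath_def)

lemma fst_mult_wreath: "x \<in> X \<Longrightarrow> fst (g \<otimes>\<^bsub>W\<^esub> h) x = fst g x \<otimes> fst h (inv_into UNIV (snd g) x)"
  by (simp add: mult_wreath)

lemma snd_mult_wreath: "snd (g \<otimes>\<^bsub>W\<^esub> h) = snd g \<circ> snd h"
  by (simp add: mult_wreath)

lemma one_wreath: "\<one>\<^bsub>W\<^esub> = (\<lambda>x\<in>X. \<one>, id)"
  by (simp add: wreath_def)

lemma fst_closed [simp]: "g \<in> carrier W \<Longrightarrow> x \<in> X \<Longrightarrow> fst g x \<in> carrier H"
  by (auto simp: carrier_wreath_iff)

lemma snd_permutes: "g \<in> carrier W \<Longrightarrow> snd g permutes X"
  by (auto simp: carrier_wreath_iff)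

lemma snd_permutation: "g \<in> carrier W \<Longrightarrow> permutation (snd g)"
  using permutes_finite_support_permutation by (auto simp: carrier_wreath_iff)

lemma snd_in [simp]: "g \<in> carrier W \<Longrightarrow> snd g x \<in> X \<longleftrightarrow> x \<in> X"
  by (simp add: snd_permutes permutes_in_image)

lemma inv_snd_in [simp]: "g \<in> carrier W \<Longrightarrow> inv_into UNIV (snd g) x \<in> X \<longleftrightarrow> x \<in> X"
  using permutes_in_image[OF permutes_inv[OF snd_permutes]] by blast

lemma snd_pow_in [simp]: "g \<in> carrier W \<Longrightarrow> (snd g ^^ n) x \<in> X \<longleftrightarrow> x \<in> X"
  by (induction n) auto

lemma inv_snd_snd [simp]: "g \<in> carrier W \<Longrightarrow> inv_into UNIV (snd g) (snd g x) = x"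
  by (simp add: permutes_inverses(2)[OF snd_permutes])

lemma snd_inv_snd [simp]: "g \<in> carrier W \<Longrightarrow> snd g (inv_into UNIV (snd g) x) = x"
  by (simp add: permutes_inverses(1)[OF snd_permutes])

lemma wreath_eqI:
  assumes "g \<in> carrier W" "h \<in> carrier W" "\<And>x. x \<in> X \<Longrightarrow> fst g x = fst h x" "\<And>x. x \<in> X \<Longrightarrow> snd g x = snd h x"
  shows "g = h"
proof (rule prod_eqI)
  show "fst g = fst h" using assms by (intro PiE_ext[of _ X "\<lambda>_. carrier H"]) (auto simp: carrier_wreath_iff)
  show "snd g = snd h"
  proof
    fix x show "snd g x = snd h x"
      using assms(4)[of x] permutes_not_in[OF snd_permutes[OF assms(1)], of x] permutes_not_in[OF snd_permutes[OF assms(2)], of x]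
      by (cases "x \<in> X") auto
  qed
qed

lemma mult_wreath_closed:
  assumes g: "g \<in> carrier W" and h: "h \<in> carrier W"
  shows "g \<otimes>\<^bsub>W\<^esub> h \<in> carrier W"
proof -
  have "{x \<in> X. fst (g \<otimes>\<^bsub>W\<^esub> h) x \<noteq> \<one>} \<subseteq> {x \<in> X. fst g x \<noteq> \<one>} \<union> snd g ` {x \<in> X. fst h x \<noteq> \<one>}"
  proof
    fix x assume x: "x \<in> {x \<in> X. fst (g \<otimes>\<^bsub>W\<^esub> h) x \<noteq> \<one>}"
    have "fst h (inv_into UNIV (snd g) x) \<noteq> \<one> \<Longrightarrow> x \<in> snd g ` {x \<in> X. fst h x \<noteq> \<one>}"
      using x g by (intro image_eqI[of _ _ "inv_into UNIV (snd g) x"]) auto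
    thus "x \<in> {x \<in> X. fst g x \<noteq> \<one>} \<union> snd g ` {x \<in> X. fst h x \<noteq> \<one>}"
      using x g h by (auto simp: mult_wreath)
  qed
  moreover have "finite ({x \<in> X. fst g x \<noteq> \<one>} \<union> snd g ` {x \<in> X. fst h x \<noteq> \<one>})"
    using g h by (simp add: carrier_wreath_iff)
  ultimately have "finite {x \<in> X. fst (g \<otimes>\<^bsub>W\<^esub> h) x \<noteq> \<one>}" by (rule finite_subset)
  moreover have "finite {x. (snd g \<circ> snd h) x \<noteq> x}"
  proof (rule finite_subset)
    show "{x. (snd g \<circ> snd h) x \<noteq> x} \<subseteq> {x. snd g x \<noteq> x} \<union> {x. snd h x \<noteq> x}" by auto
  qed (use g h in \<open>simp add: carrier_wreath_iff\<close>)
  ultimately show ?thesis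
    unfolding carrier_wreath_iff[of "g \<otimes>\<^bsub>W\<^esub> h"] snd_mult_wreath
    using permutes_compose[OF snd_permutes[OF h] snd_permutes[OF g]] g h by (auto simp: mult_wreath)
qed

lemma one_wreath_closed: "\<one>\<^bsub>W\<^esub> \<in> carrier W"
  by (auto simp: carrier_wreath_iff one_wreath permutes_id)

definition wr_inv where
  "wr_inv g = (\<lambda>x\<in>X. inv (fst g (snd g x)), inv_into UNIV (snd g))"

lemma wr_inv_closed:
  assumes g: "g \<in> carrier W"
  shows "wr_inv g \<in> carrier W"
proof -
  have "{x \<in> X. fst (wr_inv g) x \<noteq> \<one>} \<subseteq> inv_into UNIV (snd g) ` {x \<in> X. fst g x \<noteq> \<one>}"
  proof
    fix x assume x: "x \<in> {x \<in> X. fst (wr_inv g) x \<noteq> \<one>}"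
    show "x \<in> inv_into UNIV (snd g) ` {x \<in> X. fst g x \<noteq> \<one>}"
      using x g by (intro image_eqI[of _ _ "snd g x"]) (auto simp: wr_inv_def)
  qed
  moreover have "finite (inv_into UNIV (snd g) ` {x \<in> X. fst g x \<noteq> \<one>})"
    using g by (simp add: carrier_wreath_iff)
  ultimately have "finite {x \<in> X. fst (wr_inv g) x \<noteq> \<one>}" by (rule finite_subset)
  moreover have "{x. inv_into UNIV (snd g) x \<noteq> x} \<subseteq> {x. snd g x \<noteq> x}"
  proof -
    have "inv_into UNIV (snd g) x = x" if "snd g x = x" for x using inv_snd_snd[OF g, of x] that by simp
    thus ?thesis by blast
  qed
  hence "finite {x. inv_into UNIV (snd g) x \<noteq> x}"
    using g finite_subset by (auto simp: carrier_wreath_iff)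
  ultimately show ?thesis
    unfolding carrier_wreath_iff[of "wr_inv g"]
    using g permutes_inv[OF snd_permutes[OF g]] by (auto simp: wr_inv_def)
qed

lemma group_wreath: "group W"
proof (rule groupI)
  fix g h k assume g: "g \<in> carrier W" and h: "h \<in> carrier W" and k: "k \<in> carrier W"
  show "g \<otimes>\<^bsub>W\<^esub> h \<otimes>\<^bsub>W\<^esub> k = g \<otimes>\<^bsub>W\<^esub> (h \<otimes>\<^bsub>W\<^esub> k)"
  proof (rule wreath_eqI)
    fix x assume x: "x \<in> X"
    have "inv_into UNIV (snd g \<circ> snd h) x = inv_into UNIV (snd h) (inv_into UNIV (snd g) x)"
      using o_inv_distrib[OF permutes_bij[OF snd_permutes[OF g]] permutes_bij[OF snd_permutes[OF h]]] by simp
    thus "fst (g \<otimes>\<^bsub>W\<^esub> h \<otimes>\<^bsub>W\<^esub> k) x = fst (g \<otimes>\<^bsub>W\<^esub> (h \<otimes>\<^bsub>W\<^esub> k)) x"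
      using x g h k by (simp add: fst_mult_wreath snd_mult_wreath m_assoc)
  qed (use g h k in \<open>auto intro!: mult_wreath_closed simp: snd_mult_wreath\<close>)
next
  fix g assume g: "g \<in> carrier W"
  show "\<one>\<^bsub>W\<^esub> \<otimes>\<^bsub>W\<^esub> g = g"
    by (rule wreath_eqI) (use g one_wreath_closed in \<open>auto intro!: mult_wreath_closed simp: fst_mult_wreath snd_mult_wreath, simp_all add: one_wreath\<close>)
  have "wr_inv g \<otimes>\<^bsub>W\<^esub> g = \<one>\<^bsub>W\<^esub>"
  proof (rule wreath_eqI)
    fix x assume x: "x \<in> X"
    have "inv_into UNIV (inv_into UNIV (snd g)) = snd g"
      by (intro inv_inv_eq permutes_bij[OF snd_permutes[OF g]])
    thus "fst (wr_inv g \<otimes>\<^bsub>W\<^esub> g) x = fst \<one>\<^bsub>W\<^esub> x"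
      using x g by (simp add: mult_wreath wr_inv_def one_wreath)
    show "snd (wr_inv g \<otimes>\<^bsub>W\<^esub> g) x = snd \<one>\<^bsub>W\<^esub> x"
      using g by (simp add: snd_mult_wreath wr_inv_def one_wreath)
  qed (use g in \<open>auto intro!: mult_wreath_closed wr_inv_closed one_wreath_closed\<close>)
  thus "\<exists>y\<in>carrier W. y \<otimes>\<^bsub>W\<^esub> g = \<one>\<^bsub>W\<^esub>" using wr_inv_closed[OF g] by blast
qed (auto intro: mult_wreath_closed one_wreath_closed)

sublocale W: group W by (rule group_wreath)

text \<open>The label belonging to the step from z to \<open>snd g z\<close> is stored at its
  target, as the multiplication of the wreath product requires. The product over n steps from x,
  with the latest step on the left, therefore begins at the image of x, and over a full cycle the
  label at x itself comes last.\<close>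

fun holonomy :: "('x \<Rightarrow> 'h) \<times> ('x \<Rightarrow> 'x) \<Rightarrow> 'x \<Rightarrow> nat \<Rightarrow> 'h" where
  "holonomy g x 0 = \<one>"
| "holonomy g x (Suc n) = fst g ((snd g ^^ Suc n) x) \<otimes> holonomy g x n"

definition cycle_tag :: "('x \<Rightarrow> 'h) \<times> ('x \<Rightarrow> 'x) \<Rightarrow> 'x \<Rightarrow> 'h set \<times> nat" where
  "cycle_tag g x = (conj_class H (holonomy g x (card (orbit (snd g) x))), card (orbit (snd g) x))"

lemma holonomy_closed [simp]: "g \<in> carrier W \<Longrightarrow> x \<in> X \<Longrightarrow> holonomy g x n \<in> carrier H"
  by (induction n) (auto simp del: funpow.simps)

text \<open>The form g' h = h g of conjugacy avoids inverses. It transports holonomies along a path: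
  the holonomy of g' and that of g differ by the labels of h at the two ends. Over a full cycle the
  ends coincide, so the holonomies are conjugate in \<open>H\<close>.\<close>

lemma cycle_tag_conjugate:
  assumes g: "g \<in> carrier W" and g': "g' \<in> carrier W" and h: "h \<in> carrier W"
    and eq: "g' \<otimes>\<^bsub>W\<^esub> h = h \<otimes>\<^bsub>W\<^esub> g" and x: "x \<in> X"
  shows "cycle_tag g' (snd h x) = cycle_tag g x"
proof -
  have s: "snd g' (snd h z) = snd h (snd g z)" for z
    using arg_cong[OF eq, of "\<lambda>k. snd k z"] by (simp add: mult_wreath)
  have f: "fst g' (snd h (snd g z)) \<otimes> fst h (snd h z) = fst h (snd h (snd g z)) \<otimes> fst g (snd g z)" if "z \<in> X" for z
    using arg_cong[OF eq, of "\<lambda>k. fst k (snd h (snd g z))"] that g g' h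
    by (simp add: mult_wreath s[symmetric]) (simp add: s)
  have pow: "(snd g' ^^ n) (snd h x) = snd h ((snd g ^^ n) x)" for n
    by (induction n) (auto simp: s)
  have hol: "holonomy g' (snd h x) n \<otimes> fst h (snd h x) = fst h (snd h ((snd g ^^ n) x)) \<otimes> holonomy g x n" for n
  proof (induction n)
    case (Suc n)
    define z where "z = (snd g ^^ n) x"
    have z: "z \<in> X" using g x by (simp add: z_def)
    have "holonomy g' (snd h x) (Suc n) \<otimes> fst h (snd h x)
        = fst g' (snd h (snd g z)) \<otimes> (holonomy g' (snd h x) n \<otimes> fst h (snd h x))"
      using g g' h x z pow[of "Suc n"] by (simp add: z_def m_assoc)
    also have "\<dots> = (fst g' (snd h (snd g z)) \<otimes> fst h (snd h z)) \<otimes> holonomy g x n"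
      unfolding Suc.IH using g g' h x z by (simp add: z_def[symmetric] m_assoc)
    also have "\<dots> = fst h (snd h (snd g z)) \<otimes> holonomy g x (Suc n)"
      unfolding f[OF z] using g h x z by (simp add: z_def[symmetric] m_assoc)
    finally show ?case by (simp add: z_def)
  qed (use h x in auto)
  have orb: "orbit (snd g') (snd h x) = snd h ` orbit (snd g) x"
    by (rule orbit_conjugate) (use s permutes_bij[OF snd_permutes[OF h]] in auto)
  define k where "k = card (orbit (snd g) x)"
  have card: "card (orbit (snd g') (snd h x)) = k"
    unfolding orb k_def using permutes_inj_on[OF snd_permutes[OF h]] by (intro card_image) blast
  have "(snd g ^^ k) x = x" unfolding k_def by (rule permutation_orbit_card(2)[OF snd_permutation[OF g]])
  hence "holonomy g' (snd h x) k \<otimes> fst h (snd h x) = fst h (snd h x) \<otimes> holonomy g x k"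
    using hol[of k] by simp
  hence "holonomy g' (snd h x) k = fst h (snd h x) \<otimes> holonomy g x k \<otimes> inv (fst h (snd h x))"
    using g g' h x by (metis fst_closed holonomy_closed inv_solve_right m_closed snd_in)
  thus ?thesis unfolding cycle_tag_def card k_def[symmetric]
    using conj_class_conj[of "holonomy g x k" "fst h (snd h x)"] g h x by simp
qed

text \<open>Every element commutes with itself, so the previous lemma applies with g, g' and h all
  equal.\<close>

lemma cycle_tag_step: "g \<in> carrier W \<Longrightarrow> x \<in> X \<Longrightarrow> cycle_tag g (snd g x) = cycle_tag g x"
  by (rule cycle_tag_conjugate) auto

lemma orbit_subset_X: "g \<in> carrier W \<Longrightarrow> x \<in> X \<Longrightarrow> orbit (snd g) x \<subseteq> X"
  by (intro permutes_orbit_subset snd_permutes)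

lemma cycle_tag_orbit:
  assumes "g \<in> carrier W" "x \<in> X" "y \<in> orbit (snd g) x"
  shows "cycle_tag g y = cycle_tag g x"
  using assms(3)
proof induction
  case base
  show ?case using assms by (simp add: cycle_tag_step)
next
  case (step y)
  thus ?case using cycle_tag_step[OF assms(1), of y] orbit_subset_X[OF assms(1,2)] by auto
qed

definition wr_support where
  "wr_support g = {x \<in> X. fst g x \<noteq> \<one> \<or> snd g x \<noteq> x}"

lemma finite_wr_support: "g \<in> carrier W \<Longrightarrow> finite (wr_support g)"
  unfolding wr_support_def
  by (rule finite_subset[of _ "{x \<in> X. fst g x \<noteq> \<one>} \<union> {x. snd g x \<noteq> x}"]) (auto simp: carrier_wreath_iff)

lemma cycle_tag_trivial_iff:
  assumes "g \<in> carrier W" "x \<in> X"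
  shows "cycle_tag g x = ({\<one>}, 1) \<longleftrightarrow> x \<notin> wr_support g"
proof -
  have "card (orbit (snd g) x) = 1 \<longleftrightarrow> snd g x = x"
  proof
    assume "card (orbit (snd g) x) = 1"
    then obtain y where "orbit (snd g) x = {y}" by (auto simp: card_1_singleton_iff)
    with permutation_self_in_orbit[OF snd_permutation[OF assms(1)], of x] show "snd g x = x"
      by (simp add: orbit_eq_singleton_iff)
  next
    assume "snd g x = x" hence "orbit (snd g) x = {x}" by (simp add: orbit_eq_singleton_iff)
    thus "card (orbit (snd g) x) = 1" by simp
  qed
  thus ?thesis using assms by (auto simp: cycle_tag_def wr_support_def conj_class_eq_one_iff)
qed

end

lemma permutation_in_orbit_iff:
  assumes "permutation f"
  shows "f z \<in> orbit f x \<longleftrightarrow> z \<in> orbit f x"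
proof
  assume "f z \<in> orbit f x"
  moreover have "z \<in> orbit f (f z)"
    using permutation_self_in_orbit[OF assms, of z] permutation_orbit_step[OF assms, of z] by simp
  ultimately show "z \<in> orbit f x" by (metis orbit_trans)
qed (rule orbit.step)

section \<open>Conjugating elements assembled cycle by cycle\<close>

context fin_wreath
begin

text \<open>\<open>(\<psi>, p)\<close> conjugates \<open>g\<close> restricted to \<open>A\<close> into \<open>g'\<close> restricted to \<open>A'\<close>.\<close>

definition intertwines where
  "intertwines g g' A A' p \<psi> \<longleftrightarrow> bij_betw p A A' \<and> (\<forall>z\<in>A. p (snd g z) = snd g' (p z)) \<and>
     (\<forall>z\<in>A'. \<psi> z \<in> carrier H) \<and>
     (\<forall>z\<in>A. fst g' (snd g' (p z)) \<otimes> \<psi> (p z) = \<psi> (p (snd g z)) \<otimes> fst g (snd g z))"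

definition stable where
  "stable g A \<longleftrightarrow> A \<subseteq> X \<and> (\<forall>z\<in>A. snd g z \<in> A)"

text \<open>Both cycles are walked in parallel from x and y. Once the label s at the start is
  chosen, the relation forces the label \<Psi> at the i-th point. It closes up after k steps because
  s is taken to conjugate one full holonomy into the other.\<close>

lemma intertwines_orbit:
  assumes g: "g \<in> carrier W" and g': "g' \<in> carrier W" and x: "x \<in> X" and y: "y \<in> X"
    and tag: "cycle_tag g x = cycle_tag g' y"
  shows "\<exists>p \<psi>. intertwines g g' (orbit (snd g) x) (orbit (snd g') y) p \<psi>"
proof -
  define f where "f = snd g"
  define f' where "f' = snd g'"
  define k where "k = card (orbit f x)"
  have k': "card (orbit f' y) = k" using tag by (simp add: cycle_tag_def k_def f_def f'_def)
  note P = permutation_orbit_card[OF snd_permutation[OF g], of x, folded f_def, folded k_def]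
  note P' = permutation_orbit_card[OF snd_permutation[OF g'], of y, folded f'_def, unfolded k']
  have cl: "holonomy g x i \<in> carrier H" "holonomy g' y i \<in> carrier H" for i using g g' x y by auto
  have "card (orbit (snd g) x) = k" "card (orbit (snd g') y) = k"
    using k' by (simp_all add: k_def f_def f'_def)
  hence "conj_class H (holonomy g x k) = conj_class H (holonomy g' y k)"
    using tag unfolding cycle_tag_def by simp
  then obtain s where s: "s \<in> carrier H" "holonomy g' y k = s \<otimes> holonomy g x k \<otimes> inv s"
    using conj_class_eqD[OF cl(1) cl(2)] by blast
  define \<Psi> where "\<Psi> = (\<lambda>i. holonomy g' y i \<otimes> s \<otimes> inv (holonomy g x i))"
  define idx where "idx = inv_into {..<k} (\<lambda>i. (f ^^ i) x)"
  define idx' where "idx' = inv_into {..<k} (\<lambda>i. (f' ^^ i) y)"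
  have idx: "idx ((f ^^ i) x) = i" "idx' ((f' ^^ i) y) = i" if "i < k" for i
    unfolding idx_def idx'_def
    using that inv_into_f_f[OF P(3), of i] inv_into_f_f[OF P'(3), of i] by auto
  define p where "p = (\<lambda>z. (f' ^^ idx z) y)"
  define \<psi> where "\<psi> = (\<lambda>z. \<Psi> (idx' z))"
  have \<Psi>k: "\<Psi> k = \<Psi> 0"
    unfolding \<Psi>_def s(2) using s(1) cl by (simp add: m_assoc)
  have p: "p ((f ^^ i) x) = (f' ^^ i) y" if "i \<le> k" for i
  proof (cases "i = k")
    case True
    have "p ((f ^^ 0) x) = (f' ^^ 0) y" unfolding p_def using idx(1)[of 0] P(1) by simp
    thus ?thesis using True P(2) P'(2) by simp
  qed (use that idx in \<open>simp add: p_def\<close>)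
  have \<psi>: "\<psi> ((f' ^^ i) y) = \<Psi> i" if "i \<le> k" for i
  proof (cases "i = k")
    case True
    have "\<psi> ((f' ^^ 0) y) = \<Psi> 0" unfolding \<psi>_def using idx(2)[of 0] P(1) by simp
    thus ?thesis using True P'(2) \<Psi>k by simp
  qed (use that idx in \<open>simp add: \<psi>_def\<close>)
  have "intertwines g g' (orbit f x) (orbit f' y) p \<psi>"
    unfolding intertwines_def
  proof (intro conjI ballI)
    have "bij_betw ((\<lambda>i. (f' ^^ i) y) \<circ> idx) (orbit f x) (orbit f' y)"
    proof (rule bij_betw_trans)
      show "bij_betw idx (orbit f x) {..<k}"
        unfolding idx_def using P(3,4) by (intro bij_betw_inv_into) (simp add: bij_betw_def)
      show "bij_betw (\<lambda>i. (f' ^^ i) y) {..<k} (orbit f' y)"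
        using P'(3,4) by (simp add: bij_betw_def)
    qed
    thus "bij_betw p (orbit f x) (orbit f' y)" by (simp add: p_def o_def)
    show "\<psi> z \<in> carrier H" for z unfolding \<psi>_def \<Psi>_def using cl s by auto
  next
    fix z assume "z \<in> orbit f x"
    then obtain i where i: "i < k" "z = (f ^^ i) x" using P(4) by auto
    have fz: "f z = (f ^^ Suc i) x" using i by simp
    show "p (snd g z) = snd g' (p z)"
      unfolding f_def[symmetric] f'_def[symmetric] fz using p[of i] p[of "Suc i"] i by simp
    have "fst g' ((f' ^^ Suc i) y) \<otimes> \<Psi> i = \<Psi> (Suc i) \<otimes> fst g ((f ^^ Suc i) x)"
    proof -
      have a: "fst g ((f ^^ Suc i) x) \<in> carrier H" "fst g' ((f' ^^ Suc i) y) \<in> carrier H"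
        using g g' x y unfolding f_def f'_def by (intro fst_closed; simp del: funpow.simps)+
      have "holonomy g x (Suc i) = fst g ((f ^^ Suc i) x) \<otimes> holonomy g x i"
        "holonomy g' y (Suc i) = fst g' ((f' ^^ Suc i) y) \<otimes> holonomy g' y i"
        by (simp_all only: holonomy.simps f_def f'_def)
      thus ?thesis unfolding \<Psi>_def using a s(1) cl by (simp add: m_assoc inv_mult_group)
    qed
    thus "fst g' (snd g' (p z)) \<otimes> \<psi> (p z) = \<psi> (p (snd g z)) \<otimes> fst g (snd g z)"
      unfolding f_def[symmetric] f'_def[symmetric] fz
      using p[of i] p[of "Suc i"] \<psi>[of i] \<psi>[of "Suc i"] i by simp
  qed
  thus ?thesis unfolding f_def f'_def by blast
qed

lemma intertwines_Un:
  assumes 1: "intertwines g g' A A' p \<psi>" and 2: "intertwines g g' B B' q \<omega>"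
    and disj: "A \<inter> B = {}" "A' \<inter> B' = {}" and st: "stable g A" "stable g B"
  shows "intertwines g g' (A \<union> B) (A' \<union> B') (\<lambda>z. if z \<in> A then p z else q z) (\<lambda>z. if z \<in> A' then \<psi> z else \<omega> z)"
proof -
  define r where "r = (\<lambda>z. if z \<in> A then p z else q z)"
  define \<rho> where "\<rho> = (\<lambda>z. if z \<in> A' then \<psi> z else \<omega> z)"
  have rA: "r z = p z" "\<rho> (p z) = \<psi> (p z)" if "z \<in> A" for z
    using that 1 by (auto simp: r_def \<rho>_def intertwines_def bij_betw_def)
  have rB: "r z = q z" "\<rho> (q z) = \<omega> (q z)" if "z \<in> B" for z
    using that 2 disj by (auto simp: r_def \<rho>_def intertwines_def bij_betw_def)
  have "bij_betw r A A'" using 1 rA by (subst bij_betw_cong[of A r p]) (auto simp: intertwines_def)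
  moreover have "bij_betw r B B'" using 2 rB by (subst bij_betw_cong[of B r q]) (auto simp: intertwines_def)
  ultimately have "bij_betw r (A \<union> B) (A' \<union> B')" using disj by (intro bij_betw_combine)
  moreover have "\<rho> z \<in> carrier H" if "z \<in> A' \<union> B'" for z
    using that 1 2 by (auto simp: \<rho>_def intertwines_def)
  moreover have "r (snd g z) = snd g' (r z) \<and> fst g' (snd g' (r z)) \<otimes> \<rho> (r z) = \<rho> (r (snd g z)) \<otimes> fst g (snd g z)"
    if "z \<in> A \<union> B" for z
  proof (cases "z \<in> A")
    case True
    hence z: "z \<in> A" using that by simp
    hence sz: "snd g z \<in> A" using st by (simp add: stable_def)
    show ?thesis unfolding rA[OF z] rA[OF sz] using 1 z unfolding intertwines_def by blast
  next
    case False
    hence z: "z \<in> B" using that by simp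
    hence sz: "snd g z \<in> B" using st by (simp add: stable_def)
    show ?thesis unfolding rB[OF z] rB[OF sz] using 2 z unfolding intertwines_def by blast
  qed
  ultimately show ?thesis unfolding r_def[symmetric] \<rho>_def[symmetric] by (auto simp: intertwines_def)
qed

text \<open>Induction on the size of \<open>A\<close>: a cycle on each side with the same tag is
  matched and removed. Equal tags include equal lengths, so the numbers of points per tag remain
  equal.\<close>

lemma intertwines_equal_tag_counts:
  assumes g: "g \<in> carrier W" and g': "g' \<in> carrier W"
  shows "finite A \<Longrightarrow> finite A' \<Longrightarrow> stable g A \<Longrightarrow> stable g' A' \<Longrightarrow>
    (\<And>\<tau>. card {z \<in> A. cycle_tag g z = \<tau>} = card {z \<in> A'. cycle_tag g' z = \<tau>}) \<Longrightarrow>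
    \<exists>p \<psi>. intertwines g g' A A' p \<psi>"
proof (induction "card A" arbitrary: A A' rule: less_induct)
  case less
  note fin = less.prems(1,2) and st = less.prems(3,4) and cnt = less.prems(5)
  show ?case
  proof (cases "A = {}")
    case True
    have "A' = {}"
    proof (rule ccontr)
      assume "A' \<noteq> {}"
      then obtain y where "y \<in> A'" by blast
      hence "card {z \<in> A'. cycle_tag g' z = cycle_tag g' y} \<noteq> 0" using fin by auto
      thus False using cnt[of "cycle_tag g' y"] True by simp
    qed
    hence "intertwines g g' A A' id (\<lambda>_. \<one>)" using True by (simp add: intertwines_def)
    thus ?thesis by blast
  next
    case False
    then obtain x where x: "x \<in> A" by blast
    have "card {z \<in> A. cycle_tag g z = cycle_tag g x} \<noteq> 0" using fin x by auto
    hence "{z \<in> A'. cycle_tag g' z = cycle_tag g x} \<noteq> {}"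
      using cnt[of "cycle_tag g x"] by (metis card.empty)
    then obtain y where y: "y \<in> A'" "cycle_tag g' y = cycle_tag g x" by blast
    have xX: "x \<in> X" "y \<in> X" using x y st by (auto simp: stable_def)
    define Q where "Q = orbit (snd g) x"
    define Q' where "Q' = orbit (snd g') y"
    have self: "x \<in> Q" unfolding Q_def by (rule permutation_self_in_orbit[OF snd_permutation[OF g]])
    have Q: "Q \<subseteq> A"
    proof
      fix z assume "z \<in> Q" thus "z \<in> A" unfolding Q_def
        by induction (use x st in \<open>auto simp: stable_def\<close>)
    qed
    have Q': "Q' \<subseteq> A'"
    proof
      fix z assume "z \<in> Q'" thus "z \<in> A'" unfolding Q'_def
        by induction (use y st in \<open>auto simp: stable_def\<close>)
    qed
    have stQ: "stable g Q" using Q st by (auto simp: stable_def Q_def orbit.step)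
    have stD: "stable g (A - Q)" "stable g' (A' - Q')"
      using st permutation_in_orbit_iff[OF snd_permutation[OF g]] permutation_in_orbit_iff[OF snd_permutation[OF g']]
      by (auto simp: stable_def Q_def Q'_def)
    have cardQ: "card Q = card Q'" using y(2) by (simp add: cycle_tag_def Q_def Q'_def)
    have tagQ: "cycle_tag g z = cycle_tag g x" if "z \<in> Q" for z
      using that cycle_tag_orbit[OF g xX(1)] by (simp add: Q_def)
    have tagQ': "cycle_tag g' z = cycle_tag g x" if "z \<in> Q'" for z
      using that cycle_tag_orbit[OF g' xX(2)] y(2) by (simp add: Q'_def)
    have "\<exists>p \<psi>. intertwines g g' (A - Q) (A' - Q') p \<psi>"
    proof (rule less.hyps)
      show "card (A - Q) < card A" using fin x self by (intro psubset_card_mono) auto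
      fix \<tau>
      have "{z \<in> A - Q. cycle_tag g z = \<tau>} = {z \<in> A. cycle_tag g z = \<tau>} - {z \<in> Q. cycle_tag g z = \<tau>}" by auto
      moreover have "{z \<in> A' - Q'. cycle_tag g' z = \<tau>} = {z \<in> A'. cycle_tag g' z = \<tau>} - {z \<in> Q'. cycle_tag g' z = \<tau>}" by auto
      moreover have "card {z \<in> Q. cycle_tag g z = \<tau>} = card {z \<in> Q'. cycle_tag g' z = \<tau>}"
        using tagQ tagQ' cardQ by (cases "\<tau> = cycle_tag g x") (auto cong: conj_cong)
      moreover have "{z \<in> Q. cycle_tag g z = \<tau>} \<subseteq> {z \<in> A. cycle_tag g z = \<tau>}"
        "{z \<in> Q'. cycle_tag g' z = \<tau>} \<subseteq> {z \<in> A'. cycle_tag g' z = \<tau>}" using Q Q' by auto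
      moreover have "finite Q" "finite Q'" using Q Q' fin finite_subset by blast+
      ultimately show "card {z \<in> A - Q. cycle_tag g z = \<tau>} = card {z \<in> A' - Q'. cycle_tag g' z = \<tau>}"
        using cnt[of \<tau>] by (simp add: card_Diff_subset)
    qed (use fin stD in auto)
    then obtain p \<psi> where 1: "intertwines g g' (A - Q) (A' - Q') p \<psi>" by blast
    obtain q \<omega> where 2: "intertwines g g' Q Q' q \<omega>"
      using intertwines_orbit[OF g g' xX] y(2) unfolding Q_def Q'_def by metis
    have "(A - Q) \<union> Q = A" "(A' - Q') \<union> Q' = A'" using Q Q' by auto
    thus ?thesis using intertwines_Un[OF 1 2 _ _ stD(1) stQ] by auto
  qed
qed

lemma stable_wr_support: "g \<in> carrier W \<Longrightarrow> stable g (wr_support g)"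
  unfolding stable_def
proof safe
  fix z assume g: "g \<in> carrier W" and z: "z \<in> wr_support g"
  have "z \<in> X" using z by (simp add: wr_support_def)
  thus "snd g z \<in> wr_support g"
    using z cycle_tag_trivial_iff[OF g, of z] cycle_tag_trivial_iff[OF g, of "snd g z"] cycle_tag_step[OF g, of z] g by simp
qed (simp add: wr_support_def)

definition tag_points where
  "tag_points g \<tau> = {x \<in> X. cycle_tag g x = \<tau>}"

lemma tag_points_subset_support:
  assumes "g \<in> carrier W" "\<tau> \<noteq> ({\<one>}, 1)"
  shows "tag_points g \<tau> \<subseteq> wr_support g"
  using assms cycle_tag_trivial_iff[OF assms(1)] by (auto simp: tag_points_def)

text \<open>The trivial tag belongs to all but finitely many points of \<open>X\<close>, where
  \<open>card\<close> may carry no information, so the count is made inside the union Y of the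
  supports. There the trivial tag has card Y minus card of the support many points, and the two
  supports have equal size because the other tags exhaust them. Outside Y the conjugating element is
  the identity.\<close>

lemma conj_if_equal_tag_counts:
  assumes g: "g \<in> carrier W" and g': "g' \<in> carrier W"
    and cnt: "\<And>\<tau>. \<tau> \<noteq> ({\<one>}, 1) \<Longrightarrow> card (tag_points g \<tau>) = card (tag_points g' \<tau>)"
  shows "g' \<in> conj_class W g"
proof -
  define Y where "Y = wr_support g \<union> wr_support g'"
  have finY: "finite Y" using g g' by (simp add: Y_def finite_wr_support)
  have YX: "Y \<subseteq> X" by (auto simp: Y_def wr_support_def)
  have fixed: "snd g z = z" "fst g z = \<one>" "snd g' z = z" "fst g' z = \<one>" if "z \<in> X - Y" for z
    using that by (auto simp: Y_def wr_support_def)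
  have "stable g Y" unfolding stable_def
  proof (intro conjI ballI YX)
    fix z assume z: "z \<in> Y"
    show "snd g z \<in> Y"
    proof (cases "z \<in> wr_support g")
      case True thus ?thesis using stable_wr_support[OF g] by (auto simp: stable_def Y_def)
    next
      case False thus ?thesis using z YX by (auto simp: wr_support_def)
    qed
  qed
  moreover have "stable g' Y" unfolding stable_def
  proof (intro conjI ballI YX)
    fix z assume z: "z \<in> Y"
    show "snd g' z \<in> Y"
    proof (cases "z \<in> wr_support g'")
      case True thus ?thesis using stable_wr_support[OF g'] by (auto simp: stable_def Y_def)
    next
      case False thus ?thesis using z YX by (auto simp: wr_support_def)
    qed
  qed
  moreover have "card {z \<in> Y. cycle_tag g z = \<tau>} = card {z \<in> Y. cycle_tag g' z = \<tau>}" for \<tau>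
  proof (cases "\<tau> = ({\<one>}, 1)")
    case False
    have "{z \<in> Y. cycle_tag g z = \<tau>} = tag_points g \<tau>" "{z \<in> Y. cycle_tag g' z = \<tau>} = tag_points g' \<tau>"
      using tag_points_subset_support[OF g False] tag_points_subset_support[OF g' False] YX
      by (auto simp: tag_points_def Y_def)
    thus ?thesis using cnt[OF False] by simp
  next
    case True
    define T where "T = cycle_tag g ` wr_support g \<union> cycle_tag g' ` wr_support g'"
    have finT: "finite T" using g g' by (simp add: T_def finite_wr_support)
    have nT: "({\<one>}, 1) \<notin> T"
    proof -
      have "cycle_tag k x \<noteq> ({\<one>}, 1)" if "k \<in> carrier W" "x \<in> wr_support k" for k x
        using cycle_tag_trivial_iff[OF that(1), of x] that(2) wr_support_def by blast
      from this[OF g] this[OF g'] show ?thesis unfolding T_def by fastforce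
    qed
    have decomp: "card (wr_support k) = (\<Sum>\<tau>\<in>T. card (tag_points k \<tau>))"
      if k: "k \<in> carrier W" "cycle_tag k ` wr_support k \<subseteq> T" for k
    proof -
      have "wr_support k = (\<Union>\<tau>\<in>T. tag_points k \<tau>)"
      proof
        show "wr_support k \<subseteq> (\<Union>\<tau>\<in>T. tag_points k \<tau>)"
          using k(2) by (auto simp: tag_points_def wr_support_def)
        show "(\<Union>\<tau>\<in>T. tag_points k \<tau>) \<subseteq> wr_support k"
        proof (rule UN_least)
          fix \<sigma> assume "\<sigma> \<in> T"
          hence "\<sigma> \<noteq> ({\<one>}, 1)" using nT by blast
          thus "tag_points k \<sigma> \<subseteq> wr_support k" by (rule tag_points_subset_support[OF k(1)])
        qed
      qed
      moreover have "finite (tag_points k \<tau>)" if "\<tau> \<in> T" for \<tau>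
      proof (rule finite_subset[OF tag_points_subset_support[OF k(1)] finite_wr_support[OF k(1)]])
        show "\<tau> \<noteq> ({\<one>}, 1)" using that nT by blast
      qed
      ultimately show ?thesis using finT
        by (simp only:) (intro card_UN_disjoint, auto simp: tag_points_def)
    qed
    have "card (wr_support g) = card (wr_support g')"
    proof -
      have T: "cycle_tag g ` wr_support g \<subseteq> T" "cycle_tag g' ` wr_support g' \<subseteq> T"
        unfolding T_def by (rule Un_upper1, rule Un_upper2)
      have "card (wr_support g) = (\<Sum>\<tau>\<in>T. card (tag_points g \<tau>))" by (rule decomp[OF g T(1)])
      also have "\<dots> = (\<Sum>\<tau>\<in>T. card (tag_points g' \<tau>))"
      proof (rule sum.cong[OF refl])
        fix \<sigma> assume "\<sigma> \<in> T"
        hence "\<sigma> \<noteq> ({\<one>}, 1)" using nT by blast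
        thus "card (tag_points g \<sigma>) = card (tag_points g' \<sigma>)" by (rule cnt)
      qed
      also have "\<dots> = card (wr_support g')" by (rule decomp[OF g' T(2), symmetric])
      finally show ?thesis .
    qed
    moreover have "{z \<in> Y. cycle_tag k z = \<tau>} = Y - wr_support k" if "k \<in> carrier W" for k
    proof -
      have "cycle_tag k z = \<tau> \<longleftrightarrow> z \<notin> wr_support k" if "z \<in> Y" for z
        unfolding True by (rule cycle_tag_trivial_iff[OF \<open>k \<in> carrier W\<close> subsetD[OF YX that]])
      thus ?thesis by blast
    qed
    moreover have "card (Y - wr_support k) = card Y - card (wr_support k)" if "k = g \<or> k = g'" for k
      using that finY g g' by (intro card_Diff_subset finite_wr_support) (auto simp: Y_def)
    ultimately show ?thesis using g g' by (simp only: simp_thms)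
  qed
  ultimately obtain p \<psi> where I: "intertwines g g' Y Y p \<psi>"
    using intertwines_equal_tag_counts[OF g g' finY finY] by blast
  define h where "h = (\<lambda>x\<in>X. if x \<in> Y then \<psi> x else \<one>, \<lambda>x. if x \<in> Y then p x else x)"
  have bij: "bij_betw p Y Y" using I by (simp add: intertwines_def)
  have perm: "(\<lambda>x. if x \<in> Y then p x else x) permutes Y"
    using bij by (intro bij_imp_permutes) (auto intro: bij_betw_cong[THEN iffD1])
  have hW: "h \<in> carrier W"
    unfolding carrier_wreath_iff
  proof (intro conjI)
    show "fst h \<in> X \<rightarrow>\<^sub>E carrier H" using I by (auto simp: h_def intertwines_def)
    show "finite {x \<in> X. fst h x \<noteq> \<one>}" by (rule finite_subset[OF _ finY]) (auto simp: h_def)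
    show "snd h permutes X" using permutes_subset[OF perm YX] by (simp add: h_def)
    show "finite {x. snd h x \<noteq> x}" by (rule finite_subset[OF _ finY]) (auto simp: h_def)
  qed
  have pY: "p z \<in> Y" "snd g z \<in> Y" if "z \<in> Y" for z
    using that bij \<open>stable g Y\<close> by (auto simp: bij_betw_def stable_def)
  have s: "snd h (snd g z) = snd g' (snd h z)" if "z \<in> X" for z
    using that I pY[of z] fixed[of z] by (cases "z \<in> Y") (auto simp: h_def intertwines_def)
  have f: "fst g' (snd g' (snd h z)) \<otimes> fst h (snd h z) = fst h (snd h (snd g z)) \<otimes> fst g (snd g z)" if "z \<in> X" for z
    using that I pY[of z] pY(1)[of "snd g z"] fixed[of z] YX by (cases "z \<in> Y") (auto simp: h_def intertwines_def)
  have eq: "g' \<otimes>\<^bsub>W\<^esub> h = h \<otimes>\<^bsub>W\<^esub> g"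
  proof (rule wreath_eqI)
    fix x assume x: "x \<in> X"
    show "snd (g' \<otimes>\<^bsub>W\<^esub> h) x = snd (h \<otimes>\<^bsub>W\<^esub> g) x" using s[OF x] by (simp add: snd_mult_wreath)
    define z where "z = inv_into UNIV (snd g) (inv_into UNIV (snd h) x)"
    have z: "z \<in> X" using x g hW by (simp add: z_def)
    have x_eq: "x = snd h (snd g z)" using g hW by (simp add: z_def)
    have "fst (g' \<otimes>\<^bsub>W\<^esub> h) x = fst g' (snd g' (snd h z)) \<otimes> fst h (snd h z)"
      using x g' unfolding x_eq by (simp add: fst_mult_wreath s[OF z])
    moreover have "fst (h \<otimes>\<^bsub>W\<^esub> g) x = fst h (snd h (snd g z)) \<otimes> fst g (snd g z)"
      using x hW unfolding x_eq by (simp add: fst_mult_wreath)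
    ultimately show "fst (g' \<otimes>\<^bsub>W\<^esub> h) x = fst (h \<otimes>\<^bsub>W\<^esub> g) x" using f[OF z] by simp
  qed (use g g' hW in auto)
  hence "g' = h \<otimes>\<^bsub>W\<^esub> g \<otimes>\<^bsub>W\<^esub> inv\<^bsub>W\<^esub> h"
    using g g' hW by (metis W.inv_solve_right W.m_closed)
  thus ?thesis unfolding conj_class_def using hW by blast
qed

lemma tag_points_conj:
  assumes g: "g \<in> carrier W" and g': "g' \<in> conj_class W g"
  shows "card (tag_points g' \<tau>) = card (tag_points g \<tau>)"
proof -
  obtain h where h: "h \<in> carrier W" "g' = h \<otimes>\<^bsub>W\<^esub> g \<otimes>\<^bsub>W\<^esub> inv\<^bsub>W\<^esub> h" using g' by (auto simp: conj_class_def)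
  have g'W: "g' \<in> carrier W" using g h by simp
  have eq: "g' \<otimes>\<^bsub>W\<^esub> h = h \<otimes>\<^bsub>W\<^esub> g" using g h by (simp add: W.m_assoc)
  have "tag_points g' \<tau> = snd h ` tag_points g \<tau>"
  proof safe
    fix y assume y: "y \<in> tag_points g' \<tau>"
    have "cycle_tag g' (snd h (inv_into UNIV (snd h) y)) = cycle_tag g (inv_into UNIV (snd h) y)"
      using y h(1) by (intro cycle_tag_conjugate g g'W eq) (auto simp: tag_points_def)
    thus "y \<in> snd h ` tag_points g \<tau>"
      using y h(1) by (intro image_eqI[of _ _ "inv_into UNIV (snd h) y"]) (auto simp: tag_points_def)
  next
    fix x assume "x \<in> tag_points g \<tau>"
    thus "snd h x \<in> tag_points g' \<tau>"
      using cycle_tag_conjugate[OF g g'W h(1) eq] h(1) by (auto simp: tag_points_def)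
  qed
  thus ?thesis using permutes_inj_on[OF snd_permutes[OF h(1)]] by (simp add: card_image)
qed


section \<open>Cycle types and their weights\<close>

definition cycle_type :: "('x \<Rightarrow> 'h) \<times> ('x \<Rightarrow> 'x) \<Rightarrow> 'h set \<times> nat \<Rightarrow> nat" where
  "cycle_type g \<tau> = (if \<tau> = ({\<one>}, 1) then 0 else card (orbit (snd g) ` tag_points g \<tau>))"

definition tag_weight :: "'h set \<times> nat \<Rightarrow> nat" where
  "tag_weight \<tau> = (if fst \<tau> = {\<one>} then snd \<tau> - 1 else snd \<tau>)"

definition wr_weight where
  "wr_weight g = (\<Sum>\<tau> | cycle_type g \<tau> \<noteq> 0. tag_weight \<tau> * cycle_type g \<tau>)"

lemma orbit_eq_if_in:
  assumes "g \<in> carrier W" "z \<in> orbit (snd g) x"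
  shows "orbit (snd g) z = orbit (snd g) x"
  using orbit_cyclic_eq3[OF cyclic_on_orbit'[OF snd_permutation[OF assms(1)]] assms(2)] .

lemma self_in_orbit: "g \<in> carrier W \<Longrightarrow> x \<in> orbit (snd g) x"
  by (rule permutation_self_in_orbit[OF snd_permutation])

lemma Union_orbits_stable:
  assumes "g \<in> carrier W" "stable g A"
  shows "\<Union> (orbit (snd g) ` A) = A"
proof -
  have "orbit (snd g) x \<subseteq> A" if "x \<in> A" for x
  proof
    fix z assume "z \<in> orbit (snd g) x"
    thus "z \<in> A" by induction (use that assms in \<open>auto simp: stable_def\<close>)
  qed
  thus ?thesis using self_in_orbit[OF assms(1)] by blast
qed

lemma stable_tag_points: "g \<in> carrier W \<Longrightarrow> stable g (tag_points g \<tau>)"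
  by (auto simp: stable_def tag_points_def cycle_tag_step)

lemma finite_tag_points: "g \<in> carrier W \<Longrightarrow> \<tau> \<noteq> ({\<one>}, 1) \<Longrightarrow> finite (tag_points g \<tau>)"
  by (rule finite_subset[OF tag_points_subset_support finite_wr_support])

lemma card_tag_points:
  assumes g: "g \<in> carrier W" and \<tau>: "\<tau> \<noteq> ({\<one>}, 1)"
  shows "card (tag_points g \<tau>) = snd \<tau> * cycle_type g \<tau>"
proof -
  have "snd \<tau> * card (orbit (snd g) ` tag_points g \<tau>) = card (\<Union> (orbit (snd g) ` tag_points g \<tau>))"
  proof (rule card_partition)
    show "finite (orbit (snd g) ` tag_points g \<tau>)" using finite_tag_points[OF g \<tau>] by simp
    show "finite (\<Union> (orbit (snd g) ` tag_points g \<tau>))"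
      unfolding Union_orbits_stable[OF g stable_tag_points[OF g]] by (rule finite_tag_points[OF g \<tau>])
    show "card c = snd \<tau>" if "c \<in> orbit (snd g) ` tag_points g \<tau>" for c
      using that by (auto simp: tag_points_def cycle_tag_def)
    show "c1 \<inter> c2 = {}" if "c1 \<in> orbit (snd g) ` tag_points g \<tau>" "c2 \<in> orbit (snd g) ` tag_points g \<tau>" "c1 \<noteq> c2" for c1 c2
      using that orbit_eq_if_in[OF g] by blast
  qed
  thus ?thesis using \<tau> by (simp add: Union_orbits_stable[OF g stable_tag_points[OF g]] cycle_type_def)
qed

lemma tag_points_empty_if_snd_0:
  assumes "g \<in> carrier W" "snd \<tau> = 0"
  shows "tag_points g \<tau> = {}"
proof (rule ccontr)
  assume "tag_points g \<tau> \<noteq> {}"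
  then obtain x where "snd \<tau> = card (orbit (snd g) x)" by (auto simp: tag_points_def cycle_tag_def)
  thus False using permutation_orbit_card(1)[OF snd_permutation[OF assms(1)], of x] assms(2) by simp
qed

text \<open>Point counts and cycle counts determine each other by \<open>card_tag_points\<close>,
  except for tags of length 0, which no point has.\<close>

lemma conj_class_wreath_eq_iff:
  assumes g: "g \<in> carrier W" and g': "g' \<in> carrier W"
  shows "conj_class W g = conj_class W g' \<longleftrightarrow> cycle_type g = cycle_type g'"
proof
  assume "conj_class W g = conj_class W g'"
  hence "g' \<in> conj_class W g" using W.in_own_conj_class[OF g'] by simp
  note eq = tag_points_conj[OF g this]
  show "cycle_type g = cycle_type g'"
  proof
    fix \<tau>
    show "cycle_type g \<tau> = cycle_type g' \<tau>"
    proof (cases "\<tau> = ({\<one>}, 1) \<or> snd \<tau> = 0")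
      case True
      thus ?thesis using tag_points_empty_if_snd_0[OF g, of \<tau>] tag_points_empty_if_snd_0[OF g', of \<tau>] by (auto simp: cycle_type_def)
    next
      case False
      thus ?thesis using card_tag_points[OF g, of \<tau>] card_tag_points[OF g', of \<tau>] eq[of \<tau>] by simp
    qed
  qed
next
  assume "cycle_type g = cycle_type g'"
  hence "g' \<in> conj_class W g"
    using card_tag_points[OF g] card_tag_points[OF g'] by (intro conj_if_equal_tag_counts[OF g g']) simp
  thus "conj_class W g = conj_class W g'" using W.conj_class_eq_iff[OF g g'] by simp
qed

lemma tag_points_nonempty_if_cycle_type:
  assumes "cycle_type g \<tau> \<noteq> 0"
  shows "tag_points g \<tau> \<noteq> {}" "\<tau> \<noteq> ({\<one>}, 1)"
  using assms by (auto simp: cycle_type_def split: if_splits)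

lemma finite_cycle_type_support:
  assumes "g \<in> carrier W"
  shows "finite {\<tau>. cycle_type g \<tau> \<noteq> 0}"
proof (rule finite_subset)
  show "{\<tau>. cycle_type g \<tau> \<noteq> 0} \<subseteq> cycle_tag g ` wr_support g"
  proof
    fix \<tau> assume "\<tau> \<in> {\<tau>. cycle_type g \<tau> \<noteq> 0}"
    hence "tag_points g \<tau> \<noteq> {}" "\<tau> \<noteq> ({\<one>}, 1)" using tag_points_nonempty_if_cycle_type by auto
    then obtain x where "x \<in> tag_points g \<tau>" by blast
    moreover from this have "x \<in> wr_support g" using tag_points_subset_support[OF assms \<open>\<tau> \<noteq> _\<close>] by blast
    ultimately show "\<tau> \<in> cycle_tag g ` wr_support g" by (auto simp: tag_points_def)
  qed
qed (use assms finite_wr_support in auto)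

text \<open>In contrast to \<open>cycle_type\<close>, fixed points with trivial label count here as
  long as they lie in \<open>A\<close>. This lets \<open>A\<close> be any finite invariant set
  around the support, as a word on \<open>A\<close> requires.\<close>

definition trivial_orbits where
  "trivial_orbits g A = orbit (snd g) ` {x \<in> A. fst (cycle_tag g x) = {\<one>}}"

text \<open>Every cycle contributes its length, minus one precisely if its holonomy is trivial.\<close>

lemma wr_weight_add_trivial_orbits:
  assumes g: "g \<in> carrier W" and fin: "finite A" and st: "stable g A" and supp: "wr_support g \<subseteq> A"
  shows "wr_weight g + card (trivial_orbits g A) = card A"
proof -
  define \<O> where "\<O> = orbit (snd g) ` A"
  have AX: "A \<subseteq> X" using st by (simp add: stable_def)
  define otag where "otag = (\<lambda>Q. cycle_tag g (SOME x. x \<in> Q))"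
  have otag: "otag (orbit (snd g) x) = cycle_tag g x" if "x \<in> X" for x
  proof -
    have "(SOME y. y \<in> orbit (snd g) x) \<in> orbit (snd g) x"
      using self_in_orbit[OF g, of x] by (rule someI)
    thus ?thesis unfolding otag_def by (rule cycle_tag_orbit[OF g that])
  qed
  have finO: "finite \<O>" using fin by (simp add: \<O>_def)
  have "card (\<Union> \<O>) = (\<Sum>Q\<in>\<O>. card Q)"
  proof (rule card_Union_disjoint)
    show "pairwise disjnt \<O>"
      unfolding pairwise_def disjnt_def \<O>_def using orbit_eq_if_in[OF g] by blast
    show "finite Q" if "Q \<in> \<O>" for Q
      using that Union_orbits_stable[OF g st] fin finite_subset[of Q A] unfolding \<O>_def by blast
  qed
  hence "card A = (\<Sum>Q\<in>\<O>. card Q)" unfolding \<O>_def Union_orbits_stable[OF g st] .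
  also have "\<dots> = (\<Sum>Q\<in>\<O>. tag_weight (otag Q) + (if fst (otag Q) = {\<one>} then 1 else 0))"
  proof (rule sum.cong[OF refl])
    fix Q assume "Q \<in> \<O>"
    then obtain x where x: "x \<in> X" "Q = orbit (snd g) x" using AX by (auto simp: \<O>_def)
    thus "card Q = tag_weight (otag Q) + (if fst (otag Q) = {\<one>} then 1 else 0)"
      using otag[OF x(1)] permutation_orbit_card(1)[OF snd_permutation[OF g], of x]
      by (simp add: tag_weight_def cycle_tag_def)
  qed
  also have "\<dots> = (\<Sum>Q\<in>\<O>. tag_weight (otag Q)) + card {Q \<in> \<O>. fst (otag Q) = {\<one>}}"
    using finO by (simp add: sum.distrib sum.If_cases Int_def)
  also have "{Q \<in> \<O>. fst (otag Q) = {\<one>}} = trivial_orbits g A"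
    unfolding \<O>_def trivial_orbits_def using otag AX by auto
  also have "(\<Sum>Q\<in>\<O>. tag_weight (otag Q)) = (\<Sum>\<tau>\<in>otag ` \<O>. \<Sum>Q | Q \<in> \<O> \<and> otag Q = \<tau>. tag_weight (otag Q))"
    by (rule sum.image_gen[OF finO])
  also have "\<dots> = (\<Sum>\<tau>\<in>otag ` \<O>. tag_weight \<tau> * cycle_type g \<tau>)"
  proof (rule sum.cong[OF refl])
    fix \<tau>
    have eq: "{Q \<in> \<O>. otag Q = \<tau>} = orbit (snd g) ` tag_points g \<tau>" if "\<tau> \<noteq> ({\<one>}, 1)"
    proof -
      have "tag_points g \<tau> = {x \<in> A. cycle_tag g x = \<tau>}"
        using tag_points_subset_support[OF g that] supp AX by (auto simp: tag_points_def)
      thus ?thesis unfolding \<O>_def using otag AX by auto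
    qed
    have "(\<Sum>Q | Q \<in> \<O> \<and> otag Q = \<tau>. tag_weight (otag Q)) = (\<Sum>Q | Q \<in> \<O> \<and> otag Q = \<tau>. tag_weight \<tau>)"
      by (intro sum.cong) auto
    also have "\<dots> = tag_weight \<tau> * card {Q \<in> \<O>. otag Q = \<tau>}" by simp
    \<comment> \<open>The trivial tag has weight 0, so it does not matter that
      \<open>cycle_type\<close> sets its count to 0.\<close>
    also have "\<dots> = tag_weight \<tau> * cycle_type g \<tau>"
      using eq by (cases "\<tau> = ({\<one>}, 1)") (auto simp: cycle_type_def tag_weight_def)
    finally show "(\<Sum>Q | Q \<in> \<O> \<and> otag Q = \<tau>. tag_weight (otag Q)) = tag_weight \<tau> * cycle_type g \<tau>" .
  qed
  also have "\<dots> = wr_weight g"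
    unfolding wr_weight_def
  proof (rule sum.mono_neutral_right)
    show "{\<tau>. cycle_type g \<tau> \<noteq> 0} \<subseteq> otag ` \<O>"
    proof
      fix \<tau> assume "\<tau> \<in> {\<tau>. cycle_type g \<tau> \<noteq> 0}"
      hence *: "tag_points g \<tau> \<noteq> {}" "\<tau> \<noteq> ({\<one>}, 1)" using tag_points_nonempty_if_cycle_type by auto
      then obtain x where x: "x \<in> tag_points g \<tau>" by blast
      hence "x \<in> A" using tag_points_subset_support[OF g *(2)] supp by blast
      hence "otag (orbit (snd g) x) = \<tau>" "orbit (snd g) x \<in> \<O>" using x otag by (auto simp: tag_points_def \<O>_def)
      thus "\<tau> \<in> otag ` \<O>" by blast
    qed
  qed (use finO in auto)
  finally show ?thesis by simp
qed

section \<open>The lower bound on the conjugacy length\<close>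

lemma wr_single_closed: "u \<in> X \<Longrightarrow> a \<in> carrier H \<Longrightarrow> wr_single H X u a \<in> carrier W"
proof -
  assume ua: "u \<in> X" "a \<in> carrier H"
  have "finite {x \<in> X. fst (wr_single H X u a) x \<noteq> \<one>}"
    by (rule finite_subset[of _ "{u}"]) (auto simp: wr_single_def)
  thus ?thesis using ua unfolding carrier_wreath_iff by (auto simp: wr_single_def permutes_id)
qed

lemma wr_transp_closed: "x \<in> X \<Longrightarrow> y \<in> X \<Longrightarrow> wr_transp H X x y \<in> carrier W"
proof -
  assume xy: "x \<in> X" "y \<in> X"
  have "finite {z. Transposition.transpose x y z \<noteq> z}"
    by (rule finite_subset[of _ "{x, y}"]) (auto simp: Transposition.transpose_def)
  thus ?thesis using xy permutes_swap_id[OF xy] by (simp add: carrier_wreath_iff wr_transp_def)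
qed

lemma inv_wr_single:
  assumes "u \<in> X" "a \<in> carrier H"
  shows "inv\<^bsub>W\<^esub> (wr_single H X u a) = wr_single H X u (inv a)"
proof (rule W.inv_equality)
  show "wr_single H X u (inv a) \<otimes>\<^bsub>W\<^esub> wr_single H X u a = \<one>\<^bsub>W\<^esub>"
    using assms by (auto simp: mult_wreath one_wreath wr_single_def)
qed (use assms wr_single_closed in auto)

lemma inv_wr_transp:
  assumes "x \<in> X" "y \<in> X"
  shows "inv\<^bsub>W\<^esub> (wr_transp H X x y) = wr_transp H X x y"
proof (rule W.inv_equality)
  have "Transposition.transpose x y z \<in> X" if "z \<in> X" for z using that assms by (auto simp: Transposition.transpose_def)
  thus "wr_transp H X x y \<otimes>\<^bsub>W\<^esub> wr_transp H X x y = \<one>\<^bsub>W\<^esub>"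
    by (auto simp: mult_wreath one_wreath wr_transp_def)
qed (use assms wr_transp_closed in auto)

definition letter_on where
  "letter_on A s \<longleftrightarrow> (\<exists>u\<in>A. \<exists>a\<in>carrier H. s = wr_single H X u a) \<or> (\<exists>x\<in>A. \<exists>y\<in>A. s = wr_transp H X x y)"

lemma letter_on_closed: "A \<subseteq> X \<Longrightarrow> letter_on A s \<Longrightarrow> s \<in> carrier W"
  unfolding letter_on_def using wr_single_closed wr_transp_closed by blast

lemma letter_on_mono: "letter_on A s \<Longrightarrow> A \<subseteq> B \<Longrightarrow> letter_on B s"
  unfolding letter_on_def by blast

text \<open>A block need not be a single orbit: multiplication by a transposition inside a block
  changes its cycles but leaves it invariant with trivial labels.\<close>

definition clean_blocks where
  "clean_blocks g A \<U> \<longleftrightarrow> finite \<U> \<and> pairwise disjnt \<U> \<and>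
     (\<forall>U\<in>\<U>. U \<noteq> {} \<and> U \<subseteq> A \<and> (\<forall>z\<in>U. snd g z \<in> U \<and> fst g z = \<one>))"

text \<open>Only the label at u changes, so only a block containing u is spoiled, and by
  disjointness there is at most one.\<close>

lemma clean_blocks_single:
  assumes A: "A \<subseteq> X" and g: "g \<in> carrier W" and u: "u \<in> A" and a: "a \<in> carrier H" and U: "clean_blocks g A \<U>"
  shows "\<exists>\<V>. clean_blocks (wr_single H X u a \<otimes>\<^bsub>W\<^esub> g) A \<V> \<and> card \<U> \<le> card \<V> + 1"
proof (intro exI conjI)
  define \<V> where "\<V> = {U \<in> \<U>. u \<notin> U}"
  have fin: "finite \<U>" using U by (simp add: clean_blocks_def)
  show "clean_blocks (wr_single H X u a \<otimes>\<^bsub>W\<^esub> g) A {U \<in> \<U>. u \<notin> U}"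
    unfolding clean_blocks_def
  proof (intro conjI ballI)
    show "finite {U \<in> \<U>. u \<notin> U}" using fin by simp
    show "pairwise disjnt {U \<in> \<U>. u \<notin> U}" using U by (auto simp: clean_blocks_def pairwise_def)
    fix U' assume U': "U' \<in> {U \<in> \<U>. u \<notin> U}"
    thus "U' \<noteq> {}" "U' \<subseteq> A" using U by (auto simp: clean_blocks_def)
    fix z assume z: "z \<in> U'"
    hence "z \<in> X" "z \<noteq> u" "snd g z \<in> U'" "fst g z = \<one>" using U' U A unfolding clean_blocks_def by blast+
    thus "snd (wr_single H X u a \<otimes>\<^bsub>W\<^esub> g) z \<in> U'" "fst (wr_single H X u a \<otimes>\<^bsub>W\<^esub> g) z = \<one>"
      by (auto simp: mult_wreath wr_single_def)
  qed
  have "card \<U> \<le> card ({U \<in> \<U>. u \<notin> U} \<union> {U \<in> \<U>. u \<in> U})" using fin by (intro card_mono) auto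
  also have "\<dots> \<le> card {U \<in> \<U>. u \<notin> U} + card {U \<in> \<U>. u \<in> U}" by (rule card_Un_le)
  also have "card {U \<in> \<U>. u \<in> U} \<le> 1"
  proof -
    have "U1 = U2" if "U1 \<in> \<U>" "U2 \<in> \<U>" "u \<in> U1" "u \<in> U2" for U1 U2
      using that U unfolding clean_blocks_def pairwise_def disjnt_iff by blast
    hence "\<forall>U1\<in>{U \<in> \<U>. u \<in> U}. \<forall>U2\<in>{U \<in> \<U>. u \<in> U}. U1 = U2" by simp
    moreover have "finite {U \<in> \<U>. u \<in> U}" using fin by simp
    ultimately show ?thesis unfolding One_nat_def by (simp only: card_le_Suc0_iff_eq)
  qed
  finally show "card \<U> \<le> card {U \<in> \<U>. u \<notin> U} + 1" by simp
qed

text \<open>Blocks that avoid x and y survive. If both points lie in blocks, these are replaced by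
  their union, which costs one block, or none if they are the same. Otherwise at most one block
  meets {x, y}, and it is dropped.\<close>

lemma clean_blocks_transp:
  assumes A: "A \<subseteq> X" and g: "g \<in> carrier W" and x: "x \<in> A" and y: "y \<in> A" and U: "clean_blocks g A \<U>"
  shows "\<exists>\<V>. clean_blocks (wr_transp H X x y \<otimes>\<^bsub>W\<^esub> g) A \<V> \<and> card \<U> \<le> card \<V> + 1"
proof -
  define h where "h = wr_transp H X x y \<otimes>\<^bsub>W\<^esub> g"
  define R where "R = {U \<in> \<U>. x \<notin> U \<and> y \<notin> U}"
  have fin: "finite \<U>" using U by (simp add: clean_blocks_def)
  have disj: "U1 = U2" if "U1 \<in> \<U>" "U2 \<in> \<U>" "z \<in> U1" "z \<in> U2" for U1 U2 z
    using that U by (auto simp: clean_blocks_def pairwise_def disjnt_iff)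
  have inX: "Transposition.transpose x y z \<in> X" if "z \<in> X" for z using that x y A by (auto simp: Transposition.transpose_def)
  have h: "snd h z = Transposition.transpose x y (snd g z)" for z by (simp add: h_def mult_wreath wr_transp_def)
  have h': "fst h z = fst g (Transposition.transpose x y z)" if "z \<in> X" "fst g (Transposition.transpose x y z) = \<one>" for z
    using that inX[of z] by (simp add: h_def mult_wreath wr_transp_def)
  have ok: "snd h z \<in> V \<and> fst h z = \<one>"
    if "z \<in> V" "V \<subseteq> A" "\<And>v. v \<in> V \<Longrightarrow> Transposition.transpose x y v \<in> V" "\<And>v. v \<in> V \<Longrightarrow> snd g v \<in> V \<and> fst g v = \<one>" for V z
    using that(1,2) that(3)[of z] that(3)[of "snd g z"] that(4)[of z] that(4)[of "Transposition.transpose x y z"] h[of z] h'[of z] A by auto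
  have cb: "U' \<noteq> {}" "U' \<subseteq> A" "\<And>v. v \<in> U' \<Longrightarrow> snd g v \<in> U' \<and> fst g v = \<one>" if "U' \<in> \<U>" for U'
    using that U unfolding clean_blocks_def by blast+
  have R_ok: "\<forall>V\<in>R. V \<noteq> {} \<and> V \<subseteq> A \<and> (\<forall>z\<in>V. snd h z \<in> V \<and> fst h z = \<one>)"
  proof (intro ballI conjI)
    fix V assume V: "V \<in> R"
    thus "V \<noteq> {}" "V \<subseteq> A" using cb by (auto simp: R_def)
    fix z assume "z \<in> V"
    have "Transposition.transpose x y v \<in> V" if "v \<in> V" for v using that V by (auto simp: R_def Transposition.transpose_def)
    from ok[OF \<open>z \<in> V\<close> \<open>V \<subseteq> A\<close> this] show "snd h z \<in> V" "fst h z = \<one>" using V cb by (auto simp: R_def)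
  qed
  have R_cb: "clean_blocks h A R"
    using R_ok fin U unfolding clean_blocks_def by (auto simp: R_def pairwise_def)
  show ?thesis
  proof (cases "\<exists>U1\<in>\<U>. \<exists>U2\<in>\<U>. x \<in> U1 \<and> y \<in> U2")
    case True
    then obtain U1 U2 where 12: "U1 \<in> \<U>" "U2 \<in> \<U>" "x \<in> U1" "y \<in> U2" by blast
    have UR: "\<U> = insert U1 (insert U2 R)" using 12 disj by (auto simp: R_def)
    have notin: "U1 \<union> U2 \<notin> R" using 12 by (auto simp: R_def)
    have "clean_blocks h A (insert (U1 \<union> U2) R)"
      unfolding clean_blocks_def
    proof (intro conjI ballI)
      show "finite (insert (U1 \<union> U2) R)" using fin by (simp add: R_def)
      have "disjnt V (U1 \<union> U2)" if "V \<in> R" for V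
        using that 12 disj by (auto simp: R_def disjnt_iff)
      thus "pairwise disjnt (insert (U1 \<union> U2) R)"
        using R_cb by (auto simp: pairwise_insert clean_blocks_def disjnt_sym)
      fix V assume V: "V \<in> insert (U1 \<union> U2) R"
      show "V \<noteq> {}" "V \<subseteq> A" using V cb(2)[OF 12(1)] cb(2)[OF 12(2)] 12 R_ok by auto
      fix z assume z: "z \<in> V"
      have "snd h z \<in> U1 \<union> U2 \<and> fst h z = \<one>" if "z \<in> U1 \<union> U2"
      proof (rule ok[OF that])
        show "U1 \<union> U2 \<subseteq> A" using cb(2) 12 by auto
        show "Transposition.transpose x y v \<in> U1 \<union> U2" if "v \<in> U1 \<union> U2" for v using that 12 by (auto simp: Transposition.transpose_def)
        show "snd g v \<in> U1 \<union> U2 \<and> fst g v = \<one>" if "v \<in> U1 \<union> U2" for v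
          using that cb(3)[OF 12(1)] cb(3)[OF 12(2)] by blast
      qed
      thus "snd h z \<in> V" "fst h z = \<one>" using V z R_ok by auto
    qed
    moreover have "card \<U> \<le> card (insert (U1 \<union> U2) R) + 1"
    proof -
      have "finite R" using fin by (simp add: R_def)
      hence "card (insert U1 (insert U2 R)) \<le> card R + 2"
        by (metis add_2_eq_Suc' card_insert_le_m1 card_insert_if le_SucI le_refl Suc_le_mono finite_insert)
      thus ?thesis using notin \<open>finite R\<close> by (simp add: UR[symmetric])
    qed
    ultimately show ?thesis unfolding h_def by blast
  next
    case False
    define T where "T = {U \<in> \<U>. x \<in> U \<or> y \<in> U}"
    have "card T \<le> 1"
    proof -
      have "\<forall>U1\<in>T. \<forall>U2\<in>T. U1 = U2"
      proof (intro ballI)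
        fix U1 U2 assume T12: "U1 \<in> T" "U2 \<in> T"
        hence U12: "U1 \<in> \<U>" "U2 \<in> \<U>" by (simp_all add: T_def)
        have "\<not> (x \<in> U1 \<and> y \<in> U2)" "\<not> (x \<in> U2 \<and> y \<in> U1)" using False U12 by blast+
        hence "x \<in> U1 \<and> x \<in> U2 \<or> y \<in> U1 \<and> y \<in> U2" using T12 by (auto simp: T_def)
        thus "U1 = U2" using disj[OF U12] by blast
      qed
      moreover have "finite T" using fin by (simp add: T_def)
      ultimately show ?thesis unfolding One_nat_def by (simp only: card_le_Suc0_iff_eq)
    qed
    moreover have "\<U> = R \<union> T" by (auto simp: R_def T_def)
    hence "card \<U> \<le> card R + card T" using card_Un_le[of R T] by simp
    ultimately have "card \<U> \<le> card R + 1" by linarith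
    thus ?thesis using R_cb unfolding h_def by blast
  qed
qed

text \<open>The empty word has the singletons of \<open>A\<close> as blocks. A further letter
  multiplies on the left and costs at most one block.\<close>

lemma word_clean_blocks:
  assumes A: "A \<subseteq> X" "finite A" and ss: "\<And>s. s \<in> set ss \<Longrightarrow> letter_on A s"
  defines "g \<equiv> wprod ss"
  shows "g \<in> carrier W" "wr_support g \<subseteq> A" "\<exists>\<U>. clean_blocks g A \<U> \<and> card A \<le> card \<U> + length ss"
proof -
  have "wprod ss \<in> carrier W \<and> wr_support (wprod ss) \<subseteq> A \<and>
    (\<exists>\<U>. clean_blocks (wprod ss) A \<U> \<and> card A \<le> card \<U> + length ss)"
    using ss
  proof (induction ss)
    case Nil
    have "clean_blocks \<one>\<^bsub>W\<^esub> A ((\<lambda>x. {x}) ` A)"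
      using A by (auto simp: clean_blocks_def one_wreath pairwise_def)
    moreover have "card ((\<lambda>x. {x}) ` A) = card A" by (simp add: card_image)
    moreover have "wr_support \<one>\<^bsub>W\<^esub> \<subseteq> A" by (auto simp: wr_support_def one_wreath)
    ultimately show ?case using one_wreath_closed by force
  next
    case (Cons s ss)
    define k where "k = wprod ss"
    have IH: "k \<in> carrier W" "wr_support k \<subseteq> A" "\<exists>\<U>. clean_blocks k A \<U> \<and> card A \<le> card \<U> + length ss"
      using Cons unfolding k_def by auto
    then obtain \<U> where U: "clean_blocks k A \<U>" "card A \<le> card \<U> + length ss" by blast
    have s: "letter_on A s" using Cons.prems by simp
    have sW: "s \<in> carrier W" by (rule letter_on_closed[OF A(1) s])
    have s_out: "snd s x = x" "fst s x = \<one>" if "x \<in> X - A" for x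
      using s that A(1) by (auto simp: letter_on_def wr_single_def wr_transp_def Transposition.transpose_def)
    have k_out: "snd k x = x" "fst k x = \<one>" if "x \<in> X - A" for x
      using IH(2) that by (auto simp: wr_support_def)
    have inv_out: "inv_into UNIV (snd s) x = x" if "x \<in> X - A" for x
      using s_out(1)[OF that] inv_snd_snd[OF sW, of x] by simp
    have "wr_support (s \<otimes>\<^bsub>W\<^esub> k) \<subseteq> A"
    proof (rule ccontr)
      assume "\<not> wr_support (s \<otimes>\<^bsub>W\<^esub> k) \<subseteq> A"
      then obtain x where x: "x \<in> wr_support (s \<otimes>\<^bsub>W\<^esub> k)" "x \<in> X - A" by (auto simp: wr_support_def)
      thus False
        using s_out[OF x(2)] k_out[OF x(2)] inv_out[OF x(2)] by (auto simp: wr_support_def mult_wreath)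
    qed
    moreover have "\<exists>\<V>. clean_blocks (s \<otimes>\<^bsub>W\<^esub> k) A \<V> \<and> card \<U> \<le> card \<V> + 1"
      using s clean_blocks_single[OF A(1) IH(1) _ _ U(1)] clean_blocks_transp[OF A(1) IH(1) _ _ U(1)]
      unfolding letter_on_def by blast
    ultimately show ?case using U(2) sW IH(1) by (auto simp: k_def[symmetric])
  qed
  thus "g \<in> carrier W" "wr_support g \<subseteq> A" "\<exists>\<U>. clean_blocks g A \<U> \<and> card A \<le> card \<U> + length ss"
    unfolding g_def by blast+
qed

text \<open>The orbit of a point of a block stays inside it and meets only trivial labels, so its
  holonomy is trivial. Disjoint blocks yield different orbits.\<close>

lemma card_clean_blocks_le:
  assumes g: "g \<in> carrier W" and A: "A \<subseteq> X" "finite A" and U: "clean_blocks g A \<U>"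
  shows "card \<U> \<le> card (trivial_orbits g A)"
proof (rule card_inj_on_le)
  define b where "b = (\<lambda>U. SOME z. z \<in> U :: 'x)"
  have b: "b V \<in> V" if "V \<in> \<U>" for V
    using that U unfolding b_def clean_blocks_def by (metis some_in_eq)
  have orb: "orbit (snd g) (b V) \<subseteq> V" if "V \<in> \<U>" for V
  proof
    fix z assume "z \<in> orbit (snd g) (b V)"
    thus "z \<in> V" by induction (use that b[OF that] U in \<open>auto simp: clean_blocks_def\<close>)
  qed
  show "inj_on (\<lambda>V. orbit (snd g) (b V)) \<U>"
  proof (rule inj_onI)
    fix V1 V2 assume V: "V1 \<in> \<U>" "V2 \<in> \<U>" "orbit (snd g) (b V1) = orbit (snd g) (b V2)"
    hence "b V1 \<in> V1 \<inter> V2" using orb[OF V(1)] orb[OF V(2)] self_in_orbit[OF g, of "b V1"] by blast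
    thus "V1 = V2" using U V by (auto simp: clean_blocks_def pairwise_def disjnt_def)
  qed
  show "(\<lambda>V. orbit (snd g) (b V)) ` \<U> \<subseteq> trivial_orbits g A"
  proof safe
    fix V assume V: "V \<in> \<U>"
    have bA: "b V \<in> A" using b[OF V] V U by (auto simp: clean_blocks_def)
    have pow: "(snd g ^^ n) (b V) \<in> V" for n
      by (induction n) (use b[OF V] V U in \<open>auto simp: clean_blocks_def\<close>)
    have "holonomy g (b V) n = \<one>" for n
    proof (induction n)
      case (Suc n)
      have "fst g ((snd g ^^ Suc n) (b V)) = \<one>" using pow[of "Suc n"] V U by (auto simp: clean_blocks_def)
      thus ?case using Suc by (simp del: funpow.simps)
    qed simp
    hence "fst (cycle_tag g (b V)) = {\<one>}" by (simp add: cycle_tag_def conj_class_eq_one_iff)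
    thus "orbit (snd g) (b V) \<in> trivial_orbits g A" using bA by (auto simp: trivial_orbits_def)
  qed
  show "finite (trivial_orbits g A)" using A by (simp add: trivial_orbits_def)
qed

lemma stable_if_support_subset:
  assumes g: "g \<in> carrier W" and "A \<subseteq> X" "wr_support g \<subseteq> A"
  shows "stable g A"
  unfolding stable_def
proof (intro conjI ballI assms)
  fix z assume "z \<in> A"
  thus "snd g z \<in> A"
    using assms stable_wr_support[OF g] by (cases "z \<in> wr_support g") (auto simp: stable_def wr_support_def)
qed

text \<open>Take a finite \<open>A\<close> that contains all points named by the letters. Then card
  A is at most the number of blocks plus the length, the blocks are at most the trivial orbits, and
  weight plus trivial orbits is card A; the size of \<open>A\<close> cancels.\<close>

lemma wr_weight_le_length:
  assumes ss: "\<And>s. s \<in> set ss \<Longrightarrow> letter_on X s"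
  defines "g \<equiv> wprod ss"
  shows "wr_weight g \<le> length ss"
proof -
  have "\<exists>A. finite A \<and> A \<subseteq> X \<and> (\<forall>s\<in>set ss. letter_on A s)" using ss
  proof (induction ss)
    case (Cons s ss)
    then obtain A where A: "finite A" "A \<subseteq> X" "\<forall>s\<in>set ss. letter_on A s" by auto
    have "\<exists>B. finite B \<and> B \<subseteq> X \<and> letter_on B s"
    proof -
      have "letter_on X s" using Cons.prems by simp
      then consider u a where "u \<in> X" "a \<in> carrier H" "s = wr_single H X u a"
        | x y where "x \<in> X" "y \<in> X" "s = wr_transp H X x y" unfolding letter_on_def by blast
      thus ?thesis
      proof cases
        case 1 thus ?thesis by (intro exI[of _ "{u}"]) (auto simp: letter_on_def)
      next
        case 2 thus ?thesis by (intro exI[of _ "{x, y}"]) (auto simp: letter_on_def)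
      qed
    qed
    then obtain B where B: "finite B" "B \<subseteq> X" "letter_on B s" by blast
    show ?case using A B letter_on_mono[of A _ "A \<union> B"] letter_on_mono[of B _ "A \<union> B"]
      by (intro exI[of _ "A \<union> B"]) auto
  qed auto
  then obtain A where A: "finite A" "A \<subseteq> X" "\<And>s. s \<in> set ss \<Longrightarrow> letter_on A s" by blast
  note word = word_clean_blocks[OF A(2,1,3), where ss = ss, folded g_def]
  then obtain \<U> where U: "clean_blocks g A \<U>" "card A \<le> card \<U> + length ss" by blast
  have "card \<U> \<le> card (trivial_orbits g A)" by (rule card_clean_blocks_le[OF word(1) A(2,1) U(1)])
  moreover have "wr_weight g + card (trivial_orbits g A) = card A"
    by (rule wr_weight_add_trivial_orbits[OF word(1) A(1) stable_if_support_subset[OF word(1) A(2) word(2)] word(2)])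
  ultimately show ?thesis using U(2) by linarith
qed

end

section \<open>Short words for every cycle type\<close>

text \<open>Composing with the transposition of u and v on the right splices the fixed point v into
  the cycle directly after u.\<close>

lemma cyclic_on_extend:
  assumes f: "f permutes V" "cyclic_on f V" and u: "u \<in> V" and v: "v \<notin> V"
  shows "f \<circ> Transposition.transpose u v permutes insert v V" "cyclic_on (f \<circ> Transposition.transpose u v) (insert v V)"
proof -
  define h where "h = f \<circ> Transposition.transpose u v"
  have fv: "f v = v" using permutes_not_in[OF f(1) v] .
  have hu: "h u = v" and hv: "h v = f u" using fv by (auto simp: h_def)
  have h: "h z = f z" if "z \<noteq> u" "z \<noteq> v" for z using that by (simp add: h_def Transposition.transpose_def)
  have perm: "h permutes insert v V"
    unfolding h_def using u f(1) by (intro permutes_compose permutes_swap_id) (auto intro: permutes_subset)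
  thus "f \<circ> Transposition.transpose u v permutes insert v V" by (simp add: h_def)
  have V: "z \<in> orbit h v" if "z \<in> V" for z
  proof -
    have "z \<in> orbit f u" using f(2) u that by (simp add: orbit_cyclic_eq3)
    thus ?thesis
    proof induction
      case base
      show ?case unfolding hv[symmetric] by (rule orbit.base)
    next
      case (step y)
      have "y \<in> V" using step.hyps f(2) u by (simp add: orbit_cyclic_eq3)
      show ?case
      proof (cases "y = u")
        case True thus ?thesis unfolding True hv[symmetric] by (simp add: orbit.base)
      next
        case False
        hence "h y = f y" using h \<open>y \<in> V\<close> v by blast
        thus ?thesis using orbit.step[OF step.IH] by simp
      qed
    qed
  qed
  have "v \<in> orbit h v" using orbit.step[OF V[OF u]] hu by simp
  hence "insert v V = orbit h v"
    using V permutes_orbit_subset[OF perm, of v] by blast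
  thus "cyclic_on (f \<circ> Transposition.transpose u v) (insert v V)"
    unfolding h_def[symmetric] by (intro cyclic_on_singleI[of v]) auto
qed

lemma (in monoid) foldr_mult_one:
  assumes "set ts \<subseteq> carrier G" "a \<in> carrier G"
  shows "foldr (\<otimes>) ts a = foldr (\<otimes>) ts \<one> \<otimes> a" "foldr (\<otimes>) ts \<one> \<in> carrier G"
proof -
  have "foldr (\<otimes>) ts a = foldr (\<otimes>) ts \<one> \<otimes> a \<and> foldr (\<otimes>) ts \<one> \<in> carrier G"
    using assms by (induction ts) (auto simp: m_assoc)
  thus "foldr (\<otimes>) ts a = foldr (\<otimes>) ts \<one> \<otimes> a" "foldr (\<otimes>) ts \<one> \<in> carrier G" by auto
qed

lemma (in monoid) foldr_concat:
  assumes "\<And>i. i \<in> set is \<Longrightarrow> set (w i) \<subseteq> carrier G"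
  shows "foldr (\<otimes>) (concat (map w is)) \<one> = foldr (\<otimes>) (map (\<lambda>i. foldr (\<otimes>) (w i) \<one>) is) \<one>
    \<and> foldr (\<otimes>) (concat (map w is)) \<one> \<in> carrier G"
  using assms
proof (induction "is")
  case (Cons i "is")
  hence IH: "foldr (\<otimes>) (concat (map w is)) \<one> = foldr (\<otimes>) (map (\<lambda>i. foldr (\<otimes>) (w i) \<one>) is) \<one>"
    "foldr (\<otimes>) (concat (map w is)) \<one> \<in> carrier G" by auto
  have wi: "set (w i) \<subseteq> carrier G" using Cons.prems by simp
  show ?case using foldr_mult_one[OF wi IH(2)] foldr_mult_one(2)[OF wi one_closed] IH by simp
qed simp

lemma rtrancl_leaves_set:
  assumes "(x, y) \<in> r\<^sup>*" "x \<in> A" "y \<notin> A"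
  shows "\<exists>u v. (u, v) \<in> r \<and> u \<in> A \<and> v \<notin> A"
  using assms by (induction) auto

section \<open>Words for single cycles and for products of disjoint cycles\<close>

context fin_wreath
begin

text \<open>A vertex set V' is grown from x one vertex at a time: connectivity yields an edge
  leaving V', and its transposition, appended to the word, splices the new vertex into the
  cycle.\<close>

lemma connected_cycle_word:
  assumes V: "finite V" "V \<subseteq> X" "graph_tree V E" and E: "E \<subseteq> transp_graph_edges H X SX" and x: "x \<in> V"
  shows "\<exists>ts f. length ts = card V - 1 \<and> set ts \<subseteq> SX \<inter> carrier W \<and> wprod ts = (\<lambda>x\<in>X. \<one>, f) \<and>
    f permutes V \<and> cyclic_on f V"
proof -
  have con: "(y, z) \<in> {(u, v). {u, v} \<in> E}\<^sup>*" if "y \<in> V" "z \<in> V" for y z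
    using that V(3) by (auto simp: graph_tree_def graph_connected_def)
  have edge: "u \<in> V \<and> v \<in> V \<and> wr_transp H X u v \<in> SX" if "{u, v} \<in> E" for u v
  proof -
    have "{u, v} \<subseteq> V" using that V(3) by (auto simp: graph_tree_def simple_graph_def)
    moreover have "{u, v} \<in> transp_graph_edges H X SX" using that E by blast
    then obtain a b where "{u, v} = {a, b}" "wr_transp H X a b \<in> SX"
      unfolding transp_graph_edges_def by blast
    moreover have "wr_transp H X a b = wr_transp H X b a" by (simp add: wr_transp_def transpose_commute)
    ultimately show ?thesis by (auto simp: doubleton_eq_iff)
  qed
  have "\<exists>V' ts f. V' \<subseteq> V \<and> x \<in> V' \<and> card V' = Suc j \<and> length ts = j \<and> set ts \<subseteq> SX \<inter> carrier W \<and>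
      wprod ts = (\<lambda>x\<in>X. \<one>, f) \<and> f permutes V' \<and> cyclic_on f V'" if "j < card V" for j
    using that
  proof (induction j)
    case 0
    have cyc: "cyclic_on id {x}" by (rule cyclic_on_singleI[of x]) (auto simp: orbit_eq_singleton_iff[THEN iffD2])
    show ?case using x permutes_id[of "{x}"] cyc cyc[unfolded id_def]
      by (intro exI[of _ "{x}"] exI[of _ "[]"] exI[of _ id]) (auto simp: one_wreath)
  next
    case (Suc j)
    have "j < card V" using Suc.prems by simp
    from Suc.IH[OF this] obtain V' ts f where IH: "V' \<subseteq> V" "x \<in> V'" "card V' = Suc j" "length ts = j" "set ts \<subseteq> SX \<inter> carrier W"
      "wprod ts = (\<lambda>x\<in>X. \<one>, f)" "f permutes V'" "cyclic_on f V'" by blast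
    have "V' \<noteq> V" using IH(3) Suc.prems by auto
    then obtain y where "y \<in> V" "y \<notin> V'" using IH(1) by blast
    then obtain u v where uv: "{u, v} \<in> E" "u \<in> V'" "v \<notin> V'"
      using rtrancl_leaves_set[OF con[of x y] IH(2)] x by auto
    note e = edge[OF uv(1)]
    have tW: "wr_transp H X u v \<in> carrier W" using e V(2) by (intro wr_transp_closed) auto
    have gW: "(\<lambda>x\<in>X. \<one>, f) \<in> carrier W" unfolding IH(6)[symmetric] using IH(5) by (intro W.foldr_mult_one) auto
    have "wprod (ts @ [wr_transp H X u v]) = (\<lambda>x\<in>X. \<one>, f) \<otimes>\<^bsub>W\<^esub> wr_transp H X u v"
      using W.foldr_mult_one(1)[of ts "wr_transp H X u v"] IH(5,6) tW by simp
    also have "\<dots> = (\<lambda>x\<in>X. \<one>, f \<circ> Transposition.transpose u v)"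
      using inv_snd_in[OF gW] by (auto simp: mult_wreath wr_transp_def)
    finally have w: "wprod (ts @ [wr_transp H X u v]) = (\<lambda>x\<in>X. \<one>, f \<circ> Transposition.transpose u v)" .
    have "finite V'" using IH(1) V(1) finite_subset by blast
    hence "card (insert v V') = Suc (Suc j)" using IH(3) uv(3) by simp
    moreover define k where "k = f \<circ> Transposition.transpose u v"
    ultimately show ?case using w IH(1-5) e tW cyclic_on_extend[OF IH(7,8) uv(2,3)] unfolding k_def[symmetric]
      by (intro exI[of _ "insert v V'"] exI[of _ "ts @ [wr_transp H X u v]"] exI[of _ k]) auto
  qed
  note steps = this
  have "card V > 0" using x V(1) by (auto simp: card_gt_0_iff)
  hence "card V - 1 < card V" by simp
  from steps[OF this] obtain V' ts f where *: "V' \<subseteq> V" "card V' = Suc (card V - 1)" "length ts = card V - 1"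
    "set ts \<subseteq> SX \<inter> carrier W" "wprod ts = (\<lambda>x\<in>X. \<one>, f)" "f permutes V'" "cyclic_on f V'" by blast
  hence "card V' = card V" using \<open>card V > 0\<close> by simp
  hence "V' = V" using * V(1) by (intro card_subset_eq) auto
  thus ?thesis using * by blast
qed

definition block_elem where
  "block_elem g V \<tau> \<longleftrightarrow> g \<in> carrier W \<and> V \<subseteq> X \<and> snd g permutes V \<and> cyclic_on (snd g) V \<and>
     (\<forall>z\<in>X - V. fst g z = \<one>) \<and> (\<forall>z\<in>V. cycle_tag g z = \<tau>)"

text \<open>A nontrivial class costs just one more letter, the label a at x. For a = 1 that letter
  is omitted, which is the saving of 1 in \<open>tag_weight\<close>.\<close>

lemma block_word:
  assumes V: "finite V" "V \<subseteq> X" "graph_tree V E" and E: "E \<subseteq> transp_graph_edges H X SX" and x: "x \<in> V"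
    and single: "\<And>a. a \<in> carrier H - {\<one>} \<Longrightarrow> wr_single H X x a \<in> SH"
    and \<tau>: "fst \<tau> = conj_class H a" "a \<in> carrier H" "snd \<tau> = card V"
  shows "\<exists>ss. length ss = tag_weight \<tau> \<and> set ss \<subseteq> (SH \<union> SX) \<inter> carrier W \<and> block_elem (wprod ss) V \<tau>"
proof -
  obtain ts f where ts: "length ts = card V - 1" "set ts \<subseteq> SX \<inter> carrier W" "wprod ts = (\<lambda>x\<in>X. \<one>, f)"
    "f permutes V" "cyclic_on f V" using connected_cycle_word[OF V E x] by blast
  define ss where "ss = (if a = \<one> then ts else wr_single H X x a # ts)"
  define g where "g = (\<lambda>z\<in>X. if z = x then a else \<one>, f)"
  have xX: "x \<in> X" using x V by auto
  have sW: "wr_single H X x a \<in> carrier W" using xX \<tau> by (intro wr_single_closed)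
  have prod: "wprod ss = g"
    using \<tau>(2) ts(3) by (auto simp: ss_def g_def mult_wreath wr_single_def)
  have sub: "set ss \<subseteq> (SH \<union> SX) \<inter> carrier W" using ts(2) single[of a] sW \<tau>(2) by (auto simp: ss_def)
  have gW: "g \<in> carrier W" unfolding prod[symmetric] using sub by (intro W.foldr_mult_one) auto
  have cardV: "card V > 0" using x V(1) by (auto simp: card_gt_0_iff)
  have len: "length ss = tag_weight \<tau>"
    using ts(1) cardV \<tau> by (auto simp: ss_def tag_weight_def conj_class_eq_one_iff)
  have orb: "orbit f x = V" using ts(5) x by (rule orbit_cyclic_eq3)
  note P = permutation_orbit_card[OF snd_permutation[OF gW], of x]
  have sg: "snd g = f" by (simp add: g_def)
  \<comment> \<open>The label at \<open>x\<close> is read only in the last step, on the return to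
    \<open>x\<close>.\<close>
  have hol1: "holonomy g x n = \<one>" if "n < card V" for n
    using that
  proof (induction n)
    case (Suc n)
    have "(f ^^ Suc n) x \<noteq> (f ^^ 0) x"
      using P(3) Suc.prems unfolding sg orb inj_on_def by (metis lessThan_iff Zero_not_Suc cardV)
    hence "(f ^^ Suc n) x \<noteq> x" by simp
    moreover have "(f ^^ Suc n) x \<in> X" using snd_pow_in[OF gW, of "Suc n" x] xX by (simp add: sg del: funpow.simps)
    ultimately have "fst g ((f ^^ Suc n) x) = \<one>" by (simp add: g_def del: funpow.simps)
    thus ?case using Suc by (simp add: sg del: funpow.simps)
  qed simp
  have "holonomy g x (card V) = a"
  proof -
    obtain n where n: "card V = Suc n" using cardV gr0_conv_Suc by auto
    have "(f ^^ Suc n) x = x" using P(2) unfolding sg orb n .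
    thus ?thesis using hol1[of n] n \<tau>(2) xX by (simp add: sg del: funpow.simps) (simp add: g_def)
  qed
  hence "cycle_tag g x = \<tau>" using \<tau> by (intro prod_eqI) (simp_all add: cycle_tag_def sg orb)
  hence "cycle_tag g z = \<tau>" if "z \<in> V" for z
    using cycle_tag_orbit[OF gW xX, of z] that by (simp add: sg orb)
  hence "block_elem g V \<tau>"
    unfolding block_elem_def using gW V(2) ts(4,5) x by (auto simp: sg) (auto simp: g_def)
  thus ?thesis using len sub prod by blast
qed

lemma cycle_tag_cong:
  assumes g: "g \<in> carrier W" and agree: "\<And>y. y \<in> orbit (snd g) z \<Longrightarrow> snd G y = snd g y \<and> fst G y = fst g y"
  shows "cycle_tag G z = cycle_tag g z" "orbit (snd G) z = orbit (snd g) z"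
proof -
  show orb: "orbit (snd G) z = orbit (snd g) z"
    using self_in_orbit[OF g, of z] agree by (intro orbit_cong) auto
  have pow: "(snd G ^^ n) z = (snd g ^^ n) z \<and> (snd g ^^ n) z \<in> orbit (snd g) z" for n
    by (induction n) (use self_in_orbit[OF g, of z] agree in \<open>auto intro: orbit.step\<close>)
  have "holonomy G z n = holonomy g z n" for n
    by (induction n) (use pow agree in \<open>simp_all del: funpow.simps\<close>)
  thus "cycle_tag G z = cycle_tag g z" by (simp add: cycle_tag_def orb)
qed

text \<open>Each factor is trivial outside its own set, so disjoint factors do not disturb one
  another. \<open>sorted_wrt\<close> with a symmetric relation expresses pairwise disjointness by
  position in the list.\<close>

lemma blocks_product:
  assumes "\<And>g V \<tau>. (g, V, \<tau>) \<in> set bs \<Longrightarrow> block_elem g V \<tau>"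
    and "sorted_wrt (\<lambda>b b'. fst (snd b) \<inter> fst (snd b') = {}) bs"
  defines "G \<equiv> wprod (map fst bs)"
  shows "G \<in> carrier W"
    "\<And>g V \<tau> z. (g, V, \<tau>) \<in> set bs \<Longrightarrow> z \<in> V \<Longrightarrow> snd G z = snd g z \<and> fst G z = fst g z"
    "\<And>z. z \<in> X \<Longrightarrow> (\<And>g V \<tau>. (g, V, \<tau>) \<in> set bs \<Longrightarrow> z \<notin> V) \<Longrightarrow> snd G z = z \<and> fst G z = \<one>"
proof -
  have "G \<in> carrier W \<and> (\<forall>(g, V, \<tau>)\<in>set bs. \<forall>z\<in>V. snd G z = snd g z \<and> fst G z = fst g z) \<and>
    (\<forall>z\<in>X. (\<forall>(g, V, \<tau>)\<in>set bs. z \<notin> V) \<longrightarrow> snd G z = z \<and> fst G z = \<one>)"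
    using assms(1,2) unfolding G_def
  proof (induction bs)
    case Nil
    show ?case using one_wreath_closed by (auto simp: one_wreath)
  next
    case (Cons b bs)
    obtain g V \<tau> where b: "b = (g, V, \<tau>)" by (cases b)
    define K where "K = wprod (map fst bs)"
    have bl: "block_elem g V \<tau>" using Cons.prems b by auto
    have bls: "block_elem g' V' \<tau>'" if "(g', V', \<tau>') \<in> set bs" for g' V' \<tau>' using that Cons.prems by auto
    have disj: "V \<inter> V' = {}" if "(g', V', \<tau>') \<in> set bs" for g' V' \<tau>'
      using Cons.prems(2) that b by fastforce
    have IH: "K \<in> carrier W" "\<And>g' V' \<tau>' z. (g', V', \<tau>') \<in> set bs \<Longrightarrow> z \<in> V' \<Longrightarrow> snd K z = snd g' z \<and> fst K z = fst g' z"
      "\<And>z. z \<in> X \<Longrightarrow> (\<And>g' V' \<tau>'. (g', V', \<tau>') \<in> set bs \<Longrightarrow> z \<notin> V') \<Longrightarrow> snd K z = z \<and> fst K z = \<one>"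
      using Cons unfolding K_def by fastforce+
    have gW: "g \<in> carrier W" and VX: "V \<subseteq> X" and gV: "snd g permutes V" and g1: "\<And>z. z \<in> X - V \<Longrightarrow> fst g z = \<one>"
      using bl by (auto simp: block_elem_def)
    have g_out: "snd g z = z" "inv_into UNIV (snd g) z = z" if "z \<notin> V" for z
      using that permutes_not_in[OF gV] permutes_not_in[OF permutes_inv[OF gV]] by auto
    have K_V: "snd K z = z \<and> fst K z = \<one>" if "z \<in> V" for z
    proof (rule IH(3))
      show "z \<in> X" using that VX by blast
      show "z \<notin> V'" if "(g', V', \<tau>') \<in> set bs" for g' V' \<tau>' using disj[OF that] \<open>z \<in> V\<close> by blast
    qed
    have mult: "wprod (map fst (b # bs)) = g \<otimes>\<^bsub>W\<^esub> K" by (simp add: b K_def)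
    have 1: "snd (g \<otimes>\<^bsub>W\<^esub> K) z = snd g z \<and> fst (g \<otimes>\<^bsub>W\<^esub> K) z = fst g z" if z: "z \<in> V" for z
    proof -
      have "inv_into UNIV (snd g) z \<in> V" using z permutes_in_image[OF permutes_inv[OF gV]] by blast
      thus ?thesis using K_V[OF z] K_V[of "inv_into UNIV (snd g) z"] z VX gW by (auto simp: mult_wreath)
    qed
    have 2: "snd (g \<otimes>\<^bsub>W\<^esub> K) z = snd K z \<and> fst (g \<otimes>\<^bsub>W\<^esub> K) z = fst K z" if z: "z \<in> X" "z \<notin> V" "snd K z \<notin> V" for z
      using z g_out[of z] g_out[of "snd K z"] g1[of z] IH(1) by (auto simp: mult_wreath)
    have 3: "snd (g \<otimes>\<^bsub>W\<^esub> K) z = snd g' z \<and> fst (g \<otimes>\<^bsub>W\<^esub> K) z = fst g' z" if m: "(g', V', \<tau>') \<in> set bs" and z: "z \<in> V'" for g' V' \<tau>' z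
    proof -
      have "V' \<subseteq> X" "snd g' z \<in> V'" using bls[OF m] z by (auto simp: block_elem_def permutes_in_image)
      hence "z \<in> X" "z \<notin> V" "snd K z \<notin> V" using disj[OF m] IH(2)[OF m z] z by auto
      from 2[OF this] IH(2)[OF m z] show ?thesis by simp
    qed
    have 4: "snd (g \<otimes>\<^bsub>W\<^esub> K) z = z \<and> fst (g \<otimes>\<^bsub>W\<^esub> K) z = \<one>"
      if z: "z \<in> X" "z \<notin> V" "\<And>g' V' \<tau>'. (g', V', \<tau>') \<in> set bs \<Longrightarrow> z \<notin> V'" for z
      using 2[OF z(1,2)] IH(3)[OF z(1,3)] z(2) by simp
    show ?case unfolding mult using W.m_closed[OF gW IH(1)] 1 3 4 b by fastforce
  qed
  thus "G \<in> carrier W"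
    "\<And>g V \<tau> z. (g, V, \<tau>) \<in> set bs \<Longrightarrow> z \<in> V \<Longrightarrow> snd G z = snd g z \<and> fst G z = fst g z"
    "\<And>z. z \<in> X \<Longrightarrow> (\<And>g V \<tau>. (g, V, \<tau>) \<in> set bs \<Longrightarrow> z \<notin> V) \<Longrightarrow> snd G z = z \<and> fst G z = \<one>"
    by fastforce+
qed

text \<open>Each block set is a single orbit of the product and keeps the tag of its block. These
  sets are nonempty and disjoint, hence distinct, so counting list entries is counting
  orbits.\<close>

lemma blocks_product_cycle_type:
  assumes bl: "\<And>g V \<tau>. (g, V, \<tau>) \<in> set bs \<Longrightarrow> block_elem g V \<tau>"
    and disj: "sorted_wrt (\<lambda>b b'. fst (snd b) \<inter> fst (snd b') = {}) bs" and \<tau>: "\<tau> \<noteq> ({\<one>}, 1)"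
  shows "cycle_type (wprod (map fst bs)) \<tau> = count (mset (map (\<lambda>b. snd (snd b)) bs)) \<tau>"
proof -
  define G where "G = wprod (map fst bs)"
  have GW: "G \<in> carrier W"
    unfolding G_def by (rule blocks_product(1)[OF _ disj]) (rule bl)
  have in_block: "snd G z = snd g z \<and> fst G z = fst g z" if "(g, V, \<sigma>) \<in> set bs" "z \<in> V" for g V \<sigma> z
    unfolding G_def by (rule blocks_product(2)[OF _ disj that]) (rule bl)
  have outside: "snd G z = z \<and> fst G z = \<one>" if "z \<in> X" "\<And>g V \<sigma>. (g, V, \<sigma>) \<in> set bs \<Longrightarrow> z \<notin> V" for z
    unfolding G_def by (rule blocks_product(3)[OF _ disj that(1)]) (use bl that(2) in blast)+
  have orb_tag: "orbit (snd G) z = V \<and> cycle_tag G z = \<sigma>" if m: "(g, V, \<sigma>) \<in> set bs" and z: "z \<in> V" for g V \<sigma> z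
  proof -
    have "g \<in> carrier W" and cyc: "cyclic_on (snd g) V" and "cycle_tag g z = \<sigma>"
      using bl[OF m] z by (auto simp: block_elem_def)
    have orb: "orbit (snd g) z = V" by (rule orbit_cyclic_eq3[OF cyc z])
    have agree: "snd G y = snd g y \<and> fst G y = fst g y" if "y \<in> orbit (snd g) z" for y
      using in_block[OF m] that orb by simp
    have "cycle_tag G z = cycle_tag g z" "orbit (snd G) z = orbit (snd g) z"
      by (rule cycle_tag_cong[OF \<open>g \<in> carrier W\<close>], erule agree)+
    thus ?thesis using orb \<open>cycle_tag g z = \<sigma>\<close> by simp
  qed
  have ne: "V \<noteq> {}" if "(g, V, \<sigma>) \<in> set bs" for g V \<sigma>
    using bl[OF that] by (auto simp: block_elem_def cyclic_on_def)
  have ne': "fst (snd b) \<noteq> {}" if "b \<in> set bs" for b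
    using ne[of "fst b" "fst (snd b)" "snd (snd b)"] that by simp
  define L where "L = map (\<lambda>b. fst (snd b)) (filter (\<lambda>b. snd (snd b) = \<tau>) bs)"
  have "orbit (snd G) ` tag_points G \<tau> = set L"
  proof safe
    fix z assume z: "z \<in> tag_points G \<tau>"
    hence "z \<in> wr_support G" using tag_points_subset_support[OF GW \<tau>] by blast
    then obtain g V \<sigma> where m: "(g, V, \<sigma>) \<in> set bs" "z \<in> V"
      using outside[of z] unfolding wr_support_def by blast
    have "\<sigma> = \<tau>" using orb_tag[OF m] z by (auto simp: tag_points_def)
    thus "orbit (snd G) z \<in> set L" unfolding L_def using m orb_tag[OF m] by force
  next
    fix V assume "V \<in> set L"
    then obtain g where m: "(g, V, \<tau>) \<in> set bs" by (auto simp: L_def)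
    then obtain z where z: "z \<in> V" using ne by blast
    have "z \<in> X" using bl[OF m] z by (auto simp: block_elem_def)
    thus "V \<in> orbit (snd G) ` tag_points G \<tau>"
      using orb_tag[OF m z] by (intro image_eqI[of _ _ z]) (auto simp: tag_points_def)
  qed
  moreover have "distinct L"
  proof -
    have "distinct (map (\<lambda>b. fst (snd b)) bs)"
      using disj ne'
    proof (induction bs)
      case (Cons b bs)
      have "fst (snd b) \<noteq> {}" using Cons.prems(2)[of b] by simp
      moreover have "fst (snd b) \<inter> fst (snd b') = {}" if "b' \<in> set bs" for b' using Cons.prems(1) that by simp
      ultimately have "fst (snd b) \<notin> (\<lambda>b. fst (snd b)) ` set bs" by fastforce
      moreover have "distinct (map (\<lambda>b. fst (snd b)) bs)"
        using Cons.prems by (intro Cons.IH) auto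
      ultimately show ?case by simp
    qed simp
    thus ?thesis unfolding L_def by (rule distinct_map_filter)
  qed
  ultimately have "cycle_type G \<tau> = length (filter (\<lambda>b. snd (snd b) = \<tau>) bs)"
    using \<tau> by (simp add: cycle_type_def distinct_card) (simp add: L_def)
  also have "\<dots> = count (mset (map (\<lambda>b. snd (snd b)) bs)) \<tau>"
    by (induction bs) auto
  finally show ?thesis by (simp add: G_def)
qed

section \<open>Cycle types as weighted configurations\<close>

definition tags :: "('h set \<times> nat) set" where
  "tags = conj_class H ` carrier H \<times> {0<..} - {({\<one>}, 1)}"

lemma cycle_type_in_configs:
  assumes g: "g \<in> carrier W"
  shows "cycle_type g \<in> configs tags tag_weight (wr_weight g)"
proof -
  have "\<tau> \<in> tags" if "cycle_type g \<tau> \<noteq> 0" for \<tau>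
  proof -
    from tag_points_nonempty_if_cycle_type[OF that] obtain x where x: "x \<in> X" "\<tau> = cycle_tag g x" and "\<tau> \<noteq> ({\<one>}, 1)"
      by (auto simp: tag_points_def)
    thus ?thesis using g permutation_orbit_card(1)[OF snd_permutation[OF g], of x]
      by (auto simp: tags_def cycle_tag_def)
  qed
  thus ?thesis using finite_cycle_type_support[OF g] by (auto simp: configs_def wr_weight_def)
qed

text \<open>The configuration is listed with multiplicity in order of decreasing length, so that the
  lengths form a partition and \<open>PCwr\<close> provides one tree per entry. The concatenated
  words of the trees have the total weight as their length and, the trees being disjoint, realise
  all tags together.\<close>

lemma config_realizable:
  assumes S: "PCwr H X S" and c: "c \<in> configs tags tag_weight n"
  shows "\<exists>ss. set ss \<subseteq> S \<and> length ss = n \<and> wprod ss \<in> carrier W \<and>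
    cycle_type (wprod ss) = c"
proof -
  have c_tags: "\<tau> \<in> tags" if "c \<tau> \<noteq> 0" for \<tau> using that c by (auto simp: configs_def)
  have fin: "finite {\<tau>. c \<tau> > 0}" using c by (simp add: configs_def)
  obtain js0 where js0: "mset js0 = Abs_multiset c" using ex_mset by blast
  define js where "js = rev (sort_key snd js0)"
  have cnt: "count (mset js) = c" using js0 count_Abs_multiset[OF fin] by (simp add: js_def)
  have js_tags: "\<tau> \<in> tags" if "\<tau> \<in> set js" for \<tau>
    using c_tags[of \<tau>] that unfolding cnt[symmetric] by (simp add: count_eq_zero_iff)
  obtain SH SX where SHX: "S = SH \<union> SX"
    and forest: "\<And>L ps. is_partition ps L \<Longrightarrow> (\<exists>V E. (\<forall>i < length ps.
                      graph_tree (V i) (E i) \<and> V i \<subseteq> X \<and> E i \<subseteq> transp_graph_edges H X SX \<and>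
                      finite (V i) \<and> card (V i) = ps ! i \<and>
                      (\<exists>x \<in> V i. \<forall>a \<in> carrier H - {\<one>}. wr_single H X x a \<in> SH)) \<and>
                  disjoint_family_on V {..<length ps})"
    using S unfolding PCwr_def by blast
  have "is_partition (map snd js) (sum_list (map snd js))"
    unfolding is_partition_def
  proof (intro conjI)
    have "sorted (map snd (sort_key snd js0))" by simp
    thus "sorted_wrt (\<ge>) (map snd js)" by (simp add: js_def rev_map[symmetric] sorted_wrt_rev)
    show "0 \<notin> set (map snd js)" by (auto dest!: js_tags simp: tags_def)
  qed simp
  from forest[OF this] obtain V E where VE: "\<And>i. i < length js \<Longrightarrow> graph_tree (V i) (E i) \<and> V i \<subseteq> X \<and>
      E i \<subseteq> transp_graph_edges H X SX \<and> finite (V i) \<and> card (V i) = snd (js ! i) \<and>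
      (\<exists>x \<in> V i. \<forall>a \<in> carrier H - {\<one>}. wr_single H X x a \<in> SH)"
    and disj: "disjoint_family_on V {..<length js}" by auto
  have "\<exists>ss. length ss = tag_weight (js ! i) \<and> set ss \<subseteq> S \<inter> carrier W \<and> block_elem (wprod ss) (V i) (js ! i)"
    if i: "i < length js" for i
  proof -
    obtain x where x: "x \<in> V i" "\<And>a. a \<in> carrier H - {\<one>} \<Longrightarrow> wr_single H X x a \<in> SH" using VE[OF i] by blast
    obtain a where a: "a \<in> carrier H" "fst (js ! i) = conj_class H a" using js_tags[of "js ! i"] i by (auto simp: tags_def)
    show ?thesis unfolding SHX
      using VE[OF i] x a by (intro block_word[of "V i" "E i" SX x SH "js ! i" a]) auto
  qed
  then obtain w where w: "\<And>i. i < length js \<Longrightarrow> length (w i) = tag_weight (js ! i) \<and> set (w i) \<subseteq> S \<inter> carrier W \<and>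
      block_elem (wprod (w i)) (V i) (js ! i)" by metis
  define ss where "ss = concat (map w [0..<length js])"
  define bs where "bs = map (\<lambda>i. (wprod (w i), V i, js ! i)) [0..<length js]"
  have prod: "wprod ss = wprod (map fst bs)" "wprod ss \<in> carrier W"
    using W.foldr_concat[of "[0..<length js]" w] w unfolding ss_def bs_def by (auto simp: o_def)
  have bl: "block_elem g U \<tau>" if "(g, U, \<tau>) \<in> set bs" for g U \<tau>
    using that w by (auto simp: bs_def)
  have sorted: "sorted_wrt (\<lambda>b b'. fst (snd b) \<inter> fst (snd b') = {}) bs"
    unfolding sorted_wrt_iff_nth_less bs_def using disj by (auto simp: disjoint_family_on_def)
  have tags_bs: "map (\<lambda>b. snd (snd b)) bs = js" by (simp add: bs_def o_def map_nth)
  have "cycle_type (wprod ss) = c"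
  proof
    fix \<tau>
    show "cycle_type (wprod ss) \<tau> = c \<tau>"
    proof (cases "\<tau> = ({\<one>}, 1)")
      case True
      thus ?thesis using c_tags[of \<tau>] by (auto simp: cycle_type_def tags_def)
    next
      case False
      have "cycle_type (wprod (map fst bs)) \<tau> = count (mset (map (\<lambda>b. snd (snd b)) bs)) \<tau>"
        by (rule blocks_product_cycle_type[OF _ sorted False]) (rule bl)
      thus ?thesis unfolding prod(1) tags_bs cnt .
    qed
  qed
  moreover have "length ss = n"
  proof -
    have "length ss = (\<Sum>i<length js. tag_weight (js ! i))"
      using w by (simp add: ss_def length_concat o_def interv_sum_list_conv_sum_set_nat atLeast0LessThan)
    also have "\<dots> = sum_list (map tag_weight js)"
      by (simp add: sum_list_sum_nth atLeast0LessThan)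
    also have "\<dots> = (\<Sum>\<tau>\<in>set js. count_list js \<tau> * tag_weight \<tau>)" by (rule sum_list_map_eq_sum_count)
    also have "\<dots> = (\<Sum>\<tau> | c \<tau> \<noteq> 0. tag_weight \<tau> * c \<tau>)"
    proof (rule sum.cong)
      show "set js = {\<tau>. c \<tau> \<noteq> 0}" unfolding cnt[symmetric] by (simp add: count_eq_zero_iff)
      show "count_list js \<tau> * tag_weight \<tau> = tag_weight \<tau> * c \<tau>" for \<tau>
        unfolding cnt[symmetric] by (simp add: count_mset)
    qed
    also have "\<dots> = n" using c by (simp add: configs_def)
    finally show ?thesis .
  qed
  moreover have "set ss \<subseteq> S" using w by (fastforce simp: ss_def)
  ultimately show ?thesis using prod(2) by blast
qed

end

section \<open>The conjugacy growth series\<close>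

context fin_wreath
begin

lemma PCwr_letters:
  assumes "PCwr H X S" "s \<in> S \<union> m_inv W ` S"
  shows "letter_on X s"
proof -
  have S: "S \<subseteq> wr_singles H X \<union> wr_transps H X" using assms(1) unfolding PCwr_def by blast
  have "letter_on X s \<and> letter_on X (inv\<^bsub>W\<^esub> s)" if s: "s \<in> S" for s
  proof -
    consider u a where "u \<in> X" "a \<in> carrier H" "s = wr_single H X u a"
      | x y where "x \<in> X" "y \<in> X" "s = wr_transp H X x y"
      using S s unfolding wr_singles_def wr_transps_def by blast
    thus ?thesis
    proof cases
      case 1
      thus ?thesis using inv_closed[of a] by (auto simp: letter_on_def inv_wr_single simp del: inv_closed)
    next
      case 2
      thus ?thesis by (auto simp: letter_on_def inv_wr_transp)
    qed
  qed
  thus ?thesis using assms(2) by blast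
qed

lemma wr_weight_cong: "cycle_type g = cycle_type h \<Longrightarrow> wr_weight g = wr_weight h"
  by (simp add: wr_weight_def)

text \<open>Guarantees that the \<open>LEAST\<close> in \<open>word_length\<close> is taken over a
  nonempty set; otherwise it would be unspecified.\<close>

lemma generate_word:
  assumes "S \<subseteq> carrier W" "h \<in> generate W S"
  shows "\<exists>ss. set ss \<subseteq> S \<union> m_inv W ` S \<and> h = wprod ss"
  using assms(2)
proof induction
  case one
  show ?case by (intro exI[of _ "[]"]) simp
next
  case (incl h)
  thus ?case using assms(1) by (intro exI[of _ "[h]"]) auto
next
  case (inv h)
  hence "inv\<^bsub>W\<^esub> h \<in> carrier W" using assms(1) by auto
  thus ?case using inv by (intro exI[of _ "[inv\<^bsub>W\<^esub> h]"]) auto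
next
  case (eng h1 h2)
  then obtain ss1 ss2 where ss: "set ss1 \<subseteq> S \<union> m_inv W ` S" "h1 = wprod ss1"
    "set ss2 \<subseteq> S \<union> m_inv W ` S" "h2 = wprod ss2" by blast
  have "S \<union> m_inv W ` S \<subseteq> carrier W" using assms(1) W.inv_closed by blast
  hence sub: "set ss1 \<subseteq> carrier W" "set ss2 \<subseteq> carrier W" using ss by blast+
  have "wprod (ss1 @ ss2) = h1 \<otimes>\<^bsub>W\<^esub> h2"
    using W.foldr_mult_one(1)[OF sub(1) W.foldr_mult_one(2)[OF sub(2) W.one_closed]] ss by simp
  thus ?case using ss by (intro exI[of _ "ss1 @ ss2"]) auto
qed

lemma word_length_ge_wr_weight:
  assumes S: "PCwr H X S" and gen: "generate W S = carrier W" and h: "h \<in> carrier W"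
  shows "wr_weight h \<le> word_length W S h"
proof -
  define P where "P = (\<lambda>n. \<exists>ss. length ss = n \<and> set ss \<subseteq> S \<union> m_inv W ` S \<and> h = wprod ss)"
  have "S \<subseteq> carrier W" using PCwr_letters[OF S] letter_on_closed[OF order.refl] by blast
  from generate_word[OF this] gen h have "\<exists>n. P n" unfolding P_def by blast
  hence "P (LEAST n. P n)" by (rule LeastI_ex)
  hence "P (word_length W S h)" by (simp add: word_length_def P_def)
  then obtain ss where ss: "length ss = word_length W S h" "set ss \<subseteq> S \<union> m_inv W ` S"
    "h = wprod ss" by (auto simp: P_def)
  have "wr_weight (wprod ss) \<le> length ss"
    by (rule wr_weight_le_length) (use PCwr_letters[OF S] ss(2) in blast)
  thus ?thesis using ss by simp
qed

text \<open>The weight is constant on the class and bounds every word length in it from below; the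
  word of \<open>config_realizable\<close> for the same cycle type lies in the class and attains the
  bound.\<close>

lemma conj_length_eq_wr_weight:
  assumes S: "PCwr H X S" and gen: "generate W S = carrier W" and g: "g \<in> carrier W"
  shows "conj_length W S g = wr_weight g"
proof -
  have class_weight: "h \<in> carrier W \<and> wr_weight h = wr_weight g" if "h \<in> conj_class W g" for h
  proof -
    have hW: "h \<in> carrier W" using that W.conj_class_closed[OF g] by blast
    hence "conj_class W g = conj_class W h" using that W.conj_class_eq_iff[OF g] by blast
    thus ?thesis using conj_class_wreath_eq_iff[OF g hW] wr_weight_cong hW by metis
  qed
  obtain ss where ss: "set ss \<subseteq> S" "length ss = wr_weight g" "wprod ss \<in> carrier W"
    "cycle_type (wprod ss) = cycle_type g"
    using config_realizable[OF S cycle_type_in_configs[OF g]] by blast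
  define h where "h = wprod ss"
  have h: "h \<in> conj_class W g"
    using ss conj_class_wreath_eq_iff[OF g ss(3)] W.conj_class_eq_iff[OF g ss(3)] by (simp add: h_def)
  have "word_length W S h \<le> wr_weight g"
    unfolding word_length_def using ss by (intro Least_le exI[of _ ss]) (auto simp: h_def)
  hence "word_length W S h = wr_weight g"
    using word_length_ge_wr_weight[OF S gen] class_weight[OF h] by (metis order.antisym)
  thus ?thesis
    unfolding conj_length_def using h word_length_ge_wr_weight[OF S gen] class_weight
    by (intro Least_equality) (metis, metis)
qed

text \<open>Classes correspond to the cycle types of chosen representatives; by
  \<open>conj_class_wreath_eq_iff\<close> the choice is immaterial and the correspondence injective,
  and \<open>config_realizable\<close> shows that every configuration occurs.\<close>

lemma conj_growth_eq_card_configs: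
  assumes S: "PCwr H X S" and gen: "generate W S = carrier W"
  shows "conj_growth W S n = card (configs tags tag_weight n)"
proof -
  define A where "A = {g \<in> carrier W. wr_weight g = n}"
  have types: "cycle_type ` A = configs tags tag_weight n"
  proof safe
    fix g assume "g \<in> A"
    thus "cycle_type g \<in> configs tags tag_weight n" using cycle_type_in_configs[of g] by (auto simp: A_def)
  next
    fix c assume c: "c \<in> configs tags tag_weight n"
    then obtain g where g: "g \<in> carrier W" "cycle_type g = c" using config_realizable[OF S] by blast
    have "wr_weight g = n" using c g by (simp add: wr_weight_def configs_def)
    thus "c \<in> cycle_type ` A" using g by (auto simp: A_def)
  qed
  have "{conj_class W g | g. g \<in> carrier W \<and> conj_length W S g = n} = conj_class W ` A"
    using conj_length_eq_wr_weight[OF S gen] by (auto simp: A_def)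
  moreover have "bij_betw (\<lambda>C. cycle_type (SOME g. g \<in> A \<and> conj_class W g = C)) (conj_class W ` A) (cycle_type ` A)"
  proof (rule bij_betwI')
    define r where "r = (\<lambda>C. SOME g. g \<in> A \<and> conj_class W g = C)"
    have r: "r C \<in> A \<and> conj_class W (r C) = C" if C: "C \<in> conj_class W ` A" for C
      unfolding r_def by (rule someI_ex) (use C in blast)
    have eq: "conj_class W g = conj_class W h \<longleftrightarrow> cycle_type g = cycle_type h" if "g \<in> A" "h \<in> A" for g h
      using that conj_class_wreath_eq_iff by (simp add: A_def)
    show "cycle_type (r C) = cycle_type (r D) \<longleftrightarrow> C = D" if "C \<in> conj_class W ` A" "D \<in> conj_class W ` A" for C D
      using r[OF that(1)] r[OF that(2)] eq by metis
    show "cycle_type (r C) \<in> cycle_type ` A" if "C \<in> conj_class W ` A" for C using r[OF that] by blast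
    show "\<exists>C\<in>conj_class W ` A. c = cycle_type (r C)" if c: "c \<in> cycle_type ` A" for c
    proof -
      obtain g where g: "g \<in> A" "c = cycle_type g" using c by blast
      hence "conj_class W g \<in> conj_class W ` A" by blast
      thus ?thesis using r eq g by metis
    qed
  qed
  ultimately show ?thesis unfolding conj_growth_def types[symmetric] by (simp add: bij_betw_same_card)
qed

text \<open>Each class of \<open>H\<close> attains a given weight m > 0 exactly once, with length m
  + 1 if the class is trivial and length m otherwise. This is why all factors of the growth series
  carry the same exponent M.\<close>

lemma card_tags_of_weight:
  assumes "m > 0"
  shows "bij_betw (\<lambda>C. if C = {\<one>} then (C, Suc m) else (C, m)) (conj_class H ` carrier H) {\<tau> \<in> tags. tag_weight \<tau> = m}"
proof -
  define K where "K = conj_class H ` carrier H"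
  show ?thesis
    unfolding tags_def K_def[symmetric]
    by (rule bij_betw_byWitness[where f' = fst])
       (use assms in \<open>auto simp: tag_weight_def image_subset_iff split: if_splits\<close>)
qed

end

theorem corollary4:
  fixes H :: "('h, 'm) monoid_scheme"
    and X :: "'x set"
    and S :: "(('x \<Rightarrow> 'h) \<times> ('x \<Rightarrow> 'x)) set"
    and M :: nat
  assumes "group H"
    and "finite (carrier H)"
    and "infinite X"
    and "M = num_conj_classes H"
    and "generate (wreath H X) S = carrier (wreath H X)"
    and "PCwr H X S"
  shows "(\<lambda>n. real (conj_growth (wreath H X) S n)) \<sim>[at_top]
    (\<lambda>n. (real M powr ((1 + real M) / 4) /
            (2 powr ((5 + 3 * real M) / 4) * 3 powr ((1 + real M) / 4)
              * real n powr ((3 + real M) / 4)))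
         * exp (pi * sqrt (2 * real n * real M / 3)))"
proof -
  interpret fin_wreath H X by (rule fin_wreath.intro[OF assms(1)])
  have classes: "conj_class H ` carrier H = {conj_class H g | g. g \<in> carrier H}" by blast
  have M: "M = card (conj_class H ` carrier H)"
    using assms(4) unfolding num_conj_classes_def classes .
  have M_pos: "M > 0" using assms(2) M by (auto simp: card_gt_0_iff)
  note bij = card_tags_of_weight
  have "(\<lambda>n. complex_of_real (real (card (configs tags tag_weight n))) * w ^ n) sums exp (of_nat M * lambert w)"
    if "norm w < 1" for w :: complex
    unfolding of_real_of_nat_eq
  proof (rule configs_gf[OF _ _ _ that])
    \<comment> \<open>The tag excluded from \<open>tags\<close> is the only one with positive length
      and weight 0.\<close>
    show "tag_weight \<tau> > 0" if "\<tau> \<in> tags" for \<tau>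
      using that unfolding tags_def tag_weight_def by (cases \<tau>) auto
    show "finite {\<tau> \<in> tags. tag_weight \<tau> = m}" if "m > 0" for m
      using bij_betw_finite[OF bij[OF that]] assms(2) by simp
    show "card {\<tau> \<in> tags. tag_weight \<tau> = m} = M" if "m > 0" for m
      using bij_betw_same_card[OF bij[OF that]] M by simp
  qed
  from power_series_exp_lambert_coeff_asymp[OF M_pos this]
  show ?thesis unfolding conj_growth_eq_card_configs[OF assms(6,5)] .
qed

end
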